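(* Let $1<p<\infty$ and let $(T_n)_n$ be a uniformly bounded sequence of strongly translatable, sublinear and monotone operators from $L_p([0,1])$ into $L_p([0,1])$. Denote $\mu_n=\|T_n((e_1-x)^2)(x)\|_{\infty}$ and $$t_{n,p}=\left(\max\{\|T_n(e_0)-e_0\|_p,\ \|T_n(|e_1-x|)(x)\|_p,\ \mu_n\}\right)^{1/2}.$$ Suppose that $\lim_{n\to\infty}t_{n,p}=0$. Then for any $f\in L_p([0,1])$ we have $$\|T_n(f)-f\|_p\le M_p\left[t_{n,p}^2\,\|f\|_p+\omega_{2,p}(f;t_{n,p})\right],$$ where $M_p>0$ is independent of $f$ and $n$.
   Context: Functions are real-valued; $e_0(t)=1$, $e_1(t)=t$ on $[0,1]$; $\|\cdot\|_p$ is the norm of $L_p([0,1])$, ordered almost everywhere. An operator $T:L_p([0,1])\to L_p([0,1])$ (not assumed linear) is called: - sublinear if $T(f+g)\le T(f)+T(g)$ and $T(\alpha f)=\alpha T(f)$ for all $f,g$ and $\alpha\ge 0$; - monotone if $f\le g$ implies $T(f)\le T(g)$; - strongly translatable if $T(f+\alpha\cdot 1)=T(f)+\alpha T(1)$ for all $f$ and all $\alpha\in\mathbb{R}$. The norm is $\|T\|=\sup\{\|T(f)\|_p:\|f\|_p\le 1\}$; the sequence $(T_n)_n$ is uniformly bounded if $\sup_n\|T_n\|<\infty$. $T_n((e_1-x)^2)(x)$ denotes the function of $x$ obtained by applying $T_n$, for each fixed $x\in[0,1]$, to the function $t\mapsto(t-x)^2$ and evaluating the result at the point $x$; similarly $T_n(|e_1-x|)(x)$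 with $t\mapsto|t-x|$. These functions of $x$ are understood almost everywhere: representatives of the $T_n((e_1-x)^2)$, $x\in[0,1]$ (respectively of the $T_n(|e_1-x|)$) are chosen so that, for almost every $y$, the value at $y$ depends continuously on the parameter $x$. The norms $\|\cdot\|_p$, $\|\cdot\|_\infty$ of these expressions are taken with respect to $x\in[0,1]$. The second order modulus of smoothness is $$\omega_{2,p}(f;\delta)=\sup_{|h|\le\delta}\|\Delta_h^2 f\|_p,\qquad \Delta_h^2 f(x)=f(x+2h)-2f(x+h)+f(x),$$ where the $L_p$ norm is taken over those $x\in[0,1]$ with $x+2h\in[0,1]$. *)

theory Defs
  imports "HOL-Probability.Essential_Supremum"
begin

section \<open>Norms\<close>

text \<open>Only used for exponents \<open>a > 0\<close>, hence \<open>\<infinity>\<close> is mapped to \<open>\<infinity>\<close>.\<close>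

definition ennreal_powr :: "ennreal \<Rightarrow> real \<Rightarrow> ennreal" where
  "ennreal_powr c a = (if c = \<infinity> then \<infinity> else ennreal (enn2real c powr a))"

definition Lp_norm :: "real \<Rightarrow> 'a measure \<Rightarrow> ('a \<Rightarrow> real) \<Rightarrow> ennreal" where
  "Lp_norm p M f = ennreal_powr (\<integral>\<^sup>+ x. ennreal (\<bar>f x\<bar> powr p) \<partial>M) (1 / p)"

definition Linf_norm :: "'a measure \<Rightarrow> ('a \<Rightarrow> real) \<Rightarrow> ennreal" where
  "Linf_norm M f = esssup M (\<lambda>x. ennreal \<bar>f x\<bar>)"

abbreviation unit_leb :: "real measure" where
  "unit_leb \<equiv> lebesgue_on {0..1}"

text \<open>
  Elements of \<open>L_p([0,1])\<close> are represented by functions on the reals of which only the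
  almost-everywhere class on the unit interval matters; equality and order in \<open>L_p\<close> become
  almost-everywhere equality and order of representatives.
\<close>

definition Lp_space :: "real \<Rightarrow> (real \<Rightarrow> real) set" where
  "Lp_space p = {f \<in> borel_measurable unit_leb. Lp_norm p unit_leb f < \<infinity>}"


section \<open>Operators on \<open>L_p([0,1])\<close>\<close>

type_synonym fun_op = "(real \<Rightarrow> real) \<Rightarrow> real \<Rightarrow> real"

text \<open>The second conjunct makes \<open>T\<close> well defined on almost-everywhere classes.\<close>

definition Lp_operator :: "real \<Rightarrow> fun_op \<Rightarrow> bool" where
  "Lp_operator p T \<longleftrightarrow>
     (\<forall>f\<in>Lp_space p. T f \<in> Lp_space p) \<and>
     (\<forall>f\<in>Lp_space p. \<forall>g\<in>Lp_space p.
        (AE x in unit_leb. f x = g x) \<longrightarrow> (AE x in unit_leb. T f x = T g x))"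

definition sublinear_op :: "real \<Rightarrow> fun_op \<Rightarrow> bool" where
  "sublinear_op p T \<longleftrightarrow>
     (\<forall>f\<in>Lp_space p. \<forall>g\<in>Lp_space p.
        AE x in unit_leb. T (\<lambda>t. f t + g t) x \<le> T f x + T g x) \<and>
     (\<forall>f\<in>Lp_space p. \<forall>\<alpha>::real. \<alpha> \<ge> 0 \<longrightarrow>
        (AE x in unit_leb. T (\<lambda>t. \<alpha> * f t) x = \<alpha> * T f x))"

definition monotone_op :: "real \<Rightarrow> fun_op \<Rightarrow> bool" where
  "monotone_op p T \<longleftrightarrow>
     (\<forall>f\<in>Lp_space p. \<forall>g\<in>Lp_space p.
        (AE x in unit_leb. f x \<le> g x) \<longrightarrow> (AE x in unit_leb. T f x \<le> T g x))"

definition strongly_translatable_op :: "real \<Rightarrow> fun_op \<Rightarrow> bool" where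
  "strongly_translatable_op p T \<longleftrightarrow>
     (\<forall>f\<in>Lp_space p. \<forall>\<alpha>::real.
        AE x in unit_leb. T (\<lambda>t. f t + \<alpha>) x = T f x + \<alpha> * T (\<lambda>t. 1) x)"

definition op_norm :: "real \<Rightarrow> fun_op \<Rightarrow> ennreal" where
  "op_norm p T =
     (SUP f\<in>{f \<in> Lp_space p. Lp_norm p unit_leb f \<le> 1}. Lp_norm p unit_leb (T f))"

definition uniformly_bounded_ops :: "real \<Rightarrow> (nat \<Rightarrow> fun_op) \<Rightarrow> bool" where
  "uniformly_bounded_ops p T \<longleftrightarrow> (SUP n. op_norm p (T n)) < \<infinity>"


section \<open>The functions \<open>T(\<phi> x)(x)\<close>\<close>

text \<open>
  Each \<open>T (\<phi> x)\<close> is only determined up to a null set, which may vary with \<open>x\<close>. Hence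
  \<open>T (\<phi> x) x\<close> is formed from representatives \<open>F x\<close> of \<open>T (\<phi> x)\<close> whose values at almost every
  point \<open>y\<close> are continuous in the parameter \<open>x\<close>. The lemmas below show that such
  representatives exist for the operators and families of interest and that the resulting
  function is determined almost everywhere.
\<close>

definition continuous_rep ::
  "fun_op \<Rightarrow> (real \<Rightarrow> real \<Rightarrow> real) \<Rightarrow> (real \<Rightarrow> real \<Rightarrow> real) \<Rightarrow> bool" where
  "continuous_rep T \<phi> F \<longleftrightarrow>
     (\<forall>x\<in>{0..1}. AE y in unit_leb. F x y = T (\<phi> x) y) \<and>
     (AE y in unit_leb. continuous_on {0..1} (\<lambda>x. F x y))"

definition diag_eval :: "fun_op \<Rightarrow> (real \<Rightarrow> real \<Rightarrow> real) \<Rightarrow> real \<Rightarrow> real" where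
  "diag_eval T \<phi> x = (SOME F. continuous_rep T \<phi> F) x x"

lemma closure_rational_unit: "closure (\<rat> \<inter> {0..1}) = {0..1::real}"
  using closure_convex_Int_superset[of "{0..1::real}" "\<rat>"]
  by (simp add: Rats_closure_real Int_commute)

lemma continuous_rep_unique:
  assumes "continuous_rep T \<phi> F" "continuous_rep T \<phi> G"
  shows "AE y in unit_leb. F y y = G y y"
proof -
  define Q where "Q = \<rat> \<inter> {0..1::real}"
  have cQ: "countable Q" unfolding Q_def by (simp add: countable_rat)
  have clQ: "closure Q = {0..1}" unfolding Q_def by (rule closure_rational_unit)
  have "AE y in unit_leb. \<forall>q\<in>Q. F q y = G q y"
  proof (subst AE_ball_countable[OF cQ], intro ballI)
    fix q assume "q \<in> Q"
    then have "q \<in> {0..1}" by (simp add: Q_def)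
    with assms have "AE y in unit_leb. F q y = T (\<phi> q) y" "AE y in unit_leb. G q y = T (\<phi> q) y"
      unfolding continuous_rep_def by blast+
    then show "AE y in unit_leb. F q y = G q y" by eventually_elim simp
  qed
  moreover have "AE y in unit_leb. continuous_on {0..1} (\<lambda>x. F x y)"
    "AE y in unit_leb. continuous_on {0..1} (\<lambda>x. G x y)"
    using assms unfolding continuous_rep_def by blast+
  moreover have "AE y in unit_leb. y \<in> {0..1}" by (rule AE_I2) simp
  ultimately show ?thesis
  proof eventually_elim
    case (elim y)
    have "continuous_on (closure Q) (\<lambda>x. F x y - G x y)"
      unfolding clQ using elim by (intro continuous_intros)
    moreover have "\<And>x. x \<in> Q \<Longrightarrow> F x y - G x y = 0"
      using elim by simp
    moreover have "y \<in> closure Q"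
      unfolding clQ using elim by simp
    ultimately have "F y y - G y y = 0"
      by (rule continuous_constant_on_closure)
    then show ?case by simp
  qed
qed

lemma continuous_imp_Lp_space:
  assumes "continuous_on {0..1} f" "p > 0"
  shows "f \<in> Lp_space p"
proof -
  have meas: "f \<in> borel_measurable unit_leb"
    by (rule continuous_imp_measurable_on_sets_lebesgue[OF assms(1)]) simp
  have "compact (f ` {0..1})"
    by (rule compact_continuous_image[OF assms(1)]) simp
  then have "bounded (f ` {0..1})"
    by (rule compact_imp_bounded)
  then obtain B where B: "\<And>x. x \<in> {0..1} \<Longrightarrow> \<bar>f x\<bar> \<le> B"
    unfolding bounded_iff by (force simp del: atLeastAtMost_iff)
  have "(\<integral>\<^sup>+ x. ennreal (\<bar>f x\<bar> powr p) \<partial>unit_leb) \<le> (\<integral>\<^sup>+ x. ennreal (B powr p) \<partial>unit_leb)"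
    using assms(2) by (intro nn_integral_mono ennreal_leI powr_mono2 B) auto
  also have "\<dots> < \<infinity>"
    by (simp add: emeasure_restrict_space ennreal_mult_less_top)
  finally have "Lp_norm p unit_leb f < \<infinity>"
    by (simp add: Lp_norm_def ennreal_powr_def)
  with meas show ?thesis by (simp add: Lp_space_def)
qed

lemma continuous_rep_exists:
  assumes p: "p > 0" and T: "Lp_operator p T" "sublinear_op p T" "monotone_op p T"
    and cont: "\<And>x. x \<in> {0..1} \<Longrightarrow> continuous_on {0..1} (\<phi> x)"
    and lip: "\<And>x x' t. \<lbrakk>x \<in> {0..1}; x' \<in> {0..1}; t \<in> {0..1}\<rbrakk> \<Longrightarrow> \<bar>\<phi> x t - \<phi> x' t\<bar> \<le> L * \<bar>x - x'\<bar>"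
  shows "\<exists>F. continuous_rep T \<phi> F"
proof -
  define Q where "Q = \<rat> \<inter> {0..1::real}"
  have cQ: "countable Q" unfolding Q_def by (simp add: countable_rat)
  have clQ: "closure Q = {0..1}" unfolding Q_def by (rule closure_rational_unit)
  have Q01: "Q \<subseteq> {0..1}" by (simp add: Q_def)
  define c where "c y = \<bar>L * T (\<lambda>t. 1) y\<bar>" for y
  have L: "0 \<le> L"
    using lip[of 0 1 0] by simp
  have half: "AE y in unit_leb. T (\<phi> x) y - T (\<phi> x') y \<le> c y * \<bar>x - x'\<bar>"
    if x: "x \<in> {0..1}" "x' \<in> {0..1}" for x x'
  proof -
    define d where "d = L * \<bar>x - x'\<bar>"
    have d: "0 \<le> d" using L by (simp add: d_def)
    have mem: "\<phi> x \<in> Lp_space p" "\<phi> x' \<in> Lp_space p" "(\<lambda>t. 1) \<in> Lp_space p"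
      "(\<lambda>t. d * 1) \<in> Lp_space p" "(\<lambda>t. \<phi> x' t + d * 1) \<in> Lp_space p"
      using x by (intro continuous_imp_Lp_space p continuous_intros cont; simp)+
    have "AE t in unit_leb. \<phi> x t \<le> \<phi> x' t + d * 1"
    proof (rule AE_I2)
      fix t assume "t \<in> space unit_leb"
      then have "\<bar>\<phi> x t - \<phi> x' t\<bar> \<le> d"
        unfolding d_def by (intro lip x) simp
      then show "\<phi> x t \<le> \<phi> x' t + d * 1" by linarith
    qed
    then have "AE y in unit_leb. T (\<phi> x) y \<le> T (\<lambda>t. \<phi> x' t + d * 1) y"
      by (rule T(3)[unfolded monotone_op_def, rule_format, OF mem(1,5)])
    moreover have "AE y in unit_leb. T (\<lambda>t. \<phi> x' t + d * 1) y \<le> T (\<phi> x') y + T (\<lambda>t. d * 1) y"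
      by (rule T(2)[unfolded sublinear_op_def, THEN conjunct1, rule_format, OF mem(2,4)])
    moreover have "AE y in unit_leb. T (\<lambda>t. d * 1) y = d * T (\<lambda>t. 1) y"
      by (rule T(2)[unfolded sublinear_op_def, THEN conjunct2, rule_format, OF mem(3) d])
    ultimately show ?thesis
    proof eventually_elim
      case (elim y)
      have "d * T (\<lambda>t. 1) y = (L * T (\<lambda>t. 1) y) * \<bar>x - x'\<bar>" by (simp add: d_def)
      also have "\<dots> \<le> c y * \<bar>x - x'\<bar>" unfolding c_def by (intro mult_right_mono) auto
      finally show ?case using elim by simp
    qed
  qed
  have full: "AE y in unit_leb. \<bar>T (\<phi> x) y - T (\<phi> x') y\<bar> \<le> c y * \<bar>x - x'\<bar>"
    if "x \<in> {0..1}" "x' \<in> {0..1}" for x x'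
    using half[OF that] half[OF that(2,1)]
    by eventually_elim (simp add: abs_le_iff abs_minus_commute)
  define ext where "ext y g \<longleftrightarrow> continuous_on {0..1} g \<and> (\<forall>q\<in>Q. g q = T (\<phi> q) y)" for y g
  define F where "F x y = (SOME g. ext y g) x" for x y
  have "AE y in unit_leb. \<forall>q\<in>Q. \<forall>q'\<in>Q. \<bar>T (\<phi> q) y - T (\<phi> q') y\<bar> \<le> c y * \<bar>q - q'\<bar>"
    using Q01 full by (simp add: AE_ball_countable[OF cQ] subset_iff)
  then have ext: "AE y in unit_leb. ext y (\<lambda>x. F x y)"
  proof eventually_elim
    case (elim y)
    have "(c y)-lipschitz_on Q (\<lambda>q. T (\<phi> q) y)"
      using elim by (intro lipschitz_onI) (auto simp: dist_real_def c_def)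
    then have "uniformly_continuous_on Q (\<lambda>q. T (\<phi> q) y)"
      by (rule lipschitz_on_uniformly_continuous)
    then obtain g where "uniformly_continuous_on (closure Q) g" "\<And>q. q \<in> Q \<Longrightarrow> T (\<phi> q) y = g q"
      by (rule uniformly_continuous_on_extension_on_closure) (rule that)
    then have "ext y g"
      unfolding ext_def clQ using uniformly_continuous_imp_continuous by auto
    then have "ext y (SOME g. ext y g)" by (rule someI[of "ext y"])
    then show ?case by (simp add: F_def)
  qed
  have "AE y in unit_leb. F x y = T (\<phi> x) y" if x: "x \<in> {0..1}" for x
  proof -
    have "AE y in unit_leb. \<forall>q\<in>Q. \<bar>T (\<phi> x) y - T (\<phi> q) y\<bar> \<le> c y * \<bar>x - q\<bar>"
      using Q01 full[OF x] by (simp add: AE_ball_countable[OF cQ] subset_iff)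
    with ext show ?thesis
    proof eventually_elim
      case (elim y)
      have "continuous_on (closure Q) (\<lambda>z. max 0 (\<bar>T (\<phi> x) y - F z y\<bar> - c y * \<bar>x - z\<bar>))"
        using elim unfolding ext_def clQ by (intro continuous_intros) auto
      moreover have "max 0 (\<bar>T (\<phi> x) y - F z y\<bar> - c y * \<bar>x - z\<bar>) = 0" if "z \<in> Q" for z
        using elim that unfolding ext_def by auto
      moreover have "x \<in> closure Q" using x clQ by simp
      ultimately have "max 0 (\<bar>T (\<phi> x) y - F x y\<bar> - c y * \<bar>x - x\<bar>) = 0"
        by (rule continuous_constant_on_closure)
      then show ?case by simp
    qed
  qed
  moreover have "AE y in unit_leb. continuous_on {0..1} (\<lambda>x. F x y)"
    using ext by eventually_elim (simp add: ext_def)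
  ultimately show ?thesis unfolding continuous_rep_def by blast
qed

lemma continuous_rep_exists_abs:
  assumes "p > 0" "Lp_operator p T" "sublinear_op p T" "monotone_op p T"
  shows "\<exists>F. continuous_rep T (\<lambda>x t. \<bar>t - x\<bar>) F"
proof (rule continuous_rep_exists[OF assms, where L = 1])
  show "continuous_on {0..1} (\<lambda>t. \<bar>t - x\<bar>)" for x :: real
    by (intro continuous_intros)
  show "\<bar>\<bar>t - x\<bar> - \<bar>t - x'\<bar>\<bar> \<le> 1 * \<bar>x - x'\<bar>" for x x' t :: real
    using abs_triangle_ineq3[of "t - x" "t - x'"] by (simp add: abs_minus_commute)
qed

lemma continuous_rep_exists_square:
  assumes "p > 0" "Lp_operator p T" "sublinear_op p T" "monotone_op p T"
  shows "\<exists>F. continuous_rep T (\<lambda>x t. (t - x)\<^sup>2) F"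
proof (rule continuous_rep_exists[OF assms, where L = 2])
  show "continuous_on {0..1} (\<lambda>t. (t - x)\<^sup>2)" for x :: real
    by (intro continuous_intros)
next
  fix x x' t :: real assume "x \<in> {0..1}" "x' \<in> {0..1}" "t \<in> {0..1}"
  then have "\<bar>2 * t - x - x'\<bar> * \<bar>x - x'\<bar> \<le> 2 * \<bar>x - x'\<bar>"
    by (intro mult_right_mono) auto
  also have "\<bar>2 * t - x - x'\<bar> * \<bar>x - x'\<bar> = \<bar>(t - x)\<^sup>2 - (t - x')\<^sup>2\<bar>"
    unfolding abs_mult[symmetric]
    by (subst abs_minus_cancel[symmetric]) (simp add: power2_eq_square algebra_simps)
  finally show "\<bar>(t - x)\<^sup>2 - (t - x')\<^sup>2\<bar> \<le> 2 * \<bar>x - x'\<bar>" .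
qed


section \<open>Degree of approximation and modulus of smoothness\<close>

text \<open>
  The supremum norm \<open>mu_param\<close>, and therefore \<open>t_param\<close>, may be infinite for individual
  operators; both are extended nonnegative reals.
\<close>

definition mu_param :: "fun_op \<Rightarrow> ennreal" where
  "mu_param T = Linf_norm unit_leb (diag_eval T (\<lambda>x t. (t - x)\<^sup>2))"

definition t_param :: "real \<Rightarrow> fun_op \<Rightarrow> ennreal" where
  "t_param p T = ennreal_powr
     (Max {Lp_norm p unit_leb (\<lambda>x. T (\<lambda>t. 1) x - 1),
           Lp_norm p unit_leb (diag_eval T (\<lambda>x t. \<bar>t - x\<bar>)),
           mu_param T}) (1 / 2)"

definition second_difference :: "real \<Rightarrow> (real \<Rightarrow> real) \<Rightarrow> real \<Rightarrow> real" where
  "second_difference h f x = f (x + 2 * h) - 2 * f (x + h) + f x"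

definition omega2 :: "real \<Rightarrow> (real \<Rightarrow> real) \<Rightarrow> ennreal \<Rightarrow> ennreal" where
  "omega2 p f \<delta> =
     (SUP h\<in>{h. ennreal \<bar>h\<bar> \<le> \<delta>}.
        Lp_norm p (lebesgue_on {x \<in> {0..1}. x + 2 * h \<in> {0..1}}) (second_difference h f))"

end

theory Submission
  imports Defs
begin

text \<open>
  For \<open>g\<close> of class \<open>C\<^sup>2\<close>, \<open>\<bar>g t - g x\<bar> \<le> \<bar>g' x\<bar> \<bar>t - x\<bar> + A x (t - x)\<^sup>2\<close> on the unit interval, where
  \<open>A\<close> is the maximal function of \<open>\<bar>g''\<bar>\<close>. Strong translatability, sublinearity and monotonicity turn this
  into a bound for \<open>T g y - g x T 1 y\<close>, first for almost every \<open>y\<close> and all rational \<open>x\<close>; as \<open>A\<close>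
  is continuous, it extends to \<open>x = y\<close>. The maximal inequality (this is where \<open>p > 1\<close> enters) and the
  bound of \<open>sup \<bar>g\<bar>\<close> and \<open>sup \<bar>g'\<bar>\<close> by the norms of \<open>g\<close> and \<open>g''\<close> give
  \<open>\<parallel>T g - g\<parallel> \<le> C t\<^sup>2 (\<parallel>g\<parallel> + \<parallel>g''\<parallel>)\<close>.

  A general \<open>f\<close> is first replaced by a polynomial. For \<open>0 < t \<le> 1/16\<close> this is compared with a
  \<open>g\<close> satisfying \<open>\<parallel>f - g\<parallel> + t\<^sup>2 \<parallel>g''\<parallel> \<le> C \<omega>\<^sub>2(f; t)\<close>: iterated Steklov means with forward
  steps near the left endpoint and with backward steps near the right one, glued by a cutoff function.
  For \<open>t = 0\<close> the polynomial itself serves as \<open>g\<close>, and for \<open>t > 1/16\<close> boundedness of \<open>T\<close> suffices.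

  Constants are irrelevant, so everything is done with integrals of \<open>p\<close>-th powers and the
  inequality \<open>(a + b)\<^sup>p \<le> 2\<^sup>p (a\<^sup>p + b\<^sup>p)\<close> in place of Minkowski's inequality.
\<close>

section \<open>Integrals of \<open>p\<close>-th powers\<close>

text \<open>The two diagonal functions are measured in different norms, and this fixes the shape of
  the Taylor estimate. The one of \<open>|t - x|\<close> is small only in \<open>L_p\<close>, so its
  coefficient must be bounded: it is \<open>g' x\<close>, controlled by a one-dimensional embedding.
  The one of \<open>(t - x)^2\<close> is small uniformly, so its coefficient need only lie in
  \<open>L_p\<close>; a maximal function of \<open>|g''|\<close> does, whereas
  \<open>sup |g''|\<close> would not be controlled by the norm of \<open>g''\<close>.

  The second obstacle is the boundary. A mean built from second differences and iterated with step
  \<open>h\<close> looks \<open>4 * h\<close> ahead, so a forward mean approximates only on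
  \<open>{0..1 - 4 * h}\<close>. Asking for \<open>h \<le> 1/16\<close> leaves
  \<open>{0..3/4}\<close> and, by reflection, \<open>{1/4..1}\<close>, which overlap enough for
  gluing.

  The polynomial is a device: \<open>f\<close> is arbitrary off the unit interval and need not be
  continuous, whereas the means are taken of continuous functions on the whole line. No constant
  depends on the polynomial or on its distance \<open>e\<close> to \<open>f\<close>, so
  \<open>e\<close> tends to \<open>0\<close> at the end.\<close>

definition pint :: "real \<Rightarrow> real set \<Rightarrow> (real \<Rightarrow> real) \<Rightarrow> ennreal" where
  "pint p S f = (\<integral>\<^sup>+ x. ennreal (\<bar>f x\<bar> powr p) \<partial>lebesgue_on S)"

text \<open>\<open>nn_integral\<close> is the same for a measure and its completion, even for
  non-measurable functions, so nothing is asked of \<open>f\<close>. Over \<open>lborel\<close>,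
  Fubini and affine substitution become available.\<close>

lemma pint_eq:
  assumes "S \<in> sets lebesgue"
  shows "pint p S f = (\<integral>\<^sup>+ x. ennreal (\<bar>f x\<bar> powr p) * indicator S x \<partial>lborel)"
  unfolding pint_def by (subst nn_integral_restrict_space) (use assms in \<open>auto simp: nn_integral_completion\<close>)

lemma pint_mono:
  assumes "S \<in> sets lebesgue" "S' \<in> sets lebesgue" "S \<subseteq> S'" "0 \<le> p"
    and "\<And>x. x \<in> S \<Longrightarrow> \<bar>f x\<bar> \<le> \<bar>g x\<bar>"
  shows "pint p S f \<le> pint p S' g"
  unfolding pint_eq[OF assms(1)] pint_eq[OF assms(2)]
  using assms(3-5) by (intro nn_integral_mono) (auto split: split_indicator intro!: ennreal_leI powr_mono2)

lemma powr_add_le: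
  assumes "0 \<le> a" "0 \<le> b" "0 \<le> (p::real)"
  shows "(a + b) powr p \<le> 2 powr p * (a powr p + b powr p)"
proof -
  have "(a + b) powr p \<le> (2 * max a b) powr p"
    using assms by (intro powr_mono2) auto
  also have "\<dots> = 2 powr p * (max a b powr p)"
    using assms by (simp add: powr_mult)
  also have "\<dots> \<le> 2 powr p * (a powr p + b powr p)"
    by (intro mult_left_mono) (auto simp: max_def)
  finally show ?thesis .
qed

lemma pint_le_add_AE:
  assumes "0 \<le> p" "f \<in> borel_measurable (lebesgue_on S)" "g \<in> borel_measurable (lebesgue_on S)"
    and "AE x in lebesgue_on S. \<bar>h x\<bar> \<le> \<bar>f x\<bar> + \<bar>g x\<bar>"
  shows "pint p S h \<le> ennreal (2 powr p) * (pint p S f + pint p S g)"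
proof -
  note [measurable] = assms(2,3)
  have "pint p S h \<le> (\<integral>\<^sup>+ x. ennreal (2 powr p) * (ennreal (\<bar>f x\<bar> powr p) + ennreal (\<bar>g x\<bar> powr p)) \<partial>lebesgue_on S)"
    unfolding pint_def
  proof (rule nn_integral_mono_AE, use assms(4) in eventually_elim)
    case (elim x)
    have "\<bar>h x\<bar> powr p \<le> (\<bar>f x\<bar> + \<bar>g x\<bar>) powr p"
      using elim assms(1) by (intro powr_mono2) auto
    also have "\<dots> \<le> 2 powr p * (\<bar>f x\<bar> powr p + \<bar>g x\<bar> powr p)"
      using assms(1) by (intro powr_add_le) auto
    finally show ?case
      by (simp add: ennreal_mult'[symmetric] ennreal_plus[symmetric] ennreal_leI del: ennreal_plus)
  qed
  also have "\<dots> = ennreal (2 powr p) * (pint p S f + pint p S g)"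
    unfolding pint_def by (simp add: nn_integral_cmult nn_integral_add)
  finally show ?thesis .
qed

lemmas pint_le_add = pint_le_add_AE[OF _ _ _ AE_I2]

lemma pint_cmult:
  assumes "f \<in> borel_measurable (lebesgue_on S)" "0 \<le> p"
  shows "pint p S (\<lambda>x. c * f x) = ennreal (\<bar>c\<bar> powr p) * pint p S f"
  unfolding pint_def using assms(1)
  by (subst nn_integral_cmult[symmetric]) (auto simp: abs_mult powr_mult ennreal_mult')

lemma pint_mono_AE:
  assumes "0 \<le> p" "AE x in lebesgue_on S. \<bar>f x\<bar> \<le> \<bar>g x\<bar>"
  shows "pint p S f \<le> pint p S g"
  unfolding pint_def
  by (rule nn_integral_mono_AE, use assms(2) in eventually_elim) (intro ennreal_leI powr_mono2, use assms(1) in auto)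

lemma borel_imp_lebesgue_on:
  assumes "(f :: real \<Rightarrow> real) \<in> borel_measurable borel"
  shows "f \<in> borel_measurable (lebesgue_on S)"
  by (rule measurable_restrict_space1, rule measurable_completion) (use assms in simp)

lemma borel_measurable_lebesgue_on_continuous:
  fixes f :: "real \<Rightarrow> real"
  assumes "continuous_on UNIV f"
  shows "f \<in> borel_measurable (lebesgue_on S)"
  by (intro borel_imp_lebesgue_on borel_measurable_continuous_onI assms)

section \<open>The Hardy-Littlewood maximal inequality\<close>

text \<open>Countable subadditivity with the sum written as an integral over
  \<open>count_space C\<close>: the Vitali lemma delivers a countable set of indices rather than a
  sequence.\<close>

lemma emeasure_UN_countable_le:
  assumes "countable C" "\<And>i. i \<in> C \<Longrightarrow> X i \<in> sets M"
  shows "emeasure M (\<Union>i\<in>C. X i) \<le> (\<integral>\<^sup>+ i. emeasure M (X i) \<partial>count_space C)"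
proof -
  have [measurable]: "(\<Union>i\<in>C. X i) \<in> sets M"
    using assms by auto
  have "emeasure M (\<Union>i\<in>C. X i) = (\<integral>\<^sup>+ x. indicator (\<Union>i\<in>C. X i) x \<partial>M)"
    by simp
  also have "\<dots> \<le> (\<integral>\<^sup>+ x. (\<integral>\<^sup>+ i. indicator (X i) x \<partial>count_space C) \<partial>M)"
  proof (rule nn_integral_mono)
    fix x
    show "indicator (\<Union>i\<in>C. X i) x \<le> (\<integral>\<^sup>+ i. indicator (X i) x \<partial>count_space C :: ennreal)"
    proof (cases "x \<in> (\<Union>i\<in>C. X i)")
      case True
      then obtain i where "i \<in> C" "x \<in> X i" by auto
      then have "1 \<le> (\<integral>\<^sup>+ i. indicator (X i) x \<partial>count_space C :: ennreal)"
        using nn_integral_ge_point[of i C "\<lambda>i. indicator (X i) x"] by simp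
      then show ?thesis
        using True by (auto simp del: UN_iff)
    qed simp
  qed
  also have "\<dots> = (\<integral>\<^sup>+ i. (\<integral>\<^sup>+ x. indicator (X i) x \<partial>M) \<partial>count_space C)"
    using assms by (intro nn_integral_count_space_nn_integral) auto
  also have "\<dots> = (\<integral>\<^sup>+ i. emeasure M (X i) \<partial>count_space C)"
    using assms by (intro nn_integral_cong) auto
  finally show ?thesis .
qed

text \<open>Intervals with large mean of \<open>H\<close> are thinned by Vitali's lemma to a
  disjoint subfamily whose fivefold enlargements cover \<open>E\<close>. The factor 5 is Vitali's,
  and disjointness bounds the sum of the masses by the total mass. Nothing ties \<open>E\<close> to
  a particular \<open>H\<close>, so the lemma can also be applied to a truncated function.\<close>

lemma maximal_weak_type:
  fixes H :: "real \<Rightarrow> ennreal"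
  assumes H: "H \<in> borel_measurable borel" and E: "E \<in> sets borel" and l: "0 < l"
    and cover: "\<And>x. x \<in> E \<Longrightarrow> \<exists>a b. a < b \<and> x \<in> {a..b} \<and> {a..b} \<subseteq> {0..1::real} \<and>
                   ennreal (l * (b - a)) \<le> (\<integral>\<^sup>+ u. H u * indicator {a..b} u \<partial>lborel)"
  shows "ennreal l * emeasure lborel E \<le> 5 * (\<integral>\<^sup>+ u. H u * indicator {0..1} u \<partial>lborel)"
proof -
  note [measurable] = H E
  obtain a b where ab: "\<And>x. x \<in> E \<Longrightarrow> a x < b x \<and> x \<in> {a x..b x} \<and> {a x..b x} \<subseteq> {0..1::real} \<and>
                   ennreal (l * (b x - a x)) \<le> (\<integral>\<^sup>+ u. H u * indicator {a x..b x} u \<partial>lborel)"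
    using cover by metis
  \<comment> \<open>Vitali's lemma speaks of balls, so each interval becomes the ball around its
    midpoint; lying in the unit interval bounds the radii.\<close>
  define c r where "c x = (a x + b x) / 2" and "r x = (b x - a x) / 2" for x
  have cb: "cball (c x) (r x) = {a x..b x}" for x
    by (auto simp: c_def r_def cball_eq_atLeastAtMost field_simps)
  have r: "0 < r x \<and> r x \<le> 1" if "x \<in> E" for x
  proof -
    have "a x \<in> {0..1}" "b x \<in> {0..1}" using ab[OF that] by auto
    then show ?thesis using ab[OF that] by (auto simp: r_def)
  qed
  have sub: "E \<subseteq> (\<Union>i\<in>E. cball (c i) (r i))"
    unfolding cb using ab by blast
  obtain C where C: "countable C" "C \<subseteq> E"
     "pairwise (\<lambda>i j. disjnt (cball (c i) (r i)) (cball (c j) (r j))) C"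
     "E \<subseteq> (\<Union>i\<in>C. cball (c i) (5 * r i))"
    by (rule Vitali_covering_lemma_cballs[OF sub r])
  have "emeasure lborel E \<le> emeasure lborel (\<Union>i\<in>C. cball (c i) (5 * r i))"
    using C by (intro emeasure_mono) auto
  also have "\<dots> \<le> (\<integral>\<^sup>+ i. emeasure lborel (cball (c i) (5 * r i)) \<partial>count_space C)"
    by (rule emeasure_UN_countable_le) (use C in auto)
  also have "\<dots> = (\<integral>\<^sup>+ i. 5 * ennreal (b i - a i) \<partial>count_space C)"
  proof (rule nn_integral_cong)
    fix i assume "i \<in> space (count_space C)"
    then have "i \<in> E" using C by auto
    have "cball (c i) (5 * r i) = {c i - 5 * r i..c i + 5 * r i}"
      by (simp add: cball_eq_atLeastAtMost)
    then have "emeasure lborel (cball (c i) (5 * r i)) = ennreal (5 * (b i - a i))"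
      using ab[OF \<open>i \<in> E\<close>] by (simp add: c_def r_def field_simps)
    then show "emeasure lborel (cball (c i) (5 * r i)) = 5 * ennreal (b i - a i)"
      using ennreal_mult'[of 5 "b i - a i"] by simp
  qed
  also have "\<dots> = 5 * (\<integral>\<^sup>+ i. ennreal (b i - a i) \<partial>count_space C)"
    by (simp add: nn_integral_cmult)
  finally have "ennreal l * emeasure lborel E \<le> ennreal l * (5 * (\<integral>\<^sup>+ i. ennreal (b i - a i) \<partial>count_space C))"
    by (rule mult_left_mono) simp
  also have "\<dots> = 5 * (\<integral>\<^sup>+ i. ennreal (l * (b i - a i)) \<partial>count_space C)"
    using l by (simp add: ennreal_mult' nn_integral_cmult mult_ac)
  also have "\<dots> \<le> 5 * (\<integral>\<^sup>+ i. (\<integral>\<^sup>+ u. H u * indicator {a i..b i} u \<partial>lborel) \<partial>count_space C)"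
    using ab C by (intro mult_left_mono nn_integral_mono) auto
  \<comment> \<open>The masses are those of the measure with density \<open>H\<close>, which is
    additive over the disjoint intervals.\<close>
  also have "(\<integral>\<^sup>+ i. (\<integral>\<^sup>+ u. H u * indicator {a i..b i} u \<partial>lborel) \<partial>count_space C) =
      (\<integral>\<^sup>+ i. emeasure (density lborel H) {a i..b i} \<partial>count_space C)"
    by (simp add: emeasure_density)
  also have "\<dots> = emeasure (density lborel H) (\<Union>i\<in>C. {a i..b i})"
    by (rule emeasure_UN_countable[symmetric])
       (use C in \<open>auto simp: cb disjoint_family_on_def pairwise_def disjnt_def\<close>)
  also have "\<dots> \<le> emeasure (density lborel H) {0..1}"
  proof (rule emeasure_mono)
    show "(\<Union>i\<in>C. {a i..b i}) \<subseteq> {0..1}" using ab C by blast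
  qed simp
  also have "\<dots> = (\<integral>\<^sup>+ u. H u * indicator {0..1} u \<partial>lborel)"
    by (simp add: emeasure_density)
  finally show ?thesis by (simp add: mult_left_mono)
qed

text \<open>Used with \<open>q = p\<close> to decompose a \<open>p\<close>-th power into layers, and
  with \<open>q = p - 1\<close> after the order of integration has been exchanged; the second use is
  where \<open>p > 1\<close> enters.\<close>

lemma nn_integral_powr_less:
  assumes "0 < q" "0 \<le> (c::real)"
  shows "(\<integral>\<^sup>+ l. ennreal (q * l powr (q - 1)) * indicator {0<..<c} l \<partial>lborel) = ennreal (c powr q)"
proof -
  have "((\<lambda>l. q * l powr (q - 1)) has_integral (q * (c powr (q - 1 + 1) / (q - 1 + 1)))) {0..c}"
    using assms by (intro has_integral_mult_right has_integral_powr_from_0) auto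
  then have "((\<lambda>l. q * l powr (q - 1)) has_integral c powr q) {0..c}"
    using assms by simp
  then have "((\<lambda>l. q * l powr (q - 1)) has_integral c powr q) {0<..<c}"
    by (subst has_integral_Icc_iff_Ioo[symmetric])
  from nn_integral_has_integral_lebesgue'[OF _ this] show ?thesis
    using assms by simp
qed

text \<open>Marcinkiewicz interpolation between the weak bound and the bound by the supremum: at
  level \<open>l\<close> only the values of \<open>H\<close> above \<open>l/2\<close> matter. Of the
  constant, \<open>10\<close> is twice the 5 of the weak bound, and the rest comes from integrating
  \<open>p * l powr (p - 2)\<close> over \<open>0 < l < 2 * H u\<close>.\<close>

lemma maximal_strong_type:
  fixes H A :: "real \<Rightarrow> real"
  assumes p: "1 < p" and H: "H \<in> borel_measurable borel" and A: "A \<in> borel_measurable borel"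
    and H0: "\<And>x. 0 \<le> H x" and A0: "\<And>x. x \<in> {0..1} \<Longrightarrow> 0 \<le> A x"
    and cover: "\<And>x l. \<lbrakk>x \<in> {0..1}; 0 < l; l < A x\<rbrakk> \<Longrightarrow>
         \<exists>a b. a < b \<and> x \<in> {a..b} \<and> {a..b} \<subseteq> {0..1::real} \<and>
            ennreal (l * (b - a)) \<le> (\<integral>\<^sup>+ u. ennreal (H u) * indicator {a..b} u \<partial>lborel)"
  shows "pint p {0..1} A \<le> ennreal (10 * p / (p - 1) * 2 powr (p - 1)) * pint p {0..1} H"
proof -
  note [measurable] = H A
  define E where "E l = {x\<in>{0..1}. l < A x}" for l
  have E[measurable]: "E l \<in> sets borel" for l unfolding E_def by measurable
  have weak: "ennreal l * emeasure lborel (E l)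
      \<le> 10 * (\<integral>\<^sup>+ u. ennreal (H u) * indicator {0<..} (H u - l/2) * indicator {0..1} u \<partial>lborel)"
    if l: "0 < l" for l
  proof -
    have "ennreal (l/2) * emeasure lborel (E l)
        \<le> 5 * (\<integral>\<^sup>+ u. ennreal (H u) * indicator {0<..} (H u - l/2) * indicator {0..1} u \<partial>lborel)"
    proof (rule maximal_weak_type)
      fix x assume "x \<in> E l"
      then obtain a b where ab: "a < b" "x \<in> {a..b}" "{a..b} \<subseteq> {0..1::real}"
        "ennreal (l * (b - a)) \<le> (\<integral>\<^sup>+ u. ennreal (H u) * indicator {a..b} u \<partial>lborel)"
        using cover[of x l] l unfolding E_def by blast
      let ?I = "(\<integral>\<^sup>+ u. ennreal (H u) * indicator {0<..} (H u - l/2) * indicator {a..b} u \<partial>lborel)"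
      have "ennreal (l/2 * (b - a)) + ennreal (l/2 * (b - a)) = ennreal (l * (b - a))"
        using ab l by (subst ennreal_plus[symmetric]) (auto simp: field_simps)
      also note ab(4)
      \<comment> \<open>Where \<open>H u\<close> is at most \<open>l/2\<close> it is absorbed by the
        constant \<open>l/2\<close>. These values use up at most half of the mean, so the truncated
        function keeps the other half.\<close>
      also have "(\<integral>\<^sup>+ u. ennreal (H u) * indicator {a..b} u \<partial>lborel) \<le>
        (\<integral>\<^sup>+ u. ennreal (H u) * indicator {0<..} (H u - l/2) * indicator {a..b} u + ennreal (l/2) * indicator {a..b} u \<partial>lborel)"
        by (intro nn_integral_mono) (auto split: split_indicator simp: ennreal_leI)
      also have "\<dots> = ?I + ennreal (l/2 * (b - a))"
        using ab l by (subst nn_integral_add) (auto simp: nn_integral_cmult_indicator ennreal_mult[symmetric])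
      finally have "ennreal (l/2 * (b - a)) + ennreal (l/2 * (b - a)) \<le> ennreal (l/2 * (b - a)) + ?I"
        unfolding add.commute[of ?I] .
      then have "ennreal (l/2 * (b - a)) \<le> ?I"
        unfolding ennreal_add_left_cancel_le by simp
      then show "\<exists>a b. a < b \<and> x \<in> {a..b} \<and> {a..b} \<subseteq> {0..1::real} \<and>
            ennreal (l/2 * (b - a)) \<le> (\<integral>\<^sup>+ u. ennreal (H u) * indicator {0<..} (H u - l/2) * indicator {a..b} u \<partial>lborel)"
        using ab by blast
    qed (use l in auto)
    then have "2 * (ennreal (l/2) * emeasure lborel (E l)) \<le>
      2 * (5 * (\<integral>\<^sup>+ u. ennreal (H u) * indicator {0<..} (H u - l/2) * indicator {0..1} u \<partial>lborel))"
      by (rule mult_left_mono) simp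
    moreover have "2 * ennreal (l / 2) = ennreal l"
      using l ennreal_mult[of 2 "l/2"] by simp
    ultimately show ?thesis
      by (simp add: mult.assoc[symmetric])
  qed
  \<comment> \<open>Layer cake: \<open>A x powr p\<close> is the integral of
    \<open>p * l powr (p - 1)\<close> over \<open>0 < l < A x\<close>. The conditions are written as
    indicators of differences, which keeps joint measurability automatic for Fubini.\<close>
  have "pint p {0..1} A = (\<integral>\<^sup>+ x. (\<integral>\<^sup>+ l. ennreal (p * l powr (p - 1)) * indicator {0<..} l * indicator {0<..} (A x - l) * indicator {0..1} x \<partial>lborel) \<partial>lborel)"
  proof (subst pint_eq, simp, rule nn_integral_cong)
    fix x :: real
    show "ennreal (\<bar>A x\<bar> powr p) * indicator {0..1} x =
      (\<integral>\<^sup>+ l. ennreal (p * l powr (p - 1)) * indicator {0<..} l * indicator {0<..} (A x - l) * indicator {0..1} x \<partial>lborel)"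
    proof (cases "x \<in> {0..1}")
      case True
      have "(\<integral>\<^sup>+ l. ennreal (p * l powr (p - 1)) * indicator {0<..} l * indicator {0<..} (A x - l) * indicator {0..1} x \<partial>lborel)
       = (\<integral>\<^sup>+ l. ennreal (p * l powr (p - 1)) * indicator {0<..<A x} l \<partial>lborel)"
        using True by (intro nn_integral_cong) (auto split: split_indicator)
      also have "\<dots> = ennreal (A x powr p)"
        using p A0[OF True] by (intro nn_integral_powr_less) auto
      finally show ?thesis using True A0[OF True] by simp
    qed simp
  qed
  also have "\<dots> = (\<integral>\<^sup>+ l. (\<integral>\<^sup>+ x. ennreal (p * l powr (p - 1)) * indicator {0<..} l * indicator {0<..} (A x - l) * indicator {0..1} x \<partial>lborel) \<partial>lborel)"
    by (rule lborel_pair.Fubini'[symmetric]) measurable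
  also have "\<dots> \<le> (\<integral>\<^sup>+ l. (\<integral>\<^sup>+ u. 10 * (ennreal (p * l powr (p - 2)) * indicator {0<..} l) * (ennreal (H u) * indicator {0<..} (H u - l/2) * indicator {0..1} u) \<partial>lborel) \<partial>lborel)"
  proof (rule nn_integral_mono)
    fix l :: real
    let ?J = "(\<integral>\<^sup>+ u. ennreal (H u) * indicator {0<..} (H u - l/2) * indicator {0..1} u \<partial>lborel)"
    show "(\<integral>\<^sup>+ x. ennreal (p * l powr (p - 1)) * indicator {0<..} l * indicator {0<..} (A x - l) * indicator {0..1} x \<partial>lborel) \<le>
      (\<integral>\<^sup>+ u. 10 * (ennreal (p * l powr (p - 2)) * indicator {0<..} l) * (ennreal (H u) * indicator {0<..} (H u - l/2) * indicator {0..1} u) \<partial>lborel)"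
    proof (cases "0 < l")
      case True
      have "(\<integral>\<^sup>+ x. ennreal (p * l powr (p - 1)) * indicator {0<..} l * indicator {0<..} (A x - l) * indicator {0..1} x \<partial>lborel)
        = (\<integral>\<^sup>+ x. ennreal (p * l powr (p - 1)) * indicator (E l) x \<partial>lborel)"
        using True by (intro nn_integral_cong) (auto simp: E_def split: split_indicator)
      also have "\<dots> = ennreal (p * l powr (p - 1)) * emeasure lborel (E l)"
        by (simp add: nn_integral_cmult_indicator)
      \<comment> \<open>One factor \<open>l\<close> is split off to match the left-hand side of the
        weak bound.\<close>
      also have "\<dots> = ennreal (p * l powr (p - 2)) * (ennreal l * emeasure lborel (E l))"
      proof -
        have "p * l powr (p - 1) = p * l powr (p - 2) * l"
          using True by (simp add: powr_diff power2_eq_square field_simps)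
        then have "ennreal (p * l powr (p - 1)) = ennreal (p * l powr (p - 2)) * ennreal l"
          using p True by (simp add: ennreal_mult mult.assoc)
        then show ?thesis by (simp add: mult.assoc)
      qed
      also have "\<dots> \<le> ennreal (p * l powr (p - 2)) * (10 * ?J)"
        by (intro mult_left_mono weak True) auto
      also have "\<dots> = (\<integral>\<^sup>+ u. 10 * (ennreal (p * l powr (p - 2)) * indicator {0<..} l) * (ennreal (H u) * indicator {0<..} (H u - l/2) * indicator {0..1} u) \<partial>lborel)"
        using True by (subst nn_integral_cmult) (auto simp: mult_ac)
      finally show ?thesis .
    qed simp
  qed
  also have "\<dots> = (\<integral>\<^sup>+ u. (\<integral>\<^sup>+ l. 10 * (ennreal (p * l powr (p - 2)) * indicator {0<..} l) * (ennreal (H u) * indicator {0<..} (H u - l/2) * indicator {0..1} u) \<partial>lborel) \<partial>lborel)"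
    by (rule lborel_pair.Fubini') measurable
  also have "\<dots> = (\<integral>\<^sup>+ u. ennreal (10 * p / (p - 1) * 2 powr (p - 1)) * (ennreal (\<bar>H u\<bar> powr p) * indicator {0..1} u) \<partial>lborel)"
  proof (rule nn_integral_cong)
    fix u :: real
    \<comment> \<open>For fixed \<open>u\<close> the truncation \<open>l/2 < H u\<close> has become
      the range \<open>0 < l < 2 * H u\<close> of integration.\<close>
    have "(\<integral>\<^sup>+ l. 10 * (ennreal (p * l powr (p - 2)) * indicator {0<..} l) * (ennreal (H u) * indicator {0<..} (H u - l/2) * indicator {0..1} u) \<partial>lborel)
      = (\<integral>\<^sup>+ l. (ennreal (10 * p / (p - 1) * H u) * indicator {0..1} u) * (ennreal ((p - 1) * l powr (p - 1 - 1)) * indicator {0<..<2 * H u} l) \<partial>lborel)"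
    proof (rule nn_integral_cong)
      fix l :: real
      have "10 * ennreal (p * l powr (p - 2)) * ennreal (H u) = ennreal (10 * p / (p - 1) * H u) * ennreal ((p - 1) * l powr (p - 2))"
      proof -
        have "10 * ennreal (p * l powr (p - 2)) * ennreal (H u) = ennreal (10 * (p * l powr (p - 2)) * H u)"
          using p H0[of u] by (simp add: ennreal_mult)
        also have "10 * (p * l powr (p - 2)) * H u = 10 * p / (p - 1) * H u * ((p - 1) * l powr (p - 2))"
          using p by (simp add: field_simps)
        also have "ennreal \<dots> = ennreal (10 * p / (p - 1) * H u) * ennreal ((p - 1) * l powr (p - 2))"
          using p H0[of u] by (intro ennreal_mult) auto
        finally show ?thesis .
      qed
      then show "10 * (ennreal (p * l powr (p - 2)) * indicator {0<..} l) * (ennreal (H u) * indicator {0<..} (H u - l/2) * indicator {0..1} u)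
       = (ennreal (10 * p / (p - 1) * H u) * indicator {0..1} u) * (ennreal ((p - 1) * l powr (p - 1 - 1)) * indicator {0<..<2 * H u} l)"
        by (auto split: split_indicator)
    qed
    also have "\<dots> = (ennreal (10 * p / (p - 1) * H u) * indicator {0..1} u) * ennreal ((2 * H u) powr (p - 1))"
      using p H0[of u] by (subst nn_integral_cmult, simp, subst nn_integral_powr_less) auto
    also have "\<dots> = ennreal (10 * p / (p - 1) * 2 powr (p - 1)) * (ennreal (\<bar>H u\<bar> powr p) * indicator {0..1} u)"
    proof -
      have "10 * p / (p - 1) * H u * (2 * H u) powr (p - 1) = 10 * p / (p - 1) * 2 powr (p - 1) * (\<bar>H u\<bar> powr p)"
        using H0[of u] p by (cases "H u = 0") (auto simp: powr_mult powr_diff)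
      then have "ennreal (10 * p / (p - 1) * H u) * ennreal ((2 * H u) powr (p - 1)) = ennreal (10 * p / (p - 1) * 2 powr (p - 1)) * ennreal (\<bar>H u\<bar> powr p)"
        using p H0[of u] by (subst (1 2) ennreal_mult[symmetric]) auto
      then show ?thesis by (auto split: split_indicator)
    qed
    finally show "(\<integral>\<^sup>+ l. 10 * (ennreal (p * l powr (p - 2)) * indicator {0<..} l) * (ennreal (H u) * indicator {0<..} (H u - l/2) * indicator {0..1} u) \<partial>lborel)
     = ennreal (10 * p / (p - 1) * 2 powr (p - 1)) * (ennreal (\<bar>H u\<bar> powr p) * indicator {0..1} u)" .
  qed
  also have "\<dots> = ennreal (10 * p / (p - 1) * 2 powr (p - 1)) * pint p {0..1} H"
    by (subst nn_integral_cmult) (auto simp: pint_eq)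
  finally show ?thesis .
qed

section \<open>Averages\<close>

lemma continuous_on_abs_powr:
  fixes f :: "'a::topological_space \<Rightarrow> real"
  assumes "continuous_on S f" "0 < p"
  shows "continuous_on S (\<lambda>x. \<bar>f x\<bar> powr p)"
  by (rule continuous_on_powr') (use assms in \<open>auto intro: continuous_intros\<close>)

text \<open>Replaces Hoelder's inequality: \<open>|f| \<le> s + s powr (1 - p) * |f| powr p\<close>
  for every \<open>s > 0\<close>, because the first term suffices if \<open>|f| \<le> s\<close> and
  the second one otherwise. This is integrated over an interval of length at most \<open>1\<close>,
  and then \<open>s\<close> is chosen.\<close>

lemma integral_powr_le:
  fixes f :: "real \<Rightarrow> real"
  assumes ab: "a \<le> b" "b - a \<le> 1" and f: "continuous_on {a..b} f" and p: "1 \<le> p"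
  shows "integral {a..b} (\<lambda>x. \<bar>f x\<bar>) powr p \<le> 2 powr p * integral {a..b} (\<lambda>x. \<bar>f x\<bar> powr p)"
proof -
  define J where "J = integral {a..b} (\<lambda>x. \<bar>f x\<bar> powr p)"
  have J0: "0 \<le> J" unfolding J_def by (intro integral_nonneg integrable_continuous_real continuous_on_abs_powr f) (use p in auto)
  have I0: "0 \<le> integral {a..b} (\<lambda>x. \<bar>f x\<bar>)"
    by (intro integral_nonneg integrable_continuous_real continuous_intros f) auto
  have *: "integral {a..b} (\<lambda>x. \<bar>f x\<bar>) \<le> s + s powr (1 - p) * J" if s: "0 < s" for s
  proof -
    have "integral {a..b} (\<lambda>x. \<bar>f x\<bar>) \<le> integral {a..b} (\<lambda>x. s + s powr (1 - p) * \<bar>f x\<bar> powr p)"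
    proof (intro integral_le integrable_continuous_real continuous_on_add continuous_on_mult continuous_on_const continuous_on_abs_powr continuous_on_rabs f)
      fix x
      show "\<bar>f x\<bar> \<le> s + s powr (1 - p) * \<bar>f x\<bar> powr p"
      proof (cases "\<bar>f x\<bar> \<le> s")
        case False
        have "\<bar>f x\<bar> = \<bar>f x\<bar> powr (1 - p) * \<bar>f x\<bar> powr p"
          using False s by (simp add: powr_add[symmetric])
        also have "\<dots> \<le> s powr (1 - p) * \<bar>f x\<bar> powr p"
          using False s p by (intro mult_right_mono powr_mono2') auto
        finally show ?thesis using s by simp
      qed (use s in \<open>simp add: add_increasing2\<close>)
    qed (use p in auto)
    also have "\<dots> = s * (b - a) + s powr (1 - p) * J"
    proof -
      have "(\<lambda>x. \<bar>f x\<bar> powr p) integrable_on {a..b}"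
        by (intro integrable_continuous_real continuous_on_abs_powr f) (use p in auto)
      then show ?thesis unfolding J_def using ab
        by (subst integral_add) (auto intro: integrable_on_mult_right)
    qed
    also have "\<dots> \<le> s + s powr (1 - p) * J"
      using ab s by (simp add: mult_left_le)
    finally show ?thesis .
  qed
  show ?thesis
  proof (cases "J = 0")
    case True
    \<comment> \<open>Here only the term \<open>s\<close> is left, and \<open>s > 0\<close> is
      arbitrary.\<close>
    have "integral {a..b} (\<lambda>x. \<bar>f x\<bar>) \<le> 0"
      by (rule field_le_epsilon) (use * True in simp)
    then show ?thesis using I0 True p by (simp add: J_def)
  next
    case False
    then have J: "0 < J" using J0 by simp
    \<comment> \<open>The choice \<open>s = J powr (1 / p)\<close> makes both terms equal, whence
      the factor \<open>2\<close> and finally \<open>2 powr p\<close>.\<close>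
    have "integral {a..b} (\<lambda>x. \<bar>f x\<bar>) \<le> J powr (1/p) + (J powr (1/p)) powr (1 - p) * J"
      using * J by simp
    also have "(J powr (1/p)) powr (1 - p) * J = J powr (1 / p * (1 - p) + 1)"
      using J by (simp add: powr_powr powr_add)
    also have "1 / p * (1 - p) + 1 = 1 / p"
      using p by (simp add: field_simps)
    finally have "integral {a..b} (\<lambda>x. \<bar>f x\<bar>) powr p \<le> (2 * J powr (1/p)) powr p"
      using I0 p by (intro powr_mono2) auto
    also have "\<dots> = 2 powr p * J"
      using J p by (simp add: powr_mult powr_powr)
    finally show ?thesis by (simp add: J_def)
  qed
qed

lemma pint_eq_integral:
  assumes "continuous_on {a..b} f" "0 < p"
  shows "pint p {a..b} f = ennreal (integral {a..b} (\<lambda>x. \<bar>f x\<bar> powr p))"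
proof -
  have "((\<lambda>x. \<bar>f x\<bar> powr p) has_integral integral {a..b} (\<lambda>x. \<bar>f x\<bar> powr p)) {a..b}"
    by (intro integrable_integral integrable_continuous_real continuous_on_abs_powr assms)
  from nn_integral_has_integral_lebesgue'[OF _ this] show ?thesis
    by (simp add: pint_eq)
qed

text \<open>Stands in for Minkowski's integral inequality: the power-mean inequality in
  \<open>s\<close> for each \<open>x\<close>, then Fubini, and the bound \<open>W\<close> is
  integrated over a parameter interval of length \<open>1\<close>.\<close>

lemma pint_integral_le:
  fixes \<phi> :: "real \<Rightarrow> real \<Rightarrow> real"
  assumes \<phi>: "continuous_on UNIV (\<lambda>(x, s). \<phi> x s)" and p: "1 \<le> p"
    and W: "\<And>s. s \<in> {0..1} \<Longrightarrow> pint p {a..b} (\<lambda>x. \<phi> x s) \<le> W"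
  shows "pint p {a..b} (\<lambda>x. integral {0..1} (\<phi> x)) \<le> ennreal (2 powr p) * W"
proof -
  have cont: "continuous_on UNIV (\<phi> x)" for x
    using continuous_on_compose2[OF \<phi>, of UNIV "\<lambda>s. (x, s)"] by (simp add: continuous_on_Pair)
  have [measurable]: "(\<lambda>(x, s). \<phi> x s) \<in> borel_measurable (borel \<Otimes>\<^sub>M borel)"
    using borel_measurable_continuous_onI[OF \<phi>] by (simp add: borel_prod)
  have "pint p {a..b} (\<lambda>x. integral {0..1} (\<phi> x)) \<le>
    (\<integral>\<^sup>+ x. (\<integral>\<^sup>+ s. ennreal (2 powr p) * (ennreal (\<bar>\<phi> x s\<bar> powr p) * indicator {0..1} s * indicator {a..b} x) \<partial>lborel) \<partial>lborel)"
  proof (subst pint_eq, simp, rule nn_integral_mono)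
    fix x
    have c: "continuous_on {0..1} (\<phi> x)"
      using cont by (rule continuous_on_subset) simp
    have "ennreal (\<bar>integral {0..1} (\<phi> x)\<bar> powr p) \<le> ennreal (integral {0..1} (\<lambda>s. \<bar>\<phi> x s\<bar>) powr p)"
      using p by (intro ennreal_leI powr_mono2 order.refl integral_norm_bound_integral[where 'a=real, unfolded real_norm_def])
         (auto intro!: integrable_continuous_real continuous_intros c)
    also have "\<dots> \<le> ennreal (2 powr p * integral {0..1} (\<lambda>s. \<bar>\<phi> x s\<bar> powr p))"
      by (intro ennreal_leI integral_powr_le c p) auto
    also have "\<dots> = ennreal (2 powr p) * pint p {0..1} (\<phi> x)"
      using p by (subst pint_eq_integral) (auto simp: ennreal_mult' c)
    also have "\<dots> = (\<integral>\<^sup>+ s. ennreal (2 powr p) * (ennreal (\<bar>\<phi> x s\<bar> powr p) * indicator {0..1} s) \<partial>lborel)"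
      by (subst nn_integral_cmult) (auto simp: pint_eq)
    finally show "ennreal (\<bar>integral {0..1} (\<phi> x)\<bar> powr p) * indicator {a..b} x \<le>
      (\<integral>\<^sup>+ s. ennreal (2 powr p) * (ennreal (\<bar>\<phi> x s\<bar> powr p) * indicator {0..1} s * indicator {a..b} x) \<partial>lborel)"
      by (auto split: split_indicator)
  qed
  also have "\<dots> = (\<integral>\<^sup>+ s. (\<integral>\<^sup>+ x. ennreal (2 powr p) * (ennreal (\<bar>\<phi> x s\<bar> powr p) * indicator {0..1} s * indicator {a..b} x) \<partial>lborel) \<partial>lborel)"
    by (rule lborel_pair.Fubini'[symmetric]) measurable
  also have "\<dots> \<le> (\<integral>\<^sup>+ s. ennreal (2 powr p) * W * indicator {0..1::real} s \<partial>lborel)"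
  proof (rule nn_integral_mono)
    fix s :: real
    have "(\<integral>\<^sup>+ x. ennreal (2 powr p) * (ennreal (\<bar>\<phi> x s\<bar> powr p) * indicator {0..1} s * indicator {a..b} x) \<partial>lborel)
      = (\<integral>\<^sup>+ x. ennreal (2 powr p) * indicator {0..1} s * (ennreal (\<bar>\<phi> x s\<bar> powr p) * indicator {a..b} x) \<partial>lborel)"
      by (simp add: mult_ac)
    also have "\<dots> = ennreal (2 powr p) * indicator {0..1} s * pint p {a..b} (\<lambda>x. \<phi> x s)"
      by (subst nn_integral_cmult) (auto simp: pint_eq)
    also have "\<dots> \<le> ennreal (2 powr p) * W * indicator {0..1::real} s"
      using W[of s] by (auto split: split_indicator intro: mult_left_mono)
    finally show "(\<integral>\<^sup>+ x. ennreal (2 powr p) * (ennreal (\<bar>\<phi> x s\<bar> powr p) * indicator {0..1} s * indicator {a..b} x) \<partial>lborel) \<le> \<dots>" .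
  qed
  also have "\<dots> = ennreal (2 powr p) * W"
    by (subst nn_integral_cmult_indicator) auto
  finally show ?thesis .
qed

lemma pint_shift:
  assumes "v \<in> borel_measurable borel"
  shows "pint p {a..b} (\<lambda>x. v (x + c)) = pint p {a + c..b + c} v"
proof -
  note [measurable] = assms
  have "pint p {a + c..b + c} v = (\<integral>\<^sup>+ x. ennreal (\<bar>v (c + 1 * x)\<bar> powr p) * indicator {a+c..b+c} (c + 1 * x) \<partial>lborel)"
    by (subst pint_eq, simp, subst nn_integral_real_affine[where c = 1 and t = c]) auto
  also have "\<dots> = (\<integral>\<^sup>+ x. ennreal (\<bar>v (x + c)\<bar> powr p) * indicator {a..b} x \<partial>lborel)"
    by (intro nn_integral_cong) (auto simp: add.commute split: split_indicator)
  finally show ?thesis by (simp add: pint_eq)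
qed

lemma pint_reflect:
  assumes "v \<in> borel_measurable borel"
  shows "pint p {a..b} (\<lambda>x. v (c - x)) = pint p {c - b..c - a} v"
proof -
  note [measurable] = assms
  have "pint p {c - b..c - a} v = (\<integral>\<^sup>+ x. ennreal (\<bar>v (c + (-1) * x)\<bar> powr p) * indicator {c-b..c-a} (c + (-1) * x) \<partial>lborel)"
    by (subst pint_eq, simp, subst nn_integral_real_affine[where c = "-1" and t = c]) auto
  also have "\<dots> = (\<integral>\<^sup>+ x. ennreal (\<bar>v (c - x)\<bar> powr p) * indicator {a..b} x \<partial>lborel)"
    by (intro nn_integral_cong) (auto split: split_indicator)
  finally show ?thesis by (simp add: pint_eq)
qed

section \<open>Twice continuously differentiable functions and Steklov means\<close>

text \<open>The derivatives are arguments, so that explicit formulas for means and glued functions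
  can be inserted. Everything lives on the whole line, so no one-sided derivatives occur at the ends
  of the unit interval.\<close>

definition C2_fun :: "(real \<Rightarrow> real) \<Rightarrow> (real \<Rightarrow> real) \<Rightarrow> (real \<Rightarrow> real) \<Rightarrow> bool" where
  "C2_fun g g' g'' \<longleftrightarrow> (\<forall>x. (g has_real_derivative g' x) (at x)) \<and>
     (\<forall>x. (g' has_real_derivative g'' x) (at x)) \<and> continuous_on UNIV g''"

lemma C2_funD:
  assumes "C2_fun g g' g''"
  shows "(g has_real_derivative g' x) (at x within S)" "(g' has_real_derivative g'' x) (at x within S)"
    "continuous_on S g" "continuous_on S g'" "continuous_on S g''"
  using assms unfolding C2_fun_def
  by (auto intro: has_field_derivative_at_within continuous_on_subset
       intro!: DERIV_continuous_on[of S g g'] DERIV_continuous_on[of S g' g''])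

section \<open>Pointwise bounds from integrals\<close>

lemma C2_fun_deriv_bound:
  assumes g: "C2_fun g g' g''" and "x \<in> {a..b}" "y \<in> {a..b}"
  shows "\<bar>g' x\<bar> \<le> \<bar>g' y\<bar> + integral {a..b} (\<lambda>s. \<bar>g'' s\<bar>)"
proof -
  have *: "\<bar>g' v - g' u\<bar> \<le> integral {a..b} (\<lambda>s. \<bar>g'' s\<bar>)" if "u \<in> {a..b}" "v \<in> {a..b}" "u \<le> v" for u v
  proof -
    have "(g'' has_integral (g' v - g' u)) {u..v}"
      using that C2_funD(2)[OF g]
      by (intro fundamental_theorem_of_calculus) (auto simp: has_real_derivative_iff_has_vector_derivative[symmetric])
    then have "\<bar>g' v - g' u\<bar> = \<bar>integral {u..v} g''\<bar>"
      by (simp add: integral_unique)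
    also have "\<dots> \<le> integral {u..v} (\<lambda>s. \<bar>g'' s\<bar>)"
      by (intro integral_norm_bound_integral[where 'a=real, unfolded real_norm_def] integrable_continuous_real
          continuous_intros C2_funD[OF g]) auto
    also have "\<dots> \<le> integral {a..b} (\<lambda>s. \<bar>g'' s\<bar>)"
      using that by (intro integral_subset_le integrable_continuous_real continuous_intros C2_funD[OF g]) auto
    finally show ?thesis .
  qed
  have "\<bar>g' x - g' y\<bar> \<le> integral {a..b} (\<lambda>s. \<bar>g'' s\<bar>)"
    using *[of x y] *[of y x] assms(2,3) by (cases "x \<le> y") (auto simp: abs_minus_commute)
  then show ?thesis by linarith
qed

text \<open>A minimum point of \<open>|u|\<close> on \<open>{c..d}\<close> will do. It turns an
  integral bound into a bound at one point, from which the mean value theorem can start.\<close>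

lemma exists_small_value:
  assumes "a \<le> c" "c < d" "d \<le> b" "0 < p" "continuous_on {a..b} (u :: real \<Rightarrow> real)"
  shows "\<exists>z\<in>{c..d}. \<bar>u z\<bar> powr p * (d - c) \<le> integral {a..b} (\<lambda>x. \<bar>u x\<bar> powr p)"
proof -
  have cont: "continuous_on {a..b} (\<lambda>x. \<bar>u x\<bar> powr p)"
    using assms by (intro continuous_on_abs_powr)
  then have contc: "continuous_on {c..d} (\<lambda>x. \<bar>u x\<bar> powr p)"
    by (rule continuous_on_subset) (use assms in auto)
  obtain z where z: "z \<in> {c..d}" "\<And>y. y \<in> {c..d} \<Longrightarrow> \<bar>u z\<bar> powr p \<le> \<bar>u y\<bar> powr p"
    using continuous_attains_inf[OF _ _ contc] assms by auto
  have "\<bar>u z\<bar> powr p * (d - c) = integral {c..d} (\<lambda>x. \<bar>u z\<bar> powr p)"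
    using assms by simp
  also have "\<dots> \<le> integral {c..d} (\<lambda>x. \<bar>u x\<bar> powr p)"
    using z contc by (intro integral_le integrable_continuous_real) auto
  also have "\<dots> \<le> integral {a..b} (\<lambda>x. \<bar>u x\<bar> powr p)"
    using assms cont contc by (intro integral_subset_le integrable_continuous_real) auto
  finally show ?thesis using z by blast
qed

text \<open>A one-dimensional Sobolev embedding. Small values of \<open>u\<close> near both ends
  give, by the mean value theorem, one point with small \<open>u'\<close>; integrating
  \<open>u''\<close> from there bounds \<open>u'\<close> everywhere, and this in turn bounds
  \<open>u\<close>, starting from one of its small values.\<close>

lemma C2_fun_sup_bound:
  assumes ab: "a < b" "b - a \<le> 1" and p: "1 \<le> p"
  shows "\<exists>C>0. \<forall>u u' u''. C2_fun u u' u'' \<longrightarrow> (\<forall>x\<in>{a..b}.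
     ennreal (\<bar>u x\<bar> powr p) \<le> ennreal C * (pint p {a..b} u + pint p {a..b} u'') \<and>
     ennreal (\<bar>u' x\<bar> powr p) \<le> ennreal C * (pint p {a..b} u + pint p {a..b} u''))"
proof -
  define L where "L = b - a"
  have L: "0 < L" "L \<le> 1" using ab by (auto simp: L_def)
  \<comment> \<open>The small values are sought in the outer quarters, of length
    \<open>L / 4\<close>, whence \<open>K = 4 / L\<close>. These quarters are \<open>L / 2\<close>
    apart, which gives the factor \<open>2 / L\<close> in \<open>D\<close>.\<close>
  define K where "K = 4 / L"
  define D where "D = 2 powr p * ((2 / L) powr p * (2 powr p * (2 * K)) + 2 powr p)"
  define C where "C = 2 powr p * (K + D)"
  have K: "0 < K" using L by (simp add: K_def)
  have D: "0 < D" using K by (auto simp: D_def intro!: mult_pos_pos add_nonneg_pos)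
  have C: "0 < C" using K D by (simp add: C_def)
  have two: "(1::real) \<le> 2 powr p" using p by (intro ge_one_powr_ge_zero) auto
  have "D \<le> 1 * (K + D)" using K by simp
  also have "\<dots> \<le> C" unfolding C_def using two K D by (intro mult_right_mono) auto
  finally have DC: "D \<le> C" .
  have main: "\<bar>u x\<bar> powr p \<le> C * (P + R) \<and> \<bar>u' x\<bar> powr p \<le> C * (P + R)"
    if u: "C2_fun u u' u''" and x: "x \<in> {a..b}"
      and PR: "P = integral {a..b} (\<lambda>x. \<bar>u x\<bar> powr p)" "R = integral {a..b} (\<lambda>x. \<bar>u'' x\<bar> powr p)"
    for u u' u'' x P R
  proof -
    note cont = C2_funD(3-5)[OF u]
    have P0: "0 \<le> P" and R0: "0 \<le> R"
      unfolding PR using p by (auto intro!: integral_nonneg integrable_continuous_real continuous_on_abs_powr cont)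
    obtain y1 where y1: "y1 \<in> {a..a + L/4}" "\<bar>u y1\<bar> powr p * (a + L/4 - a) \<le> P"
      using exists_small_value[of a a "a + L/4" b p u] L p cont by (auto simp: PR L_def field_simps)
    obtain y2 where y2: "y2 \<in> {b - L/4..b}" "\<bar>u y2\<bar> powr p * (b - (b - L/4)) \<le> P"
      using exists_small_value[of a "b - L/4" b b p u] L p cont by (auto simp: PR L_def field_simps)
    have u1: "\<bar>u y1\<bar> powr p \<le> K * P" "\<bar>u y2\<bar> powr p \<le> K * P"
      using y1 y2 L by (auto simp: K_def field_simps)
    have gap: "L / 2 \<le> y2 - y1" using y1 y2 by (auto simp: L_def field_simps)
    obtain y where y: "y1 < y" "y < y2" "u y2 - u y1 = (y2 - y1) * u' y"
      using MVT2[of y1 y2 u u'] gap L C2_funD(1)[OF u] by auto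
    have "\<bar>u' y\<bar> * (L / 2) \<le> \<bar>u' y\<bar> * (y2 - y1)"
      using gap by (intro mult_left_mono) auto
    also have "\<dots> = \<bar>u y2 - u y1\<bar>" using gap L unfolding y by (simp add: abs_mult)
    also have "\<dots> \<le> \<bar>u y1\<bar> + \<bar>u y2\<bar>" by linarith
    finally have "\<bar>u' y\<bar> \<le> 2 / L * (\<bar>u y1\<bar> + \<bar>u y2\<bar>)" using L by (simp add: field_simps)
    then have "\<bar>u' y\<bar> powr p \<le> (2 / L * (\<bar>u y1\<bar> + \<bar>u y2\<bar>)) powr p"
      using p by (intro powr_mono2) auto
    also have "\<dots> = (2 / L) powr p * (\<bar>u y1\<bar> + \<bar>u y2\<bar>) powr p"
      by (rule powr_mult)
    also have "\<dots> \<le> (2 / L) powr p * (2 powr p * (\<bar>u y1\<bar> powr p + \<bar>u y2\<bar> powr p))"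
      using p by (intro mult_left_mono powr_add_le) auto
    also have "\<dots> \<le> (2 / L) powr p * (2 powr p * (K * P + K * P))"
      using u1 by (intro mult_left_mono add_mono) auto
    finally have u'y: "\<bar>u' y\<bar> powr p \<le> (2 / L) powr p * (2 powr p * (2 * K)) * P"
      by (simp add: algebra_simps)
    define I where "I = integral {a..b} (\<lambda>s. \<bar>u'' s\<bar>)"
    have I0: "0 \<le> I" unfolding I_def
      by (auto intro!: integral_nonneg integrable_continuous_real continuous_intros cont)
    have Ip: "I powr p \<le> 2 powr p * R"
      unfolding I_def PR using ab p by (intro integral_powr_le cont) auto
    have yab: "y \<in> {a..b}" using y y1 y2 by auto
    have bd: "\<bar>u' z\<bar> powr p \<le> D * (P + R)" if z: "z \<in> {a..b}" for z
    proof -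
      have "\<bar>u' z\<bar> powr p \<le> (\<bar>u' y\<bar> + I) powr p"
        using C2_fun_deriv_bound[OF u z yab] p unfolding I_def by (intro powr_mono2) auto
      also have "\<dots> \<le> 2 powr p * (\<bar>u' y\<bar> powr p + I powr p)"
        using p I0 by (intro powr_add_le) auto
      also have "\<dots> \<le> 2 powr p * ((2 / L) powr p * (2 powr p * (2 * K)) * P + 2 powr p * R)"
        using u'y Ip by (intro mult_left_mono add_mono) auto
      also have "\<dots> \<le> 2 powr p * ((2 / L) powr p * (2 powr p * (2 * K)) * (P + R) + 2 powr p * (P + R))"
        using P0 R0 K by (intro mult_left_mono add_mono) auto
      finally show ?thesis by (simp add: D_def algebra_simps)
    qed
    have "\<bar>u x\<bar> \<le> \<bar>u y1\<bar> + (D * (P + R)) powr (1/p)"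
    proof -
      have y1ab: "y1 \<in> {a..b}" using y1(1) y2(1) gap L by auto
      have "norm (u x - u y1) \<le> (D * (P + R)) powr (1/p) * norm (x - y1)"
      proof (rule field_differentiable_bound[of "{a..b}"])
        fix z assume z: "z \<in> {a..b}"
        have "\<bar>u' z\<bar> = (\<bar>u' z\<bar> powr p) powr (1/p)" using p by (simp add: powr_powr)
        also have "\<dots> \<le> (D * (P + R)) powr (1/p)"
          using bd[OF z] p by (intro powr_mono2) auto
        finally show "norm (u' z) \<le> (D * (P + R)) powr (1/p)" by simp
      qed (use x y1ab C2_funD(1)[OF u] in auto)
      also have "\<dots> \<le> (D * (P + R)) powr (1/p) * 1"
        using x y1ab ab by (intro mult_left_mono) auto
      finally show ?thesis by simp
    qed
    then have "\<bar>u x\<bar> powr p \<le> (\<bar>u y1\<bar> + (D * (P + R)) powr (1/p)) powr p"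
      using p by (intro powr_mono2) auto
    also have "\<dots> \<le> 2 powr p * (\<bar>u y1\<bar> powr p + ((D * (P + R)) powr (1/p)) powr p)"
      using p by (intro powr_add_le) auto
    also have "((D * (P + R)) powr (1/p)) powr p = D * (P + R)"
      using p D P0 R0 by (simp add: powr_powr)
    also have "2 powr p * (\<bar>u y1\<bar> powr p + D * (P + R)) \<le> 2 powr p * (K * (P + R) + D * (P + R))"
    proof -
      have "K * P \<le> K * (P + R)" using K R0 by simp
      then show ?thesis using u1(1) D by (intro mult_left_mono add_mono) auto
    qed
    finally have "\<bar>u x\<bar> powr p \<le> C * (P + R)" by (simp add: C_def algebra_simps)
    moreover have "\<bar>u' x\<bar> powr p \<le> C * (P + R)"
      using bd[OF x] DC P0 R0 mult_right_mono[of D C "P + R"] by linarith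
    ultimately show ?thesis by simp
  qed
  show ?thesis
  proof (intro exI[of _ C] conjI C allI impI ballI)
    fix u u' u'' x assume u: "C2_fun u u' u''" and x: "x \<in> {a..b}"
    let ?P = "integral {a..b} (\<lambda>x. \<bar>u x\<bar> powr p)" and ?R = "integral {a..b} (\<lambda>x. \<bar>u'' x\<bar> powr p)"
    note cont = C2_funD(3-5)[OF u]
    have "0 \<le> ?P" "0 \<le> ?R"
      using p by (auto intro!: integral_nonneg integrable_continuous_real continuous_on_abs_powr cont)
    then have eq: "ennreal C * (pint p {a..b} u + pint p {a..b} u'') = ennreal (C * (?P + ?R))"
      using p C by (subst (1 2) pint_eq_integral) (auto simp: cont ennreal_mult)
    show "ennreal (\<bar>u x\<bar> powr p) \<le> ennreal C * (pint p {a..b} u + pint p {a..b} u'')"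
      "ennreal (\<bar>u' x\<bar> powr p) \<le> ennreal C * (pint p {a..b} u + pint p {a..b} u'')"
      unfolding eq using main[OF u x refl refl] by (auto intro: ennreal_leI)
  qed
qed

section \<open>Steklov means\<close>

lemma antiderivative_exists:
  fixes v :: "real \<Rightarrow> real"
  assumes "continuous_on UNIV v"
  shows "\<exists>V. \<forall>x. (V has_real_derivative v x) (at x)"
  using einterval_antiderivative[of "-\<infinity>" "\<infinity>" v] assms
  by (auto simp: has_real_derivative_iff_has_vector_derivative continuous_on_eq_continuous_at)

text \<open>Since \<open>f - steklov h f\<close> is the average of the second differences of \<open>f\<close> with steps in
  \<open>{0..h}\<close>, this mean reproduces affine functions.\<close>

definition steklov :: "real \<Rightarrow> (real \<Rightarrow> real) \<Rightarrow> real \<Rightarrow> real" where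
  "steklov h v x = integral {0..1} (\<lambda>s. 2 * v (x + h * s) - v (x + 2 * h * s))"

text \<open>In terms of an antiderivative \<open>V\<close> of \<open>v\<close> the mean is a
  combination of \<open>V x\<close>, \<open>V (x + h)\<close> and \<open>V (x + 2 * h)\<close>,
  hence one degree smoother than \<open>v\<close>. Two iterations therefore turn a continuous
  function into one of class \<open>C^2\<close>.\<close>

lemma steklov_deriv:
  assumes v: "continuous_on UNIV v" and h: "0 < h"
  shows "(steklov h v has_real_derivative (2 * v (x + h) - v (x + 2 * h) / 2 - 3 / 2 * v x) / h) (at x)"
proof -
  obtain V where V: "\<And>x. (V has_real_derivative v x) (at x)"
    using antiderivative_exists[OF v] by blast
  have V': "(V has_real_derivative v x) (at x within S)" for x S
    using V by (rule has_field_derivative_at_within)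
  have eq: "steklov h v = (\<lambda>x. (2 * V (x + h) - V (x + 2 * h) / 2 - 3 / 2 * V x) / h)"
  proof
    fix x
    let ?G = "\<lambda>s. (2 * V (x + h * s) - V (x + 2 * h * s) / 2) / h"
    have "((\<lambda>s. 2 * v (x + h * s) - v (x + 2 * h * s)) has_integral (?G 1 - ?G 0)) {0..1}"
      by (rule fundamental_theorem_of_calculus)
         (use h in \<open>auto simp: has_real_derivative_iff_has_vector_derivative[symmetric]
            diff_divide_distrib intro!: derivative_eq_intros DERIV_chain2[OF V']\<close>)
    then show "steklov h v x = (2 * V (x + h) - V (x + 2 * h) / 2 - 3 / 2 * V x) / h"
      unfolding steklov_def using h by (simp add: integral_unique field_simps)
  qed
  show ?thesis unfolding eq
    by (auto intro!: derivative_eq_intros DERIV_chain2[OF V'] simp: h[THEN less_imp_neq, symmetric] field_simps)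
qed

lemma steklov_continuous:
  assumes "continuous_on UNIV v" "0 < h"
  shows "continuous_on S (steklov h v)"
  by (rule DERIV_continuous_on, rule has_field_derivative_at_within, rule steklov_deriv[OF assms])

lemma steklov_integrable:
  fixes v :: "real \<Rightarrow> real"
  assumes "continuous_on UNIV v"
  shows "(\<lambda>s. 2 * v (x + h * s) - v (x + 2 * h * s)) integrable_on {0..1}"
  by (intro integrable_continuous_real continuous_intros continuous_on_compose2[OF assms]) auto

lemma diff_steklov:
  assumes "continuous_on UNIV f"
  shows "steklov h f x - f x = - integral {0..1} (\<lambda>s. second_difference (h * s) f x)"
proof -
  have "integral {0..1} (\<lambda>s. second_difference (h * s) f x) =
        integral {0..1} (\<lambda>s. f x - (2 * f (x + h * s) - f (x + 2 * h * s)))"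
    by (intro integral_cong) (simp add: second_difference_def algebra_simps)
  also have "\<dots> = f x - steklov h f x"
    unfolding steklov_def by (subst integral_diff) (auto intro: steklov_integrable assms)
  finally show ?thesis by simp
qed

lemma steklov_diff:
  assumes "continuous_on UNIV f" "continuous_on UNIV g"
  shows "steklov h (\<lambda>x. f x - g x) x = steklov h f x - steklov h g x"
  unfolding steklov_def
  by (subst integral_diff[OF steklov_integrable[OF assms(1)] steklov_integrable[OF assms(2)], symmetric])
     (simp add: algebra_simps)

section \<open>The K-functional\<close>

lemma second_difference_continuous:
  assumes "continuous_on UNIV f"
  shows "continuous_on S (second_difference s f)"
  unfolding second_difference_def
  by (intro continuous_intros continuous_on_compose2[OF assms]) auto

text \<open>With \<open>u\<close> the mean of \<open>f\<close> and \<open>g\<close> the mean of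
  \<open>u\<close>, \<open>g - f = (g - u) + (u - f)\<close>, where \<open>g - u\<close> is itself
  the mean of \<open>u - f\<close>; so both parts reduce to averages of second differences. Each
  mean looks \<open>2 * h\<close> ahead, whence the condition
  \<open>b + 4 * h \<le> 1\<close>.\<close>

lemma K_functional_forward:
  assumes p: "1 \<le> p"
  shows "\<exists>C::ennreal. C \<noteq> top \<and> (\<forall>f h b W. continuous_on UNIV f \<longrightarrow> 0 < h \<longrightarrow> b + 4 * h \<le> 1 \<longrightarrow>
     (\<forall>s\<in>{0..h}. pint p {0..1 - 2 * s} (second_difference s f) \<le> W) \<longrightarrow>
     (\<exists>g g' g''. C2_fun g g' g'' \<and> pint p {0..b} (\<lambda>x. g x - f x) \<le> C * W \<and>
        pint p {0..b} (\<lambda>x. h\<^sup>2 * g'' x) \<le> C * W))"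
proof -
  define c where "c = ennreal (2 powr p)"
  have c: "c \<noteq> top" by (simp add: c_def)
  define C1 where "C1 = c * (c * (c * (c * c + c)) + c)"
  define C2 where "C2 = c * (c * (ennreal ((9/4) powr p) + ennreal ((3/2) powr p)) + ennreal ((1/4) powr p))"
  have p0: "0 < p" "0 \<le> p" using p by auto
  have main: "\<exists>g g' g''. C2_fun g g' g'' \<and> pint p {0..b} (\<lambda>x. g x - f x) \<le> (C1 + C2) * W \<and>
        pint p {0..b} (\<lambda>x. h\<^sup>2 * g'' x) \<le> (C1 + C2) * W"
    if f: "continuous_on UNIV f" and h: "0 < h" and b: "b + 4 * h \<le> 1"
      and W: "\<And>s. s \<in> {0..h} \<Longrightarrow> pint p {0..1 - 2 * s} (second_difference s f) \<le> W"
    for f h b W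
  proof -
    define u where "u = steklov h f"
    define g where "g = steklov h u"
    define w where "w x = u x - f x" for x
    have u: "continuous_on S u" for S unfolding u_def by (rule steklov_continuous[OF f h])
    have fS: "continuous_on S f" for S using f by (rule continuous_on_subset) simp
    have g: "continuous_on S g" for S unfolding g_def by (rule steklov_continuous[OF u h])
    have w: "continuous_on S w" for S unfolding w_def by (intro continuous_intros u fS)
    define u' where "u' x = (2 * f (x + h) - f (x + 2 * h) / 2 - 3 / 2 * f x) / h" for x
    define g' where "g' x = (2 * u (x + h) - u (x + 2 * h) / 2 - 3 / 2 * u x) / h" for x
    define g'' where "g'' x = (2 * u' (x + h) - u' (x + 2 * h) / 2 - 3 / 2 * u' x) / h" for x
    have du: "(u has_real_derivative u' x) (at x)" for x
      unfolding u_def u'_def by (rule steklov_deriv[OF f h])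
    have C2: "C2_fun g g' g''"
      unfolding C2_fun_def
    proof (intro conjI allI)
      show "(g has_real_derivative g' x) (at x)" for x
        unfolding g_def g'_def by (rule steklov_deriv[OF u h])
      show "(g' has_real_derivative g'' x) (at x)" for x
        unfolding g'_def g''_def using h
        by (auto intro!: derivative_eq_intros DERIV_chain2[OF du] simp: field_simps)
      show "continuous_on UNIV g''"
        unfolding g''_def u'_def using h by (intro continuous_intros continuous_on_compose2[OF f]) auto
    qed
    \<comment> \<open>The interval is longer than \<open>{0..b}\<close> by \<open>2 * h\<close>,
      which is how far the second mean looks.\<close>
    have w1: "pint p {0..b + 2 * h} w \<le> c * W"
    proof -
      have "w = (\<lambda>x. integral {0..1} (\<lambda>s. - second_difference (h * s) f x))"
        unfolding w_def u_def by (simp add: diff_steklov[OF f] fun_eq_iff)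
      moreover have "pint p {0..b + 2 * h} (\<lambda>x. integral {0..1} (\<lambda>s. - second_difference (h * s) f x)) \<le> ennreal (2 powr p) * W"
      proof (rule pint_integral_le[OF _ p])
        show "continuous_on UNIV (\<lambda>(x, s). - second_difference (h * s) f x)"
          unfolding second_difference_def case_prod_beta
          by (intro continuous_intros continuous_on_compose2[OF f]) auto
        fix s :: real assume s: "s \<in> {0..1}"
        then have hs: "h * s \<in> {0..h}" using h by (auto simp: mult_left_le)
        have "pint p {0..b + 2 * h} (\<lambda>x. - second_difference (h * s) f x) \<le> pint p {0..1 - 2 * (h * s)} (second_difference (h * s) f)"
          using b hs p0 by (intro pint_mono) auto
        also have "\<dots> \<le> W" by (rule W[OF hs])
        finally show "pint p {0..b + 2 * h} (\<lambda>x. - second_difference (h * s) f x) \<le> W" .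
      qed
      ultimately show ?thesis by (simp add: c_def)
    qed
    have w2: "pint p {0..b} (steklov h w) \<le> c * ((c * (c * c + c)) * W)"
      unfolding steklov_def[abs_def] c_def
    proof (rule pint_integral_le[OF _ p], fold c_def)
      show "continuous_on UNIV (\<lambda>(x, s). 2 * w (x + h * s) - w (x + 2 * h * s))"
        unfolding case_prod_beta by (intro continuous_intros continuous_on_compose2[OF w[of UNIV]]) auto
      fix s :: real assume s: "s \<in> {0..1}"
      then have hs: "0 \<le> h * s" "h * s \<le> h" using h by (auto simp: mult_left_le)
      have m: "(\<lambda>x. w (x + t)) \<in> borel_measurable (lebesgue_on S)" for t S
        by (intro borel_measurable_lebesgue_on_continuous continuous_on_compose2[OF w[of UNIV]] continuous_intros) auto
      have sh: "pint p {0..b} (\<lambda>x. w (x + t)) \<le> c * W" if "0 \<le> t" "t \<le> 2 * h" for t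
      proof -
        have "pint p {0..b} (\<lambda>x. w (x + t)) = pint p {0 + t..b + t} w"
          by (rule pint_shift) (rule borel_measurable_continuous_onI[OF w])
        also have "\<dots> \<le> pint p {0..b + 2 * h} w"
          using that p0 by (intro pint_mono) auto
        finally show ?thesis using w1 by (rule order_trans)
      qed
      have "pint p {0..b} (\<lambda>x. 2 * w (x + h * s) - w (x + 2 * h * s)) \<le>
         ennreal (2 powr p) * (pint p {0..b} (\<lambda>x. 2 * w (x + h * s)) + pint p {0..b} (\<lambda>x. w (x + 2 * h * s)))"
        using p0 m by (intro pint_le_add) auto
      also have "pint p {0..b} (\<lambda>x. 2 * w (x + h * s)) = c * pint p {0..b} (\<lambda>x. w (x + h * s))"
        using p0 m by (subst pint_cmult) (auto simp: c_def)
      also have "ennreal (2 powr p) * (c * pint p {0..b} (\<lambda>x. w (x + h * s)) + pint p {0..b} (\<lambda>x. w (x + 2 * h * s)))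
         \<le> c * (c * (c * W) + c * W)"
        using hs h unfolding c_def[symmetric] by (intro mult_left_mono add_mono sh) auto
      also have "\<dots> = c * (c * c + c) * W" by (simp add: algebra_simps)
      finally show "pint p {0..b} (\<lambda>x. 2 * w (x + h * s) - w (x + 2 * h * s)) \<le> c * (c * c + c) * W" .
    qed
    have "pint p {0..b} (\<lambda>x. g x - f x) \<le> c * (pint p {0..b} (steklov h w) + pint p {0..b} w)"
      unfolding c_def
    proof (rule pint_le_add)
      show "steklov h w \<in> borel_measurable (lebesgue_on {0..b})" "w \<in> borel_measurable (lebesgue_on {0..b})"
        by (intro borel_measurable_lebesgue_on_continuous steklov_continuous w h)+
      have sw: "steklov h w x = g x - u x" for x
        unfolding w_def g_def u_def by (rule steklov_diff[OF u[unfolded u_def] f])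
      show "\<bar>g x - f x\<bar> \<le> \<bar>steklov h w x\<bar> + \<bar>w x\<bar>" for x
        unfolding sw w_def by linarith
    qed (use p0 in auto)
    also have "\<dots> \<le> c * (c * ((c * (c * c + c)) * W) + c * W)"
      using h p0 by (intro mult_left_mono add_mono w2 order_trans[OF pint_mono w1]) auto
    also have "\<dots> = C1 * W" by (simp add: C1_def algebra_simps)
    also have "\<dots> \<le> (C1 + C2) * W" by (intro mult_right_mono) auto
    finally have 1: "pint p {0..b} (\<lambda>x. g x - f x) \<le> (C1 + C2) * W" .
    define d where "d = second_difference h f"
    have dc: "continuous_on S d" for S unfolding d_def by (rule second_difference_continuous[OF f])
    have m: "(\<lambda>x. q * d (x + t)) \<in> borel_measurable (lebesgue_on S)" "(\<lambda>x. d (x + t)) \<in> borel_measurable (lebesgue_on S)" for q t S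
      by (intro borel_measurable_lebesgue_on_continuous continuous_on_compose2[OF dc[of UNIV]] continuous_intros; simp)+
    have sh: "pint p {0..b} (\<lambda>x. q * d (x + t)) \<le> ennreal (\<bar>q\<bar> powr p) * W" if "0 \<le> t" "t \<le> 2 * h" for q t
    proof -
      have "pint p {0..b} (\<lambda>x. d (x + t)) = pint p {0 + t..b + t} d"
        by (rule pint_shift) (rule borel_measurable_continuous_onI[OF dc])
      also have "\<dots> \<le> pint p {0..1 - 2 * h} d"
        using that p0 b by (intro pint_mono) auto
      also have "\<dots> \<le> W" unfolding d_def using h by (intro W) auto
      finally show ?thesis using m p0 by (subst pint_cmult) (auto intro: mult_left_mono)
    qed
    have "pint p {0..b} (\<lambda>x. h\<^sup>2 * g'' x) \<le> c * (pint p {0..b} (\<lambda>x. 9/4 * d (x + 0) + (-3/2) * d (x + h)) + pint p {0..b} (\<lambda>x. 1/4 * d (x + 2 * h)))"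
      unfolding c_def
    proof (rule pint_le_add)
      \<comment> \<open>With \<open>E\<close> the shift by \<open>h\<close>, differentiating a mean
        amounts to applying \<open>- (E - 1) * (E - 3) / (2 * h)\<close>. Its square is
        \<open>(E - 1)^2 * (9 - 6 * E + E^2) / (4 * h^2)\<close>, and \<open>(E - 1)^2\<close> is
        the second difference; this is the origin of \<open>9/4\<close>, \<open>-3/2\<close> and
        \<open>1/4\<close>.\<close>
      have eq: "h\<^sup>2 * g'' x = (9/4 * d (x + 0) + (-3/2) * d (x + h)) + 1/4 * d (x + 2 * h)" for x
      proof -
        have *: "h * u' x = 2 * f (x + h) - f (x + 2 * h) / 2 - 3 / 2 * f x" for x
          using h by (simp add: u'_def)
        then have u'h: "h * u' x = 2 * f (x + h) - f (x + 2 * h) / 2 - 3 / 2 * f x"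
          "h * u' (x + h) = 2 * f (x + 2 * h) - f (x + 3 * h) / 2 - 3 / 2 * f (x + h)"
          "h * u' (x + 2 * h) = 2 * f (x + 3 * h) - f (x + 4 * h) / 2 - 3 / 2 * f (x + 2 * h)"
          using *[of x] *[of "x + h"] *[of "x + 2 * h"] by (simp_all add: algebra_simps)
        have "h\<^sup>2 * g'' x = 2 * (h * u' (x + h)) - (h * u' (x + 2 * h)) / 2 - 3 / 2 * (h * u' x)"
          using h by (simp add: g''_def power2_eq_square field_simps)
        also have "\<dots> = (9/4 * d (x + 0) + (-3/2) * d (x + h)) + 1/4 * d (x + 2 * h)"
          unfolding u'h d_def second_difference_def by (simp add: field_simps)
        finally show ?thesis .
      qed
      show "\<bar>h\<^sup>2 * g'' x\<bar> \<le> \<bar>9/4 * d (x + 0) + (-3/2) * d (x + h)\<bar> + \<bar>1/4 * d (x + 2 * h)\<bar>" for x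
        unfolding eq by (rule abs_triangle_ineq)
    qed (use p0 m in \<open>auto simp del: add_0_right\<close>)
    also have "\<dots> \<le> c * (c * (ennreal (\<bar>9/4\<bar> powr p) * W + ennreal (\<bar>-3/2\<bar> powr p) * W) + ennreal (\<bar>1/4\<bar> powr p) * W)"
    proof (intro mult_left_mono add_mono)
      have "pint p {0..b} (\<lambda>x. 9/4 * d (x + 0) + (-3/2) * d (x + h)) \<le>
         c * (pint p {0..b} (\<lambda>x. 9/4 * d (x + 0)) + pint p {0..b} (\<lambda>x. (-3/2) * d (x + h)))"
        unfolding c_def using p0 m by (intro pint_le_add) (auto simp del: add_0_right)
      also have "\<dots> \<le> c * (ennreal (\<bar>9/4\<bar> powr p) * W + ennreal (\<bar>-3/2\<bar> powr p) * W)"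
        using h by (intro mult_left_mono add_mono sh) auto
      finally show "pint p {0..b} (\<lambda>x. 9/4 * d (x + 0) + (-3/2) * d (x + h)) \<le> \<dots>" .
    qed (use sh[of "2 * h" "1/4"] h in simp_all)
    also have "\<dots> = C2 * W" by (simp add: C2_def algebra_simps)
    also have "\<dots> \<le> (C1 + C2) * W" by (intro mult_right_mono) auto
    finally have "pint p {0..b} (\<lambda>x. h\<^sup>2 * g'' x) \<le> (C1 + C2) * W" .
    with 1 C2 show ?thesis by blast
  qed
  show ?thesis
    by (rule exI[of _ "C1 + C2"]) (use main c in \<open>auto simp: C1_def C2_def ennreal_mult_eq_top_iff\<close>)
qed

text \<open>The reflection of the unit interval turns a second difference with step \<open>s\<close>
  into one with the same step read from the other end. The hypothesis on \<open>f\<close> is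
  therefore invariant, and the constant stays the same.\<close>

lemma K_functional_backward:
  assumes p: "1 \<le> p"
  shows "\<exists>C::ennreal. C \<noteq> top \<and> (\<forall>f h b W. continuous_on UNIV f \<longrightarrow> 0 < h \<longrightarrow> b + 4 * h \<le> 1 \<longrightarrow>
     (\<forall>s\<in>{0..h}. pint p {0..1 - 2 * s} (second_difference s f) \<le> W) \<longrightarrow>
     (\<exists>g g' g''. C2_fun g g' g'' \<and> pint p {1 - b..1} (\<lambda>x. g x - f x) \<le> C * W \<and>
        pint p {1 - b..1} (\<lambda>x. h\<^sup>2 * g'' x) \<le> C * W))"
proof -
  obtain C where C: "C \<noteq> top" and K: "\<And>f h b W. \<lbrakk>continuous_on UNIV f; 0 < h; b + 4 * h \<le> 1;
     \<forall>s\<in>{0..h}. pint p {0..1 - 2 * s} (second_difference s f) \<le> W\<rbrakk> \<Longrightarrow>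
     (\<exists>g g' g''. C2_fun g g' g'' \<and> pint p {0..b} (\<lambda>x. g x - f x) \<le> C * W \<and>
        pint p {0..b} (\<lambda>x. h\<^sup>2 * g'' x) \<le> C * W)"
    using K_functional_forward[OF p] by blast
  have "\<exists>g g' g''. C2_fun g g' g'' \<and> pint p {1 - b..1} (\<lambda>x. g x - f x) \<le> C * W \<and>
        pint p {1 - b..1} (\<lambda>x. h\<^sup>2 * g'' x) \<le> C * W"
    if f: "continuous_on UNIV f" and h: "0 < h" and b: "b + 4 * h \<le> 1"
      and W: "\<forall>s\<in>{0..h}. pint p {0..1 - 2 * s} (second_difference s f) \<le> W"
    for f h b W
  proof -
    have refl: "pint p {1 - b..1} (\<lambda>x. v (1 - x)) = pint p {0..b} v" if "continuous_on UNIV v" for v b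
      using pint_reflect[OF borel_measurable_continuous_onI[OF that], of p "1 - b" 1 1] by simp
    have cf: "continuous_on UNIV (\<lambda>x. f (1 - x))"
      by (intro continuous_on_compose2[OF f] continuous_intros) auto
    have "pint p {0..1 - 2 * s} (second_difference s (\<lambda>x. f (1 - x))) \<le> W" if "s \<in> {0..h}" for s
    proof -
      have "second_difference s (\<lambda>x. f (1 - x)) = (\<lambda>x. second_difference s f (1 - 2 * s - x))"
        by (simp add: second_difference_def fun_eq_iff algebra_simps)
      then have "pint p {0..1 - 2 * s} (second_difference s (\<lambda>x. f (1 - x))) = pint p {0..1 - 2 * s} (second_difference s f)"
        using pint_reflect[OF borel_measurable_continuous_onI[OF second_difference_continuous[OF f]], of p 0 "1 - 2 * s" s "1 - 2 * s"]
        by simp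
      then show ?thesis using W that by simp
    qed
    then obtain g g' g'' where g: "C2_fun g g' g''" "pint p {0..b} (\<lambda>x. g x - f (1 - x)) \<le> C * W"
        "pint p {0..b} (\<lambda>x. h\<^sup>2 * g'' x) \<le> C * W"
      using K[OF cf h b] by blast
    have "C2_fun (\<lambda>x. g (1 - x)) (\<lambda>x. - g' (1 - x)) (\<lambda>x. g'' (1 - x))"
      unfolding C2_fun_def
    proof (intro conjI allI)
      fix x
      have d: "((\<lambda>x. 1 - x) has_real_derivative - 1) (at x)"
        by (auto intro!: derivative_eq_intros)
      show "((\<lambda>x. g (1 - x)) has_real_derivative - g' (1 - x)) (at x)"
        using DERIV_chain2[OF C2_funD(1)[OF g(1)] d] by simp
      show "((\<lambda>x. - g' (1 - x)) has_real_derivative g'' (1 - x)) (at x)"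
        using DERIV_minus[OF DERIV_chain2[OF C2_funD(2)[OF g(1)] d]] by simp
      show "continuous_on UNIV (\<lambda>x. g'' (1 - x))"
        by (intro continuous_intros continuous_on_compose2[OF C2_funD(5)[OF g(1), of UNIV]]) auto
    qed
    moreover have "pint p {1 - b..1} (\<lambda>x. g (1 - x) - f x) \<le> C * W"
      using refl[of "\<lambda>x. g x - f (1 - x)" b] g(2)
      by (simp add: continuous_intros C2_funD(3)[OF g(1)] cf)
    moreover have "pint p {1 - b..1} (\<lambda>x. h\<^sup>2 * g'' (1 - x)) \<le> C * W"
      using refl[of "\<lambda>x. h\<^sup>2 * g'' x" b] g(3) by (simp add: continuous_intros C2_funD(5)[OF g(1)])
    ultimately show ?thesis by blast
  qed
  then show ?thesis using C by blast
qed

text \<open>The square removes the kink of \<open>max 0\<close> at the origin, so a bump built from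
  it is continuously differentiable and its antiderivative is of class \<open>C^2\<close>.\<close>

lemma max_0_square_deriv: "((\<lambda>s::real. (max 0 s)\<^sup>2) has_real_derivative 2 * max 0 s) (at s)"
proof -
  consider "0 < s" | "s < 0" | "s = 0" by linarith
  then show ?thesis
  proof cases
    case 1
    have "((\<lambda>s. s\<^sup>2) has_real_derivative 2 * s) (at s)" by (auto intro!: derivative_eq_intros)
    then have "((\<lambda>s. (max 0 s)\<^sup>2) has_real_derivative 2 * s) (at s)"
      by (rule DERIV_cong_ev[THEN iffD1, OF refl _ refl, rotated])
         (use eventually_nhds_in_open[of "{0<..}" s] 1 in \<open>auto elim!: eventually_mono\<close>)
    then show ?thesis using 1 by simp
  next
    case 2
    have "((\<lambda>s. 0) has_real_derivative 0) (at s)" by simp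
    then have "((\<lambda>s. (max 0 s)\<^sup>2) has_real_derivative 0) (at s)"
      by (rule DERIV_cong_ev[THEN iffD1, OF refl _ refl, rotated])
         (use eventually_nhds_in_open[of "{..<0}" s] 2 in \<open>auto elim!: eventually_mono\<close>)
    then show ?thesis using 2 by simp
  next
    case 3
    have "((\<lambda>h::real. (max 0 h)\<^sup>2 / h) \<longlongrightarrow> 0) (at 0)"
    proof (rule Lim_null_comparison)
      show "\<forall>\<^sub>F h::real in at 0. norm ((max 0 h)\<^sup>2 / h) \<le> \<bar>h\<bar>"
        by (rule always_eventually) (auto simp: max_def power2_eq_square)
      show "((\<lambda>h::real. \<bar>h\<bar>) \<longlongrightarrow> 0) (at 0)"
        using tendsto_rabs[OF tendsto_ident_at, of 0 UNIV] by simp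
    qed
    then show ?thesis using 3 by (simp add: DERIV_def)
  qed
qed

text \<open>The cutoff is the normalised antiderivative of the bump \<open>w\<close>, the squared
  positive part of \<open>(x - 1/4) * (3/4 - x)\<close>.\<close>

lemma cutoff_exists:
  "\<exists>\<psi> \<psi>' \<psi>''. C2_fun \<psi> \<psi>' \<psi>'' \<and> (\<forall>x. 0 \<le> \<psi> x \<and> \<psi> x \<le> 1) \<and>
     (\<forall>x\<le>1/4. \<psi> x = 0) \<and> (\<forall>x\<ge>3/4. \<psi> x = 1) \<and>
     (\<forall>x. x \<notin> {1/4..3/4} \<longrightarrow> \<psi>' x = 0 \<and> \<psi>'' x = 0)"
proof -
  define q where "q x = 1/16 - (x - 1/2)\<^sup>2" for x :: real
  define w where "w x = (max 0 (q x))\<^sup>2" for x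
  define w' where "w' x = 2 * max 0 (q x) * (- 2 * (x - 1/2))" for x
  have q: "q x = (x - 1/4) * (3/4 - x)" for x
    by (simp add: q_def power2_eq_square field_simps)
  have dw: "(w has_real_derivative w' x) (at x)" for x
  proof -
    have "(q has_real_derivative - 2 * (x - 1/2)) (at x)"
      unfolding q_def by (auto intro!: derivative_eq_intros)
    from DERIV_chain2[OF max_0_square_deriv this] show ?thesis
      unfolding w_def w'_def .
  qed
  have cw': "continuous_on UNIV w'"
    unfolding w'_def q_def by (intro continuous_intros)
  have cw: "continuous_on UNIV w" unfolding w_def q_def by (intro continuous_intros)
  have q0: "q x \<le> 0" if "x \<le> 1/4 \<or> 3/4 \<le> x" for x
    unfolding q using that by (intro iffD2[OF mult_le_0_iff]) auto
  have w0: "w x = 0" "w' x = 0" if "x \<le> 1/4 \<or> 3/4 \<le> x" for x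
    using q0[OF that] by (auto simp: w_def w'_def max_def)
  have wp: "0 < w x" if "1/4 < x" "x < 3/4" for x
  proof -
    have "0 < q x" unfolding q using that by (intro mult_pos_pos) auto
    then show ?thesis by (simp add: w_def)
  qed
  obtain V where V: "\<And>x. (V has_real_derivative w x) (at x)"
    using antiderivative_exists[OF cw] by blast
  have mono: "V x \<le> V y" if "x \<le> y" for x y
    by (rule DERIV_nonneg_imp_nondecreasing[OF that], rule exI[of _ "w _"]) (use V in \<open>auto simp: w_def\<close>)
  have left: "V x = V (1/4)" if x: "x \<le> 1/4" for x
  proof (cases "x = 1/4")
    case False
    then obtain z where "z < 1/4" "V (1/4) - V x = (1/4 - x) * w z"
      using MVT2[of x "1/4" V w] x V by auto
    then show ?thesis by (simp add: w0)
  qed (simp only:)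
  have right: "V x = V (3/4)" if x: "3/4 \<le> x" for x
  proof (cases "x = 3/4")
    case False
    then obtain z where "3/4 < z" "V x - V (3/4) = (x - 3/4) * w z"
      using MVT2[of "3/4" x V w] x V by auto
    then show ?thesis by (simp add: w0)
  qed (simp only:)
  \<comment> \<open>The bump is positive inside its support, so the mean value theorem yields a
    positive total increase of \<open>V\<close>, which serves as the normalising divisor.\<close>
  obtain z where "1/4 < z" "z < 3/4" "V (3/4) - V (1/4) = (3/4 - 1/4) * w z"
    using MVT2[of "1/4" "3/4" V w] V by auto
  then have pos: "0 < V (3/4) - V (1/4)" using wp[of z] by simp
  define k where "k = V (3/4) - V (1/4)"
  have k: "0 < k" using pos by (simp add: k_def)
  have bounds: "V (1/4) \<le> V x \<and> V x \<le> V (3/4)" for x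
    by (metis left right mono linorder_linear)
  show ?thesis
  proof (intro exI conjI allI impI)
    show "C2_fun (\<lambda>x. (V x - V (1/4)) / k) (\<lambda>x. w x / k) (\<lambda>x. w' x / k)"
      unfolding C2_fun_def using k
      by (auto intro!: derivative_eq_intros V dw continuous_intros cw')
    fix x
    show "0 \<le> (V x - V (1/4)) / k" "(V x - V (1/4)) / k \<le> 1"
      using bounds[of x] k by (auto simp: k_def)
    show "(V x - V (1/4)) / k = 0" if "x \<le> 1/4"
      using left[OF that] by simp
    show "(V x - V (1/4)) / k = 1" if "3/4 \<le> x"
      using right[OF that] k by (simp add: k_def)
    show "w x / k = 0" "w' x / k = 0" if "x \<notin> {1/4..3/4}"
      using that w0[of x] by auto
  qed
qed

lemma pint_indicator:
  assumes "S \<in> sets lebesgue" "S' \<in> sets lebesgue"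
  shows "pint p S (\<lambda>x. indicator S' x * v x) \<le> pint p S' v"
  unfolding pint_eq[OF assms(1)] pint_eq[OF assms(2)]
  by (intro nn_integral_mono) (auto split: split_indicator)

lemma pint_le_const:
  assumes "\<And>x. x \<in> {0..1} \<Longrightarrow> ennreal (\<bar>v x\<bar> powr p) \<le> B"
  shows "pint p {0..1} v \<le> B"
proof -
  have "pint p {0..1} v \<le> (\<integral>\<^sup>+ x. B * indicator {0..1::real} x \<partial>lborel)"
    unfolding pint_eq[of "{0..1}", simplified] using assms
    by (intro nn_integral_mono) (auto split: split_indicator)
  also have "\<dots> = B" by (subst nn_integral_cmult_indicator) auto
  finally show ?thesis .
qed

text \<open>With \<open>a\<close> good on \<open>{0..3/4}\<close> and \<open>b\<close> good on
  \<open>{1/4..1}\<close>, the glued function is \<open>a + \<psi> * (b - a)\<close>. Derivatives of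
  \<open>\<psi>\<close> bring in \<open>b - a\<close> and its derivative, on the middle half only.
  There \<open>b - a\<close> is small because both functions are close to \<open>f\<close>, its
  second derivative is controlled too, and the embedding yields the first derivative.\<close>

lemma K_functional_bound:
  assumes p: "1 \<le> p"
  shows "\<exists>C::ennreal. C \<noteq> top \<and> (\<forall>f h W. continuous_on UNIV f \<longrightarrow> 0 < h \<longrightarrow> h \<le> 1/16 \<longrightarrow>
     (\<forall>s\<in>{0..h}. pint p {0..1 - 2 * s} (second_difference s f) \<le> W) \<longrightarrow>
     (\<exists>g g' g''. C2_fun g g' g'' \<and> pint p {0..1} (\<lambda>x. g x - f x) \<le> C * W \<and>
        pint p {0..1} (\<lambda>x. h\<^sup>2 * g'' x) \<le> C * W))"
proof -
  have p0: "0 < p" "0 \<le> p" using p by auto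
  obtain C1 where C1: "C1 \<noteq> top" and K1: "\<And>f h b W. \<lbrakk>continuous_on UNIV f; 0 < h; b + 4 * h \<le> 1;
     \<forall>s\<in>{0..h}. pint p {0..1 - 2 * s} (second_difference s f) \<le> W\<rbrakk> \<Longrightarrow>
     (\<exists>g g' g''. C2_fun g g' g'' \<and> pint p {0..b} (\<lambda>x. g x - f x) \<le> C1 * W \<and>
        pint p {0..b} (\<lambda>x. h\<^sup>2 * g'' x) \<le> C1 * W)"
    using K_functional_forward[OF p] by blast
  obtain C2 where C2: "C2 \<noteq> top" and K2: "\<And>f h b W. \<lbrakk>continuous_on UNIV f; 0 < h; b + 4 * h \<le> 1;
     \<forall>s\<in>{0..h}. pint p {0..1 - 2 * s} (second_difference s f) \<le> W\<rbrakk> \<Longrightarrow>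
     (\<exists>g g' g''. C2_fun g g' g'' \<and> pint p {1 - b..1} (\<lambda>x. g x - f x) \<le> C2 * W \<and>
        pint p {1 - b..1} (\<lambda>x. h\<^sup>2 * g'' x) \<le> C2 * W)"
    using K_functional_backward[OF p] by blast
  obtain S where S: "0 < S" and sup: "\<And>u u' u'' x. \<lbrakk>C2_fun u u' u''; x \<in> {1/4..3/4}\<rbrakk> \<Longrightarrow>
     ennreal (\<bar>u x\<bar> powr p) \<le> ennreal S * (pint p {1/4..3/4} u + pint p {1/4..3/4} u'') \<and>
     ennreal (\<bar>u' x\<bar> powr p) \<le> ennreal S * (pint p {1/4..3/4} u + pint p {1/4..3/4} u'')"
    using C2_fun_sup_bound[of "1/4" "3/4" p] p by auto
  obtain \<psi> \<psi>' \<psi>'' where \<psi>: "C2_fun \<psi> \<psi>' \<psi>''" and \<psi>01: "\<And>x. 0 \<le> \<psi> x" "\<And>x. \<psi> x \<le> 1"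
    and \<psi>l: "\<And>x. x \<le> 1/4 \<Longrightarrow> \<psi> x = 0" and \<psi>r: "\<And>x. 3/4 \<le> x \<Longrightarrow> \<psi> x = 1"
    and \<psi>0: "\<And>x. x \<notin> {1/4..3/4} \<Longrightarrow> \<psi>' x = 0" "\<And>x. x \<notin> {1/4..3/4} \<Longrightarrow> \<psi>'' x = 0"
    using cutoff_exists by blast
  have bdd: "\<exists>B>0. \<forall>x\<in>{0..1}. \<bar>v x\<bar> \<le> B" if "continuous_on {0..1} v" for v :: "real \<Rightarrow> real"
  proof -
    have "bounded (v ` {0..1})"
      by (intro compact_imp_bounded compact_continuous_image that) auto
    then obtain B where "0 < B" "\<forall>y\<in>v ` {0..1}. norm y \<le> B" unfolding bounded_pos by blast
    then show ?thesis by auto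
  qed
  obtain B1 where B1: "0 < B1" "\<And>x. x \<in> {0..1} \<Longrightarrow> \<bar>\<psi>' x\<bar> \<le> B1"
    using bdd[of \<psi>'] C2_funD(4)[OF \<psi>] by blast
  obtain B2 where B2: "0 < B2" "\<And>x. x \<in> {0..1} \<Longrightarrow> \<bar>\<psi>'' x\<bar> \<le> B2"
    using bdd[of \<psi>''] C2_funD(5)[OF \<psi>] by blast
  define c where "c = ennreal (2 powr p)"
  have c: "c \<noteq> top" by (simp add: c_def)
  define D where "D = ennreal S * (c * (C1 + C2) + c * (C1 + C2))"
  define C where "C = c * (C1 + C2) + c * (c * (C1 + C2) + c * (ennreal ((2 * B1) powr p) * D + ennreal (B2 powr p) * D))"
  have fin: "C \<noteq> top"
    using C1 C2 c by (simp add: C_def D_def ennreal_mult_eq_top_iff)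
  have "\<exists>g g' g''. C2_fun g g' g'' \<and> pint p {0..1} (\<lambda>x. g x - f x) \<le> C * W \<and>
        pint p {0..1} (\<lambda>x. h\<^sup>2 * g'' x) \<le> C * W"
    if f: "continuous_on UNIV f" and h: "0 < h" "h \<le> 1/16"
      and W: "\<forall>s\<in>{0..h}. pint p {0..1 - 2 * s} (second_difference s f) \<le> W" for f h W
  proof -
    \<comment> \<open>\<open>h \<le> 1/16\<close> is exactly what gives
      \<open>3/4 + 4 * h \<le> 1\<close>.\<close>
    obtain a a' a'' where a: "C2_fun a a' a''" "pint p {0..3/4} (\<lambda>x. a x - f x) \<le> C1 * W"
        "pint p {0..3/4} (\<lambda>x. h\<^sup>2 * a'' x) \<le> C1 * W"
      using K1[OF f h(1) _ W, of "3/4"] h by auto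
    obtain b b' b'' where b: "C2_fun b b' b''" "pint p {1/4..1} (\<lambda>x. b x - f x) \<le> C2 * W"
        "pint p {1/4..1} (\<lambda>x. h\<^sup>2 * b'' x) \<le> C2 * W"
      using K2[OF f h(1) _ W, of "3/4"] h by auto
    note ca = C2_funD(3-5)[OF a(1)] and cb = C2_funD(3-5)[OF b(1)] and c\<psi> = C2_funD(3-5)[OF \<psi>]
    have cf: "continuous_on S f" for S using f by (rule continuous_on_subset) simp
    note cont = ca cb c\<psi> cf
    define d d' d'' where "d x = b x - a x" and "d' x = b' x - a' x" and "d'' x = b'' x - a'' x" for x
    have d: "C2_fun d d' d''"
      unfolding C2_fun_def d_def d'_def d''_def
      by (auto intro!: derivative_eq_intros C2_funD(1,2)[OF a(1)] C2_funD(1,2)[OF b(1)] continuous_intros cont)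
    note cd = C2_funD(3-5)[OF d]
    note cont = cont cd
    define g g' g'' where "g x = a x + \<psi> x * d x" and "g' x = a' x + (\<psi>' x * d x + \<psi> x * d' x)"
      and "g'' x = a'' x + (\<psi>'' x * d x + 2 * \<psi>' x * d' x + \<psi> x * d'' x)" for x
    have g: "C2_fun g g' g''"
      unfolding C2_fun_def g_def g'_def g''_def
      by (auto intro!: derivative_eq_intros C2_funD(1,2)[OF a(1)] C2_funD(1,2)[OF d] C2_funD(1,2)[OF \<psi>]
          continuous_intros cont)
    have mC: "v \<in> borel_measurable (lebesgue_on S)" if "continuous_on UNIV v" for v :: "real \<Rightarrow> real" and S
      using that by (rule borel_measurable_lebesgue_on_continuous)
    have mI: "(\<lambda>x. indicator {l..r::real} x * v x) \<in> borel_measurable (lebesgue_on S)" if "continuous_on UNIV v" for v :: "real \<Rightarrow> real" and l r S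
      using borel_measurable_continuous_onI[OF that] by (intro borel_imp_lebesgue_on) measurable
    \<comment> \<open>\<open>\<psi>\<close> vanishes on the left quarter and
      \<open>1 - \<psi>\<close> on the right one, so each weight is dominated by the indicator of
      the range where \<open>b\<close> or \<open>a\<close> is controlled.\<close>
    have ind: "\<bar>\<psi> x * v x\<bar> \<le> \<bar>indicator {1/4..1} x * v x\<bar>" "\<bar>(1 - \<psi> x) * v x\<bar> \<le> \<bar>indicator {0..3/4} x * v x\<bar>"
      if "x \<in> {0..1}" for x v
      using that \<psi>l[of x] \<psi>r[of x] \<psi>01[of x]
      by (auto simp: abs_mult split: split_indicator intro: mult_left_le_one_le)
    have "pint p {0..1} (\<lambda>x. g x - f x) \<le> c * (pint p {0..1} (\<lambda>x. indicator {0..3/4} x * (a x - f x)) +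
          pint p {0..1} (\<lambda>x. indicator {1/4..1} x * (b x - f x)))"
      unfolding c_def
    proof (rule pint_le_add)
      fix x :: real assume "x \<in> space (lebesgue_on {0..1})"
      then have x: "x \<in> {0..1}" by simp
      have "g x - f x = (1 - \<psi> x) * (a x - f x) + \<psi> x * (b x - f x)"
        by (simp add: g_def d_def algebra_simps)
      then show "\<bar>g x - f x\<bar> \<le> \<bar>indicator {0..3/4} x * (a x - f x)\<bar> + \<bar>indicator {1/4..1} x * (b x - f x)\<bar>"
        using ind(1)[OF x, of "\<lambda>x. b x - f x"] ind(2)[OF x, of "\<lambda>x. a x - f x"] by linarith
    qed (use p0 in \<open>auto intro!: mI continuous_intros cont\<close>)
    also have "\<dots> \<le> c * (C1 * W + C2 * W)"
      using a(2) b(2) by (intro mult_left_mono add_mono order_trans[OF pint_indicator]) auto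
    also have "\<dots> = c * (C1 + C2) * W" by (simp add: algebra_simps)
    also have "\<dots> \<le> C * W" unfolding C_def by (intro mult_right_mono) auto
    finally have 1: "pint p {0..1} (\<lambda>x. g x - f x) \<le> C * W" .
    have d1: "pint p {1/4..3/4} d \<le> c * (C1 + C2) * W"
    proof -
      have "pint p {1/4..3/4} d \<le> c * (pint p {1/4..3/4} (\<lambda>x. b x - f x) + pint p {1/4..3/4} (\<lambda>x. a x - f x))"
        unfolding c_def by (rule pint_le_add) (use p0 in \<open>auto intro!: mC continuous_intros cont simp: d_def\<close>)
      also have "\<dots> \<le> c * (C2 * W + C1 * W)"
        using p0 by (intro mult_left_mono add_mono order_trans[OF pint_mono b(2)] order_trans[OF pint_mono a(2)]) auto
      finally show ?thesis by (simp add: algebra_simps)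
    qed
    have d2: "pint p {1/4..3/4} (\<lambda>x. h\<^sup>2 * d'' x) \<le> c * (C1 + C2) * W"
    proof -
      have "pint p {1/4..3/4} (\<lambda>x. h\<^sup>2 * d'' x) \<le> c * (pint p {1/4..3/4} (\<lambda>x. h\<^sup>2 * b'' x) + pint p {1/4..3/4} (\<lambda>x. h\<^sup>2 * a'' x))"
        unfolding c_def
      proof (rule pint_le_add)
        show "\<bar>h\<^sup>2 * d'' x\<bar> \<le> \<bar>h\<^sup>2 * b'' x\<bar> + \<bar>h\<^sup>2 * a'' x\<bar>" for x
          unfolding d''_def right_diff_distrib by linarith
      qed (use p0 in \<open>auto intro!: mC continuous_intros cont\<close>)
      also have "\<dots> \<le> c * (C2 * W + C1 * W)"
        using p0 by (intro mult_left_mono add_mono order_trans[OF pint_mono b(3)] order_trans[OF pint_mono a(3)]) auto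
      finally show ?thesis by (simp add: algebra_simps)
    qed
    have dsup: "ennreal (\<bar>h\<^sup>2 * d x\<bar> powr p) \<le> D * W" "ennreal (\<bar>h\<^sup>2 * d' x\<bar> powr p) \<le> D * W"
      if x: "x \<in> {1/4..3/4}" for x
    proof -
      \<comment> \<open>In front of \<open>d\<close> the factor \<open>h^2\<close> may be dropped,
        since \<open>d\<close> is already small without it; in front of \<open>d''\<close> it is
        kept.\<close>
      have h1: "h\<^sup>2 powr p \<le> 1" using h p0 by (intro powr_le1) (auto simp: abs_square_le_1)
      have "ennreal (h\<^sup>2 powr p) * (ennreal S * (pint p {1/4..3/4} d + pint p {1/4..3/4} d'')) =
          ennreal S * (ennreal (h\<^sup>2 powr p) * pint p {1/4..3/4} d + ennreal (\<bar>h\<^sup>2\<bar> powr p) * pint p {1/4..3/4} d'')"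
        by (simp add: algebra_simps)
      also have "\<dots> = ennreal S * (ennreal (h\<^sup>2 powr p) * pint p {1/4..3/4} d + pint p {1/4..3/4} (\<lambda>x. h\<^sup>2 * d'' x))"
        by (subst pint_cmult[of d'']) (auto intro!: mC cont p0)
      also have "\<dots> \<le> ennreal S * (ennreal 1 * (c * (C1 + C2) * W) + c * (C1 + C2) * W)"
        by (intro mult_left_mono add_mono mult_mono d1 d2 ennreal_leI h1) auto
      also have "\<dots> = D * W" by (simp add: D_def algebra_simps)
      finally have *: "ennreal (h\<^sup>2 powr p) * (ennreal S * (pint p {1/4..3/4} d + pint p {1/4..3/4} d'')) \<le> D * W" .
      have eq: "ennreal (\<bar>h\<^sup>2 * v\<bar> powr p) = ennreal (h\<^sup>2 powr p) * ennreal (\<bar>v\<bar> powr p)" for v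
        by (simp add: abs_mult powr_mult ennreal_mult)
      show "ennreal (\<bar>h\<^sup>2 * d x\<bar> powr p) \<le> D * W" "ennreal (\<bar>h\<^sup>2 * d' x\<bar> powr p) \<le> D * W"
        unfolding eq using sup[OF d x] by (auto intro!: order_trans[OF mult_left_mono *])
    qed
    \<comment> \<open>A bounded factor supported in the middle half meets a function bounded
      pointwise there; on an interval of length \<open>1\<close> the pointwise bound is also an
      integral bound.\<close>
    have bterm: "pint p {0..1} (\<lambda>x. \<theta> x * (h\<^sup>2 * v x)) \<le> ennreal (B powr p) * (D * W)"
      if B: "0 < B" "\<And>x. x \<in> {0..1} \<Longrightarrow> \<bar>\<theta> x\<bar> \<le> B" and z: "\<And>x. x \<notin> {1/4..3/4} \<Longrightarrow> \<theta> x = 0"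
        and v: "\<And>x. x \<in> {1/4..3/4} \<Longrightarrow> ennreal (\<bar>h\<^sup>2 * v x\<bar> powr p) \<le> D * W" for \<theta> v B
    proof (rule pint_le_const)
      fix x :: real assume x: "x \<in> {0..1}"
      show "ennreal (\<bar>\<theta> x * (h\<^sup>2 * v x)\<bar> powr p) \<le> ennreal (B powr p) * (D * W)"
      proof (cases "x \<in> {1/4..3/4}")
        case True
        have "ennreal (\<bar>\<theta> x * (h\<^sup>2 * v x)\<bar> powr p) = ennreal (\<bar>\<theta> x\<bar> powr p) * ennreal (\<bar>h\<^sup>2 * v x\<bar> powr p)"
          by (simp add: abs_mult powr_mult ennreal_mult)
        also have "\<dots> \<le> ennreal (B powr p) * (D * W)"
          using B(2)[OF x] p0 by (intro mult_mono v True ennreal_leI powr_mono2) auto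
        finally show ?thesis .
      next
        case False
        then show ?thesis using p0 by (simp add: z)
      qed
    qed
    have t1: "pint p {0..1} (\<lambda>x. 2 * \<psi>' x * (h\<^sup>2 * d' x)) \<le> ennreal ((2 * B1) powr p) * (D * W)"
      by (rule bterm) (use B1 \<psi>0 dsup in \<open>auto simp: abs_mult\<close>)
    have t2: "pint p {0..1} (\<lambda>x. \<psi>'' x * (h\<^sup>2 * d x)) \<le> ennreal (B2 powr p) * (D * W)"
      by (rule bterm) (use B2 \<psi>0 dsup in auto)
    have t3: "pint p {0..1} (\<lambda>x. 2 * \<psi>' x * (h\<^sup>2 * d' x) + \<psi>'' x * (h\<^sup>2 * d x)) \<le>
        c * (ennreal ((2 * B1) powr p) * (D * W) + ennreal (B2 powr p) * (D * W))"
    proof -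
      have "pint p {0..1} (\<lambda>x. 2 * \<psi>' x * (h\<^sup>2 * d' x) + \<psi>'' x * (h\<^sup>2 * d x)) \<le>
         c * (pint p {0..1} (\<lambda>x. 2 * \<psi>' x * (h\<^sup>2 * d' x)) + pint p {0..1} (\<lambda>x. \<psi>'' x * (h\<^sup>2 * d x)))"
        unfolding c_def by (rule pint_le_add) (use p0 in \<open>auto intro!: mC continuous_intros cont\<close>)
      also have "\<dots> \<le> c * (ennreal ((2 * B1) powr p) * (D * W) + ennreal (B2 powr p) * (D * W))"
        by (intro mult_left_mono add_mono t1 t2) auto
      finally show ?thesis .
    qed
    have t4: "pint p {0..1} (\<lambda>x. (1 - \<psi> x) * (h\<^sup>2 * a'' x) + \<psi> x * (h\<^sup>2 * b'' x)) \<le> c * (C1 * W + C2 * W)"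
    proof -
      have "pint p {0..1} (\<lambda>x. (1 - \<psi> x) * (h\<^sup>2 * a'' x) + \<psi> x * (h\<^sup>2 * b'' x)) \<le>
          c * (pint p {0..1} (\<lambda>x. indicator {0..3/4} x * (h\<^sup>2 * a'' x)) + pint p {0..1} (\<lambda>x. indicator {1/4..1} x * (h\<^sup>2 * b'' x)))"
        unfolding c_def
      proof (rule pint_le_add)
        fix x :: real assume "x \<in> space (lebesgue_on {0..1})"
        then have x: "x \<in> {0..1}" by simp
        show "\<bar>(1 - \<psi> x) * (h\<^sup>2 * a'' x) + \<psi> x * (h\<^sup>2 * b'' x)\<bar> \<le>
          \<bar>indicator {0..3/4} x * (h\<^sup>2 * a'' x)\<bar> + \<bar>indicator {1/4..1} x * (h\<^sup>2 * b'' x)\<bar>"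
          using ind(1)[OF x, of "\<lambda>x. h\<^sup>2 * b'' x"] ind(2)[OF x, of "\<lambda>x. h\<^sup>2 * a'' x"] by linarith
      qed (use p0 in \<open>auto intro!: mI continuous_intros cont\<close>)
      also have "\<dots> \<le> c * (C1 * W + C2 * W)"
        using a(3) b(3) by (intro mult_left_mono add_mono order_trans[OF pint_indicator]) auto
      finally show ?thesis .
    qed
    \<comment> \<open>The terms without derivatives of \<open>\<psi>\<close> form a convex
      combination of \<open>a''\<close> and \<open>b''\<close>; the remaining ones are those
      supported in the middle half.\<close>
    have geq: "(\<lambda>x. h\<^sup>2 * g'' x) = (\<lambda>x. ((1 - \<psi> x) * (h\<^sup>2 * a'' x) + \<psi> x * (h\<^sup>2 * b'' x)) + (2 * \<psi>' x * (h\<^sup>2 * d' x) + \<psi>'' x * (h\<^sup>2 * d x)))"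
      by (simp add: fun_eq_iff g''_def d''_def algebra_simps)
    have "pint p {0..1} (\<lambda>x. h\<^sup>2 * g'' x) \<le> c * (pint p {0..1} (\<lambda>x. (1 - \<psi> x) * (h\<^sup>2 * a'' x) + \<psi> x * (h\<^sup>2 * b'' x)) + pint p {0..1} (\<lambda>x. 2 * \<psi>' x * (h\<^sup>2 * d' x) + \<psi>'' x * (h\<^sup>2 * d x)))"
      unfolding c_def geq by (rule pint_le_add) (use p0 in \<open>auto intro!: mC continuous_intros cont\<close>)
    also have "\<dots> \<le> c * (c * (C1 * W + C2 * W) + c * (ennreal ((2 * B1) powr p) * (D * W) + ennreal (B2 powr p) * (D * W)))"
      by (intro mult_left_mono add_mono t3 t4) auto
    also have "\<dots> = c * (c * (C1 + C2) + c * (ennreal ((2 * B1) powr p) * D + ennreal (B2 powr p) * D)) * W"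
      by (simp add: algebra_simps)
    also have "\<dots> \<le> C * W" unfolding C_def by (intro mult_right_mono) auto
    finally have "pint p {0..1} (\<lambda>x. h\<^sup>2 * g'' x) \<le> C * W" .
    with 1 g show ?thesis by blast
  qed
  with fin show ?thesis by blast
qed

section \<open>A Taylor estimate with a maximal function\<close>

text \<open>\<open>A x\<close> is the supremum of the means of \<open>H\<close> over the intervals
  inside the unit interval with endpoint \<open>x\<close>, the only ones met in a Taylor expansion
  at \<open>x\<close>. These means depend uniformly continuously on both endpoints, which makes the
  supremum continuous.\<close>

lemma maximal_function_exists:
  fixes H :: "real \<Rightarrow> real"
  assumes p: "1 < p" and H: "continuous_on UNIV H" and H0: "\<And>x. 0 \<le> H x"
  shows "\<exists>A. continuous_on UNIV A \<and> (\<forall>x. 0 \<le> A x) \<and>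
    (\<forall>x\<in>{0..1}. \<forall>t\<in>{0..1}. integral {min x t..max x t} H \<le> A x * \<bar>t - x\<bar>) \<and>
    pint p {0..1} A \<le> ennreal (10 * p / (p - 1) * 2 powr (p - 1)) * pint p {0..1} H"
proof -
  obtain V where V: "\<And>x. (V has_real_derivative H x) (at x)"
    using antiderivative_exists[OF H] by blast
  have V': "(V has_real_derivative H x) (at x within S)" for x S
    using V by (rule has_field_derivative_at_within)
  \<comment> \<open>The mean over the segment from \<open>x\<close> to \<open>t\<close>.
    Parametrised by \<open>{0..1}\<close> it also makes sense for \<open>t = x\<close>, where its
    value is \<open>H x\<close>, and is continuous there.\<close>
  define Q where "Q x t = integral {0..1} (\<lambda>s. H (x + s * (t - x)))" for x t
  have HS: "continuous_on S H" for S using H by (rule continuous_on_subset) simp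
  have Qint: "(\<lambda>s. H (x + s * (t - x))) integrable_on {0..1}" for x t
    by (intro integrable_continuous_real continuous_on_compose2[OF H] continuous_intros) auto
  have Q0: "0 \<le> Q x t" for x t
    unfolding Q_def by (intro integral_nonneg Qint H0)
  have hasV: "(H has_integral (V b - V a)) {a..b}" if "a \<le> b" for a b
    by (rule fundamental_theorem_of_calculus[OF that])
       (auto simp: has_real_derivative_iff_has_vector_derivative[symmetric] intro: V')
  have QV: "(t - x) * Q x t = V t - V x" for x t
  proof -
    have "((\<lambda>s. H (x + s * (t - x)) * (t - x)) has_integral (V (x + 1 * (t - x)) - V (x + 0 * (t - x)))) {0..1}"
    proof (rule fundamental_theorem_of_calculus)
      fix s :: real
      have "((\<lambda>s. x + s * (t - x)) has_real_derivative (t - x)) (at s within {0..1})"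
        by (auto intro!: derivative_eq_intros)
      from DERIV_chain2[OF V this]
      show "((\<lambda>s. V (x + s * (t - x))) has_vector_derivative H (x + s * (t - x)) * (t - x)) (at s within {0..1})"
        by (simp add: has_real_derivative_iff_has_vector_derivative[symmetric])
    qed simp
    from integral_unique[OF this] show ?thesis by (simp add: Q_def mult.commute)
  qed
  have Qabs: "integral {min x t..max x t} H = Q x t * \<bar>t - x\<bar>" for x t
    using hasV[of "min x t" "max x t"] QV[of t x]
    by (cases "x \<le> t") (auto simp: integral_unique min_def max_def algebra_simps)
  have seg: "x + s * (t - x) \<in> {0..1}" if "x \<in> {0..1}" "t \<in> {0..1}" "s \<in> {0..1}" for x t s :: real
    using convexD_alt[of "{0..1::real}" x t s] that by (auto simp: algebra_simps)
  have uc: "uniformly_continuous_on {0..1} H"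
    by (intro compact_uniformly_continuous HS) simp
  have unif: "\<exists>d>0. \<forall>x\<in>{0..1}. \<forall>y\<in>{0..1}. \<forall>t\<in>{0..1}. \<forall>u\<in>{0..1}. \<bar>x - y\<bar> < d \<longrightarrow> \<bar>t - u\<bar> < d \<longrightarrow> Q x t \<le> Q y u + e"
    if e: "0 < e" for e
  proof -
    obtain d where d: "0 < d" "\<And>x y. \<lbrakk>x \<in> {0..1}; y \<in> {0..1}; dist y x < d\<rbrakk> \<Longrightarrow> dist (H y) (H x) < e"
      using uc e unfolding uniformly_continuous_on_def by metis
    have "Q x t \<le> Q y u + e" if xyt: "x \<in> {0..1}" "y \<in> {0..1}" "t \<in> {0..1}" "u \<in> {0..1}" "\<bar>x - y\<bar> < d" "\<bar>t - u\<bar> < d" for x y t u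
    proof -
      have "Q x t \<le> integral {0..1} (\<lambda>s. H (y + s * (u - y)) + e)"
        unfolding Q_def
      proof (intro integral_le Qint integrable_add)
        fix s :: real assume s: "s \<in> {0..1}"
        \<comment> \<open>Corresponding points of the two segments differ by a convex combination of
          the differences of the endpoints, hence by less than \<open>d\<close>.\<close>
        have "(x + s * (t - x)) - (y + s * (u - y)) = (1 - s) * (x - y) + s * (t - u)"
          by (simp add: algebra_simps)
        also have "\<bar>\<dots>\<bar> \<le> (1 - s) * \<bar>x - y\<bar> + s * \<bar>t - u\<bar>"
          using s by (intro order_trans[OF abs_triangle_ineq]) (simp add: abs_mult)
        also have "\<dots> < d"
          using s xyt(5,6) by (intro convex_bound_lt) auto
        finally have "dist (x + s * (t - x)) (y + s * (u - y)) < d" by (simp add: dist_real_def)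
        from d(2)[OF seg[OF xyt(2,4) s] seg[OF xyt(1,3) s] this]
        show "H (x + s * (t - x)) \<le> H (y + s * (u - y)) + e"
          by (simp add: dist_real_def)
      qed auto
      also have "\<dots> = Q y u + e"
        unfolding Q_def by (subst integral_add) (auto intro: Qint)
      finally show ?thesis .
    qed
    then show ?thesis using d(1) by blast
  qed
  obtain B where B: "\<And>x. x \<in> {0..1} \<Longrightarrow> H x \<le> B"
    using continuous_attains_sup[of "{0..1::real}" H] HS by fastforce
  have QB: "Q x t \<le> B" if "x \<in> {0..1}" "t \<in> {0..1}" for x t
  proof -
    have "Q x t \<le> integral {0..1} (\<lambda>s::real. B)"
      unfolding Q_def by (intro integral_le Qint) (use B seg[OF that] in auto)
    then show ?thesis by simp
  qed
  define a where "a x = (SUP t\<in>{0..1}. Q x t)" for x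
  have bdd: "bdd_above (Q x ` {0..1})" if "x \<in> {0..1}" for x
    using QB[OF that] by (intro bdd_aboveI2)
  have Qa: "Q x t \<le> a x" if "x \<in> {0..1}" "t \<in> {0..1}" for x t
    unfolding a_def by (intro cSUP_upper bdd that)
  have acont: "continuous_on {0..1} a"
  proof (rule continuous_onI)
    fix x e :: real assume x: "x \<in> {0..1}" and e: "0 < e"
    then have "0 < e / 2" by simp
    from unif[OF this] obtain d where d: "0 < d"
      "\<And>x y t u. \<lbrakk>x \<in> {0..1}; y \<in> {0..1}; t \<in> {0..1}; u \<in> {0..1}; \<bar>x - y\<bar> < d; \<bar>t - u\<bar> < d\<rbrakk> \<Longrightarrow> Q x t \<le> Q y u + e / 2"
      by blast
    have "a x \<le> a y + e / 2" if "x \<in> {0..1}" "y \<in> {0..1}" "\<bar>x - y\<bar> < d" for x y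
      unfolding a_def[of x]
    proof (rule cSUP_least)
      fix t :: real assume t: "t \<in> {0..1}"
      have "Q x t \<le> Q y t + e / 2" using that t d by (intro d(2)) auto
      also have "\<dots> \<le> a y + e / 2" using Qa[OF that(2) t] by simp
      finally show "Q x t \<le> a y + e / 2" .
    qed simp
    then have le: "a x \<le> a y + e / 2" if "x \<in> {0..1}" "y \<in> {0..1}" "\<bar>x - y\<bar> < d" for x y
      using that by blast
    have "dist (a y) (a x) \<le> e" if y: "y \<in> {0..1}" "dist y x < d" for y
    proof -
      have "\<bar>x - y\<bar> < d" "\<bar>y - x\<bar> < d" using y(2) by (auto simp: dist_real_def)
      with le[OF x y(1)] le[OF y(1) x] e show ?thesis
        unfolding dist_real_def by linarith
    qed
    then show "\<exists>d>0. \<forall>x'\<in>{0..1}. dist x' x < d \<longrightarrow> dist (a x') (a x) \<le> e"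
      using d(1) by blast
  qed
  \<comment> \<open>Clamping the argument extends \<open>a\<close> from the unit interval to a
    continuous function on the line.\<close>
  define A where "A x = a (max 0 (min 1 x))" for x
  have Aa: "A x = a x" if "x \<in> {0..1}" for x using that by (simp add: A_def)
  have Acont: "continuous_on UNIV A"
    unfolding A_def by (intro continuous_on_compose2[OF acont] continuous_intros) auto
  have A0: "0 \<le> A x" for x
    using Q0[of "max 0 (min 1 x)" 0] Qa[of "max 0 (min 1 x)" 0] unfolding A_def by auto
  have "pint p {0..1} A \<le> ennreal (10 * p / (p - 1) * 2 powr (p - 1)) * pint p {0..1} H"
  proof (rule maximal_strong_type[OF p])
    fix x l assume x: "x \<in> {0..1}" and l: "0 < l" "l < A x"
    then have "l < (SUP t\<in>{0..1}. Q x t)" by (simp add: Aa a_def)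
    then obtain t0 where t0: "t0 \<in> {0..1}" "l < Q x t0"
      using less_cSUP_iff[OF _ bdd[OF x]] by auto
    \<comment> \<open>The covering asks for a nondegenerate interval. If the mean exceeding
      \<open>l\<close> is the degenerate one, \<open>t\<close> is moved slightly off
      \<open>x\<close>; the strict inequality leaves the room \<open>Q x t0 - l\<close> for
      this.\<close>
    obtain t where t: "t \<in> {0..1}" "t \<noteq> x" "l \<le> Q x t"
    proof (cases "t0 = x")
      case False
      with t0 show ?thesis by (intro that[of t0]) auto
    next
      case True
      have "0 < Q x t0 - l" using t0 by simp
      from unif[OF this] obtain d where d: "0 < d"
        "\<And>t. \<lbrakk>t \<in> {0..1}; \<bar>t0 - t\<bar> < d\<rbrakk> \<Longrightarrow> Q x t0 \<le> Q x t + (Q x t0 - l)"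
        using x t0(1) by (metis abs_0 diff_self)
      define m where "m = min (d / 2) (1 / 2)"
      have m: "0 < m" "m < d" "m \<le> 1/2" using d(1) by (auto simp: m_def)
      \<comment> \<open>Moving away from the nearer end by at most \<open>1/2\<close> stays inside
        the unit interval.\<close>
      define t where "t = (if x \<le> 1/2 then x + m else x - m)"
      have t: "t \<in> {0..1}" "t \<noteq> x" "\<bar>x - t\<bar> < d" using m x by (auto simp: t_def)
      have "Q x t0 \<le> Q x t + (Q x t0 - l)"
        using d(2)[OF t(1)] t(3) True by simp
      then have "l \<le> Q x t" by simp
      then show ?thesis using t that by blast
    qed
    define u v where "u = min x t" and "v = max x t"
    have uv: "u < v" "x \<in> {u..v}" "{u..v} \<subseteq> {0..1}" "v - u = \<bar>t - x\<bar>"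
      using t x by (auto simp: u_def v_def min_def max_def)
    have "ennreal (l * (v - u)) \<le> ennreal (Q x t * \<bar>t - x\<bar>)"
      using t uv by (intro ennreal_leI mult_mono) (auto simp: Q0)
    also have "\<dots> = ennreal (integral {u..v} H)" by (simp add: Qabs u_def v_def)
    also have "\<dots> = (\<integral>\<^sup>+ y. ennreal (H y) * indicator {u..v} y \<partial>lborel)"
      by (rule nn_integral_has_integral_lebesgue'[symmetric])
         (auto intro!: H0 integrable_integral integrable_continuous_real HS)
    finally show "\<exists>a b. a < b \<and> x \<in> {a..b} \<and> {a..b} \<subseteq> {0..1} \<and>
        ennreal (l * (b - a)) \<le> (\<integral>\<^sup>+ u. ennreal (H u) * indicator {a..b} u \<partial>lborel)"
      using uv by blast
  qed (auto intro: borel_measurable_continuous_onI H Acont H0 A0)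
  moreover have "integral {min x t..max x t} H \<le> A x * \<bar>t - x\<bar>" if "x \<in> {0..1}" "t \<in> {0..1}" for x t
    unfolding Qabs using Qa[OF that] by (simp add: Aa[OF that(1)] mult_right_mono)
  ultimately show ?thesis using Acont A0 by blast
qed

text \<open>The mean value inequality bounds the increment by \<open>|t - x|\<close> times the
  supremum of \<open>|g'|\<close> on the segment, and that supremum exceeds \<open>|g' x|\<close> by
  at most the integral of \<open>|g''|\<close> over the segment, hence by at most
  \<open>A x * |t - x|\<close>.\<close>

lemma taylor_maximal:
  assumes p: "1 < p" and g: "C2_fun g g' g''"
  shows "\<exists>A. continuous_on UNIV A \<and> (\<forall>x. 0 \<le> A x) \<and>
    (\<forall>x\<in>{0..1}. \<forall>t\<in>{0..1}. \<bar>g t - g x\<bar> \<le> \<bar>g' x\<bar> * \<bar>t - x\<bar> + A x * (t - x)\<^sup>2) \<and>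
    pint p {0..1} A \<le> ennreal (10 * p / (p - 1) * 2 powr (p - 1)) * pint p {0..1} g''"
proof -
  have "continuous_on UNIV (\<lambda>x. \<bar>g'' x\<bar>)" by (intro continuous_intros C2_funD(5)[OF g])
  from maximal_function_exists[OF p this] obtain A where A: "continuous_on UNIV A" "\<And>x. 0 \<le> A x"
    "\<And>x t. \<lbrakk>x\<in>{0..1}; t\<in>{0..1}\<rbrakk> \<Longrightarrow> integral {min x t..max x t} (\<lambda>x. \<bar>g'' x\<bar>) \<le> A x * \<bar>t - x\<bar>"
    "pint p {0..1} A \<le> ennreal (10 * p / (p - 1) * 2 powr (p - 1)) * pint p {0..1} (\<lambda>x. \<bar>g'' x\<bar>)"
    by auto
  have "\<bar>g t - g x\<bar> \<le> \<bar>g' x\<bar> * \<bar>t - x\<bar> + A x * (t - x)\<^sup>2" if xt: "x \<in> {0..1}" "t \<in> {0..1}" for x t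
  proof -
    let ?I = "{min x t..max x t}"
    have "\<bar>g t - g x\<bar> \<le> (\<bar>g' x\<bar> + A x * \<bar>t - x\<bar>) * \<bar>t - x\<bar>"
    proof (rule field_differentiable_bound[of ?I g g', unfolded real_norm_def])
      fix z assume z: "z \<in> ?I"
      have "\<bar>g' z\<bar> \<le> \<bar>g' x\<bar> + integral ?I (\<lambda>x. \<bar>g'' x\<bar>)"
        by (rule C2_fun_deriv_bound[OF g z]) auto
      also have "\<dots> \<le> \<bar>g' x\<bar> + A x * \<bar>t - x\<bar>" using A(3)[OF xt] by simp
      finally show "\<bar>g' z\<bar> \<le> \<bar>g' x\<bar> + A x * \<bar>t - x\<bar>" .
    qed (auto intro: C2_funD(1)[OF g])
    also have "\<dots> = \<bar>g' x\<bar> * \<bar>t - x\<bar> + A x * (t - x)\<^sup>2"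
      by (simp add: algebra_simps power2_eq_square flip: abs_mult)
    finally show ?thesis .
  qed
  moreover have "pint p {0..1} (\<lambda>x. \<bar>g'' x\<bar>) = pint p {0..1} g''" by (simp add: pint_def)
  ultimately show ?thesis using A by metis
qed

section \<open>Sublinear operators\<close>

text \<open>The scalar is divided out on the side of \<open>f\<close>, whose measurability is known,
  and nothing is asked of \<open>F\<close>. This division is why \<open>s = 0\<close> is treated
  separately.\<close>

lemma pint_mult_le:
  assumes p: "0 < p" and f: "f \<in> borel_measurable (lebesgue_on S)" and s: "0 \<le> s"
    and le: "AE x in lebesgue_on S. \<bar>f x\<bar> \<le> s * \<bar>F x\<bar>"
  shows "pint p S f \<le> ennreal (s powr p) * pint p S F"
proof (cases "s = 0")
  case True
  have "pint p S f \<le> pint p S (\<lambda>x. 0)"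
    using p le by (intro pint_mono_AE) (auto simp: True elim!: eventually_mono)
  also have "\<dots> = 0" using p by (simp add: pint_def)
  finally show ?thesis by simp
next
  case False
  then have s: "0 < s" using s by simp
  have "pint p S f = pint p S (\<lambda>x. s * (f x / s))" using s by simp
  also have "\<dots> = ennreal (s powr p) * pint p S (\<lambda>x. f x / s)"
    using p s f by (subst pint_cmult) auto
  also have "\<dots> \<le> ennreal (s powr p) * pint p S F"
    using p s le by (intro mult_left_mono pint_mono_AE) (auto elim!: eventually_mono simp: field_simps)
  finally show ?thesis .
qed

text \<open>No measurability is asked of \<open>F\<close>, because it will be a \<open>diag_eval\<close>, which is defined by choice.\<close>

lemma pint_le_add_mult:
  assumes p: "0 < p" and h: "h \<in> borel_measurable (lebesgue_on S)" and g: "g \<in> borel_measurable (lebesgue_on S)"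
    and s: "0 \<le> s" and le: "AE x in lebesgue_on S. \<bar>h x\<bar> \<le> s * \<bar>F x\<bar> + \<bar>g x\<bar>"
  shows "pint p S h \<le> ennreal (2 powr p) * (ennreal (s powr p) * pint p S F + pint p S g)"
proof -
  note [measurable] = h g
  \<comment> \<open>The excess of \<open>|h|\<close> over \<open>|g|\<close> is measurable and
    bounded by \<open>s * |F|\<close>, so it can act in place of \<open>F\<close> in the triangle
    inequality.\<close>
  define f where "f x = max 0 (\<bar>h x\<bar> - \<bar>g x\<bar>)" for x
  have [measurable]: "f \<in> borel_measurable (lebesgue_on S)" unfolding f_def by measurable
  have "pint p S h \<le> ennreal (2 powr p) * (pint p S f + pint p S g)"
    using p by (intro pint_le_add) (auto simp: f_def)
  also have "\<dots> \<le> ennreal (2 powr p) * (ennreal (s powr p) * pint p S F + pint p S g)"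
    using p s le by (intro mult_left_mono add_mono pint_mult_le) (auto simp: f_def elim!: eventually_mono)
  finally show ?thesis .
qed

section \<open>Powers of extended nonnegative reals and the space \<open>L_p\<close>\<close>

lemma Lp_norm_eq: "Lp_norm p (lebesgue_on S) f = ennreal_powr (pint p S f) (1 / p)"
  by (simp add: Lp_norm_def pint_def)

lemma ennreal_powr_eq_top_iff [simp]: "ennreal_powr c a = top \<longleftrightarrow> c = top"
  by (simp add: ennreal_powr_def)

lemma Lp_space_iff: "f \<in> Lp_space p \<longleftrightarrow> f \<in> borel_measurable unit_leb \<and> pint p {0..1} f < top"
  by (simp add: Lp_space_def Lp_norm_eq less_top[symmetric])

lemma ennreal_powr_mono:
  assumes "c \<le> d" "0 \<le> a"
  shows "ennreal_powr c a \<le> ennreal_powr d a"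
proof (cases "d = top")
  case False
  then have "c \<noteq> top" using assms(1) by (auto simp: top_unique)
  then show ?thesis using False assms
    by (auto simp: ennreal_powr_def intro!: ennreal_leI powr_mono2 enn2real_mono simp: less_top)
qed (simp add: ennreal_powr_def)

lemma ennreal_powr_powr: "ennreal_powr (ennreal_powr c a) b = ennreal_powr c (a * b)"
  by (simp add: ennreal_powr_def powr_powr)

lemma ennreal_powr_1 [simp]: "ennreal_powr c 1 = c"
  by (cases c) (simp_all add: ennreal_powr_def)

text \<open>No condition on \<open>a\<close>: infinity is mapped to infinity, and
  \<open>0 powr a = 0\<close> for every \<open>a\<close>, so products of \<open>0\<close> and
  infinity agree on both sides.\<close>

lemma ennreal_powr_mult:
  "ennreal_powr (c * d) a = ennreal_powr c a * ennreal_powr d a"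
  by (cases c; cases d)
     (auto simp: ennreal_powr_def ennreal_mult_eq_top_iff enn2real_mult powr_mult ennreal_mult ennreal_top_mult
       ennreal_mult_top ennreal_eq_0_iff)

lemma ennreal_powr_ennreal: "0 \<le> c \<Longrightarrow> ennreal_powr (ennreal c) a = ennreal (c powr a)"
  by (simp add: ennreal_powr_def)

lemma pint_le_of_Lp_norm_le:
  assumes "0 < p" "Lp_norm p (lebesgue_on S) f \<le> w"
  shows "pint p S f \<le> ennreal_powr w p"
proof -
  have "pint p S f = ennreal_powr (ennreal_powr (pint p S f) (1 / p)) p"
    using assms(1) by (simp add: ennreal_powr_powr)
  also have "\<dots> \<le> ennreal_powr w p"
    using assms by (intro ennreal_powr_mono) (auto simp: Lp_norm_eq)
  finally show ?thesis .
qed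

lemma Lp_space_add:
  assumes "0 < p" "f \<in> Lp_space p" "g \<in> Lp_space p"
  shows "(\<lambda>x. f x + g x) \<in> Lp_space p"
proof -
  have "pint p {0..1} (\<lambda>x. f x + g x) \<le> ennreal (2 powr p) * (pint p {0..1} f + pint p {0..1} g)"
    using assms by (intro pint_le_add) (auto simp: Lp_space_iff)
  also have "\<dots> < top"
    using assms by (simp add: Lp_space_iff ennreal_mult_less_top)
  finally show ?thesis using assms by (auto simp: Lp_space_iff)
qed

lemma Lp_space_cmult:
  assumes "0 < p" "f \<in> Lp_space p"
  shows "(\<lambda>x. c * f x) \<in> Lp_space p"
  using assms by (auto simp: Lp_space_iff pint_cmult ennreal_mult_less_top)

lemma Lp_space_diff:
  assumes "0 < p" "f \<in> Lp_space p" "g \<in> Lp_space p"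
  shows "(\<lambda>x. f x - g x) \<in> Lp_space p"
  using Lp_space_add[OF assms(1,2) Lp_space_cmult[OF assms(1,3), of "-1"]] by simp

lemma Lp_space_abs:
  assumes "f \<in> Lp_space p"
  shows "(\<lambda>x. \<bar>f x\<bar>) \<in> Lp_space p"
  using assms by (auto simp: Lp_space_iff pint_def)

lemma Lp_space_const: "0 < p \<Longrightarrow> (\<lambda>x. c) \<in> Lp_space p"
  by (rule continuous_imp_Lp_space) auto

section \<open>Consequences of sublinearity, monotonicity and translatability for one
  operator\<close>

locale sublinear_Lp_operator =
  fixes p :: real and T :: fun_op
  assumes p: "1 < p" and Lp: "Lp_operator p T" and translatable: "strongly_translatable_op p T"
    and sublinear: "sublinear_op p T" and monotone: "monotone_op p T"
begin

lemma p0: "0 < p" using p by simp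

lemma T_Lp: "f \<in> Lp_space p \<Longrightarrow> T f \<in> Lp_space p"
  using Lp by (simp add: Lp_operator_def)

lemma T_cong:
  "\<lbrakk>f \<in> Lp_space p; g \<in> Lp_space p; AE x in unit_leb. f x = g x\<rbrakk> \<Longrightarrow> AE x in unit_leb. T f x = T g x"
  using Lp by (simp add: Lp_operator_def)

lemma T_add: "\<lbrakk>f \<in> Lp_space p; g \<in> Lp_space p\<rbrakk> \<Longrightarrow> AE x in unit_leb. T (\<lambda>t. f t + g t) x \<le> T f x + T g x"
  using sublinear by (simp add: sublinear_op_def)

lemma T_scale: "\<lbrakk>f \<in> Lp_space p; 0 \<le> a\<rbrakk> \<Longrightarrow> AE x in unit_leb. T (\<lambda>t. a * f t) x = a * T f x"
  using sublinear by (simp add: sublinear_op_def)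

lemma T_mono: "\<lbrakk>f \<in> Lp_space p; g \<in> Lp_space p; AE x in unit_leb. f x \<le> g x\<rbrakk> \<Longrightarrow> AE x in unit_leb. T f x \<le> T g x"
  using monotone by (simp add: monotone_op_def)

lemma T_translate: "f \<in> Lp_space p \<Longrightarrow> AE x in unit_leb. T (\<lambda>t. f t + a) x = T f x + a * T (\<lambda>t. 1) x"
  using translatable by (simp add: strongly_translatable_op_def)

lemma T_zero: "AE x in unit_leb. T (\<lambda>t. 0) x = 0"
  using T_scale[OF Lp_space_const[OF p0, of 1], of 0] by simp

lemma T_diff_le:
  assumes f: "f \<in> Lp_space p" and g: "g \<in> Lp_space p" and k: "k \<in> Lp_space p"
    and le: "AE t in unit_leb. f t \<le> g t + k t"
  shows "AE y in unit_leb. T f y \<le> T g y + T k y"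
  using T_mono[OF f Lp_space_add[OF p0 g k] le] T_add[OF g k] by eventually_elim simp

text \<open>What remains of linearity: \<open>f \<le> g + |f - g|\<close> passes through
  \<open>T\<close> by monotonicity and subadditivity, and \<open>f\<close> and \<open>g\<close> may
  be interchanged.\<close>

lemma T_abs_diff_le:
  assumes f: "f \<in> Lp_space p" and g: "g \<in> Lp_space p"
  shows "AE y in unit_leb. \<bar>T f y - T g y\<bar> \<le> T (\<lambda>t. \<bar>f t - g t\<bar>) y"
proof -
  have k: "(\<lambda>t. \<bar>f t - g t\<bar>) \<in> Lp_space p"
    by (intro Lp_space_abs Lp_space_diff p0 f g)
  have "AE y in unit_leb. T f y \<le> T g y + T (\<lambda>t. \<bar>f t - g t\<bar>) y"
    by (rule T_diff_le[OF f g k]) auto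
  moreover have "AE y in unit_leb. T g y \<le> T f y + T (\<lambda>t. \<bar>f t - g t\<bar>) y"
    by (rule T_diff_le[OF g f k]) auto
  ultimately show ?thesis by eventually_elim simp
qed

text \<open>The value \<open>a * T 1\<close> at the constant \<open>a\<close> is wanted for negative
  \<open>a\<close> as well, where positive homogeneity is silent; translating the zero function
  gives it for all \<open>a\<close>.\<close>

lemma T_near_const:
  assumes f: "f \<in> Lp_space p" and k: "k \<in> Lp_space p" and le: "AE t in unit_leb. \<bar>f t - a\<bar> \<le> k t"
  shows "AE y in unit_leb. \<bar>T f y - a * T (\<lambda>t. 1) y\<bar> \<le> T k y"
proof -
  have c: "(\<lambda>t. a) \<in> Lp_space p" "(\<lambda>t. 0) \<in> Lp_space p" by (rule Lp_space_const[OF p0])+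
  have "AE y in unit_leb. T f y \<le> T (\<lambda>t. a) y + T k y"
    by (rule T_diff_le[OF f c(1) k]) (use le in \<open>auto elim!: eventually_mono\<close>)
  moreover have "AE y in unit_leb. T (\<lambda>t. a) y \<le> T f y + T k y"
    by (rule T_diff_le[OF c(1) f k]) (use le in \<open>auto elim!: eventually_mono\<close>)
  moreover have "AE y in unit_leb. T (\<lambda>t. a) y = a * T (\<lambda>t. 1) y"
    using T_translate[OF c(2), of a] T_zero by eventually_elim simp
  ultimately show ?thesis by eventually_elim simp
qed

text \<open>Positive homogeneity allows scaling to the unit ball. The scale vanishes when
  \<open>f = 0\<close> almost everywhere, and then \<open>T f\<close> agrees with
  \<open>T 0 = 0\<close> almost everywhere.\<close>

lemma T_bound:
  assumes B: "op_norm p T \<le> B" and f: "f \<in> Lp_space p"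
  shows "pint p {0..1} (T f) \<le> ennreal_powr B p * pint p {0..1} f"
proof -
  have unit: "pint p {0..1} (T v) \<le> ennreal_powr B p" if v: "v \<in> Lp_space p" "pint p {0..1} v \<le> 1" for v
  proof (rule pint_le_of_Lp_norm_le[OF p0])
    have "Lp_norm p unit_leb v \<le> ennreal_powr 1 (1 / p)"
      unfolding Lp_norm_eq using v p by (intro ennreal_powr_mono) auto
    then have "Lp_norm p unit_leb v \<le> 1" by (simp add: ennreal_powr_def)
    then have "Lp_norm p unit_leb (T v) \<le> op_norm p T"
      unfolding op_norm_def using v by (intro SUP_upper) auto
    then show "Lp_norm p unit_leb (T v) \<le> B" using B by (rule order_trans)
  qed
  obtain J where J: "0 \<le> J" "pint p {0..1} f = ennreal J"
    using f by (cases "pint p {0..1} f") (auto simp: Lp_space_iff)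
  have m[measurable]: "f \<in> borel_measurable unit_leb" using f by (simp add: Lp_space_iff)
  show ?thesis
  proof (cases "J = 0")
    case True
    then have "AE x in unit_leb. ennreal (\<bar>f x\<bar> powr p) = 0"
      using J(2) unfolding pint_def by (subst nn_integral_0_iff_AE[symmetric]) auto
    then have "AE x in unit_leb. f x = 0"
    proof eventually_elim
      case (elim x)
      then have "\<bar>f x\<bar> powr p \<le> 0" by (simp add: ennreal_eq_0_iff)
      then show ?case by (simp add: not_less[symmetric])
    qed
    then have "AE x in unit_leb. T f x = T (\<lambda>t. 0) x"
      by (intro T_cong f Lp_space_const p0)
    then have "AE x in unit_leb. \<bar>T f x\<bar> \<le> \<bar>(0::real)\<bar>"
      using T_zero by eventually_elim simp
    then have "pint p {0..1} (T f) \<le> pint p {0..1} (\<lambda>x. 0)"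
      using p by (intro pint_mono_AE) auto
    then show ?thesis using p by (simp add: pint_def)
  next
    case False
    then have J0: "0 < J" using J by simp
    define c where "c = J powr (1 / p)"
    have c: "0 < c" "c powr p = J" using J0 p by (auto simp: c_def powr_powr)
    define v where "v t = (1 / c) * f t" for t
    have v: "v \<in> Lp_space p" unfolding v_def by (intro Lp_space_cmult p0 f)
    have "pint p {0..1} v = ennreal ((1 / c) powr p) * ennreal J"
      unfolding v_def using c p J by (subst pint_cmult) auto
    also have "\<dots> = ennreal 1"
      using c J0 by (subst ennreal_mult[symmetric]) (auto simp: powr_divide)
    finally have v1: "pint p {0..1} v \<le> 1" by simp
    have eq: "(\<lambda>t. c * v t) = f" using c by (simp add: v_def fun_eq_iff)
    have "pint p {0..1} (T f) \<le> pint p {0..1} (\<lambda>x. c * T v x)"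
      using T_scale[OF v, of c] c p unfolding eq by (intro pint_mono_AE) (auto elim!: eventually_mono)
    also have "\<dots> = ennreal (c powr p) * pint p {0..1} (T v)"
      using T_Lp[OF v] c p by (subst pint_cmult) (auto simp: Lp_space_iff)
    also have "\<dots> \<le> ennreal J * ennreal_powr B p"
      unfolding c by (intro mult_left_mono unit v v1) auto
    finally show ?thesis by (simp add: J mult.commute)
  qed
qed

lemma diag_estimate:
  assumes g: "C2_fun g g' g''" and A: "continuous_on UNIV A" "\<And>x. 0 \<le> A x"
    and taylor: "\<And>x t. \<lbrakk>x \<in> {0..1}; t \<in> {0..1}\<rbrakk> \<Longrightarrow> \<bar>g t - g x\<bar> \<le> \<bar>g' x\<bar> * \<bar>t - x\<bar> + A x * (t - x)\<^sup>2"
  shows "AE y in unit_leb. \<bar>T g y - g y * T (\<lambda>t. 1) y\<bar> \<le>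
     \<bar>g' y\<bar> * diag_eval T (\<lambda>x t. \<bar>t - x\<bar>) y + A y * diag_eval T (\<lambda>x t. (t - x)\<^sup>2) y"
proof -
  \<comment> \<open>The same choice terms as in \<open>diag_eval\<close>, so that the diagonals of
    \<open>F\<close> and \<open>G\<close> are the functions in the claim.\<close>
  define F where "F = (SOME F. continuous_rep T (\<lambda>x t. \<bar>t - x\<bar>) F)"
  define G where "G = (SOME F. continuous_rep T (\<lambda>x t. (t - x)\<^sup>2) F)"
  have F: "continuous_rep T (\<lambda>x t. \<bar>t - x\<bar>) F"
    unfolding F_def using continuous_rep_exists_abs[OF p0 Lp sublinear monotone] by (rule someI_ex)
  have G: "continuous_rep T (\<lambda>x t. (t - x)\<^sup>2) G"
    unfolding G_def using continuous_rep_exists_square[OF p0 Lp sublinear monotone] by (rule someI_ex)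
  define Q where "Q = \<rat> \<inter> {0..1::real}"
  have cQ: "countable Q" unfolding Q_def by (simp add: countable_rat)
  have clQ: "closure Q = {0..1}" unfolding Q_def by (rule closure_rational_unit)
  have gL: "g \<in> Lp_space p" by (intro continuous_imp_Lp_space C2_funD(3)[OF g] p0)
  \<comment> \<open>The slack of the estimate. \<open>0 \<le> k x y\<close> is a closed condition on
    \<open>x\<close>, because for almost every \<open>y\<close> all ingredients that depend on
    \<open>x\<close> are continuous in it.\<close>
  define k where "k x y = \<bar>g' x\<bar> * F x y + A x * G x y - \<bar>T g y - g x * T (\<lambda>t. 1) y\<bar>" for x y
  have "AE y in unit_leb. \<forall>x\<in>Q. 0 \<le> k x y"
  proof (subst AE_ball_countable[OF cQ], intro ballI)
    fix x assume "x \<in> Q"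
    then have x: "x \<in> {0..1}" by (simp add: Q_def)
    have L: "(\<lambda>t. \<bar>t - x\<bar>) \<in> Lp_space p" "(\<lambda>t. (t - x)\<^sup>2) \<in> Lp_space p"
      by (intro continuous_imp_Lp_space p0 continuous_intros)+
    have L': "(\<lambda>t. \<bar>g' x\<bar> * \<bar>t - x\<bar>) \<in> Lp_space p" "(\<lambda>t. A x * (t - x)\<^sup>2) \<in> Lp_space p"
      by (intro Lp_space_cmult p0 L)+
    have "AE y in unit_leb. \<bar>T g y - g x * T (\<lambda>t. 1) y\<bar> \<le> T (\<lambda>t. \<bar>g' x\<bar> * \<bar>t - x\<bar> + A x * (t - x)\<^sup>2) y"
      by (rule T_near_const[OF gL Lp_space_add[OF p0 L']]) (rule AE_I2, use taylor[OF x] in simp)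
    moreover note T_add[OF L'] T_scale[OF L(1) abs_ge_zero[of "g' x"]] T_scale[OF L(2) A(2), of x]
    moreover have "AE y in unit_leb. F x y = T (\<lambda>t. \<bar>t - x\<bar>) y" "AE y in unit_leb. G x y = T (\<lambda>t. (t - x)\<^sup>2) y"
      using F G x unfolding continuous_rep_def by blast+
    ultimately show "AE y in unit_leb. 0 \<le> k x y"
    proof eventually_elim
      case (elim y)
      then show ?case unfolding k_def by (simp only: elim(5,6))
    qed
  qed
  moreover have "AE y in unit_leb. continuous_on {0..1} (\<lambda>x. F x y)" "AE y in unit_leb. continuous_on {0..1} (\<lambda>x. G x y)"
    using F G unfolding continuous_rep_def by blast+
  moreover have "AE y in unit_leb. y \<in> {0..1}" by (rule AE_I2) simp
  ultimately show ?thesis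
  proof eventually_elim
    case (elim y)
    have "continuous_on {0..1} A" using A(1) by (rule continuous_on_subset) simp
    then have "continuous_on (closure Q) (\<lambda>x. k x y)"
      unfolding k_def clQ by (intro continuous_intros C2_funD[OF g] elim)
    then have "0 \<le> k y y"
      by (rule continuous_ge_on_closure) (use elim clQ in auto)
    then show ?case by (simp add: k_def diag_eval_def F_def G_def)
  qed
qed

end

text \<open>The error splits into \<open>T g - g * T 1\<close> and \<open>g * (T 1 - 1)\<close>. The
  bounded factors \<open>|g|\<close> and \<open>|g'|\<close> go with the quantities small in
  \<open>L_p\<close>, the maximal function with the uniformly small one. \<open>C\<close> is chosen
  before \<open>T\<close>, so it serves all operators at once, and \<open>Z\<close> dominates all
  three \<open>p\<close>-th powers.\<close>

lemma smooth_estimate: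
  assumes p: "1 < p"
  shows "\<exists>C::ennreal. C \<noteq> top \<and> (\<forall>T g g' g'' Z m. sublinear_Lp_operator p T \<longrightarrow> C2_fun g g' g'' \<longrightarrow> 0 \<le> m \<longrightarrow>
     pint p {0..1} (\<lambda>x. T (\<lambda>t. 1) x - 1) \<le> Z \<longrightarrow> pint p {0..1} (diag_eval T (\<lambda>x t. \<bar>t - x\<bar>)) \<le> Z \<longrightarrow>
     mu_param T \<le> ennreal m \<longrightarrow> ennreal (m powr p) \<le> Z \<longrightarrow>
     pint p {0..1} (\<lambda>x. T g x - g x) \<le> C * (Z * (pint p {0..1} g + pint p {0..1} g'')))"
proof -
  have p0: "0 < p" "0 \<le> p" "1 \<le> p" using p by auto
  obtain S where S: "0 < S" and sup: "\<And>u u' u'' x. \<lbrakk>C2_fun u u' u''; x \<in> {0..1}\<rbrakk> \<Longrightarrow>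
     ennreal (\<bar>u x\<bar> powr p) \<le> ennreal S * (pint p {0..1} u + pint p {0..1} u'') \<and>
     ennreal (\<bar>u' x\<bar> powr p) \<le> ennreal S * (pint p {0..1} u + pint p {0..1} u'')"
    using C2_fun_sup_bound[of 0 1 p] p by auto
  define M where "M = ennreal (10 * p / (p - 1) * 2 powr (p - 1))"
  define c where "c = ennreal (2 powr p)"
  define C where "C = c * (ennreal S + c * (ennreal S + M))"
  have fin: "C \<noteq> top" by (simp add: C_def c_def M_def ennreal_mult_eq_top_iff)
  have "pint p {0..1} (\<lambda>x. T g x - g x) \<le> C * (Z * (pint p {0..1} g + pint p {0..1} g''))"
    if T: "sublinear_Lp_operator p T" and g: "C2_fun g g' g''" and m: "0 \<le> m" "mu_param T \<le> ennreal m"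
      and Z: "pint p {0..1} (\<lambda>x. T (\<lambda>t. 1) x - 1) \<le> Z" "pint p {0..1} (diag_eval T (\<lambda>x t. \<bar>t - x\<bar>)) \<le> Z"
        "ennreal (m powr p) \<le> Z"
    for T g g' g'' Z m
  proof -
    interpret sublinear_Lp_operator p T by (rule T)
    define Y where "Y = pint p {0..1} g + pint p {0..1} g''"
    obtain A where A: "continuous_on UNIV A" "\<And>x. 0 \<le> A x"
      "\<And>x t. \<lbrakk>x\<in>{0..1}; t\<in>{0..1}\<rbrakk> \<Longrightarrow> \<bar>g t - g x\<bar> \<le> \<bar>g' x\<bar> * \<bar>t - x\<bar> + A x * (t - x)\<^sup>2"
      "pint p {0..1} A \<le> M * pint p {0..1} g''"
      using taylor_maximal[OF p g] unfolding M_def by blast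
    have att: "\<exists>z\<in>{0..1}. \<forall>x\<in>{0..1}. \<bar>v x\<bar> \<le> \<bar>v z\<bar>" if "continuous_on {0..1} v" for v :: "real \<Rightarrow> real"
      using continuous_attains_sup[of "{0..1::real}" "\<lambda>x. \<bar>v x\<bar>"] that by (auto intro: continuous_intros)
    \<comment> \<open>Since the maxima are attained, the embedding has to be applied at a single
      point only.\<close>
    obtain z where z: "z \<in> {0..1}" "\<And>x. x \<in> {0..1} \<Longrightarrow> \<bar>g x\<bar> \<le> \<bar>g z\<bar>"
      using att[OF C2_funD(3)[OF g]] by blast
    obtain z' where z': "z' \<in> {0..1}" "\<And>x. x \<in> {0..1} \<Longrightarrow> \<bar>g' x\<bar> \<le> \<bar>g' z'\<bar>"
      using att[OF C2_funD(4)[OF g]] by blast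
    have gL: "g \<in> Lp_space p" by (intro continuous_imp_Lp_space C2_funD(3)[OF g] p0)
    have oneL: "(\<lambda>t. 1) \<in> Lp_space p" by (rule Lp_space_const[OF p0(1)])
    have [measurable]: "T g \<in> borel_measurable unit_leb" "T (\<lambda>t. 1) \<in> borel_measurable unit_leb"
      using T_Lp[OF gL] T_Lp[OF oneL] by (auto simp: Lp_space_iff)
    have [measurable]: "g \<in> borel_measurable unit_leb" "A \<in> borel_measurable unit_leb"
      by (intro borel_measurable_lebesgue_on_continuous C2_funD(3)[OF g] A)+
    define e where "e x = g x * (T (\<lambda>t. 1) x - 1)" for x
    have [measurable]: "e \<in> borel_measurable unit_leb" unfolding e_def by measurable
    have "AE y in unit_leb. ennreal \<bar>diag_eval T (\<lambda>x t. (t - x)\<^sup>2) y\<bar> \<le> mu_param T"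
      unfolding mu_param_def Linf_norm_def by (rule esssup_AE)
    then have mu: "AE y in unit_leb. \<bar>diag_eval T (\<lambda>x t. (t - x)\<^sup>2) y\<bar> \<le> m"
    proof eventually_elim
      case (elim y)
      then have "ennreal \<bar>diag_eval T (\<lambda>x t. (t - x)\<^sup>2) y\<bar> \<le> ennreal m" using m(2) by (rule order_trans)
      then show ?case using m(1) by simp
    qed
    have in01: "AE y in unit_leb. y \<in> {0..1}" by (rule AE_I2) simp
    have diag: "AE y in unit_leb. \<bar>T g y - g y * T (\<lambda>t. 1) y\<bar> \<le>
       \<bar>g' y\<bar> * diag_eval T (\<lambda>x t. \<bar>t - x\<bar>) y + A y * diag_eval T (\<lambda>x t. (t - x)\<^sup>2) y"
      by (rule diag_estimate[OF g A(1,2)]) (rule A(3))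
    have "pint p {0..1} (\<lambda>x. T g x - g x) \<le> ennreal (2 powr p) * (ennreal (\<bar>g' z'\<bar> powr p) * pint p {0..1} (diag_eval T (\<lambda>x t. \<bar>t - x\<bar>)) +
       pint p {0..1} (\<lambda>x. \<bar>e x\<bar> + m * A x))"
    proof (rule pint_le_add_mult[OF p0(1)])
      show "AE y in unit_leb. \<bar>T g y - g y\<bar> \<le> \<bar>g' z'\<bar> * \<bar>diag_eval T (\<lambda>x t. \<bar>t - x\<bar>) y\<bar> + \<bar>\<bar>e y\<bar> + m * A y\<bar>"
        using diag mu in01
      proof eventually_elim
        case (elim y)
        have "\<bar>g' y\<bar> * diag_eval T (\<lambda>x t. \<bar>t - x\<bar>) y \<le> \<bar>g' z'\<bar> * \<bar>diag_eval T (\<lambda>x t. \<bar>t - x\<bar>) y\<bar>"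
          using z'(2)[OF elim(3)] by (intro order_trans[OF mult_left_mono mult_right_mono]) auto
        moreover have "A y * diag_eval T (\<lambda>x t. (t - x)\<^sup>2) y \<le> A y * m"
          using elim(2) A(2) by (intro mult_left_mono) auto
        moreover have "\<bar>T g y - g y\<bar> \<le> \<bar>T g y - g y * T (\<lambda>t. 1) y\<bar> + \<bar>e y\<bar>"
          unfolding e_def by (simp add: algebra_simps)
        moreover have "\<bar>\<bar>e y\<bar> + m * A y\<bar> = \<bar>e y\<bar> + A y * m" using m A(2)[of y] by simp
        ultimately show ?case using elim(1) by linarith
      qed
    qed (use m in auto)
    also have "pint p {0..1} (\<lambda>x. \<bar>e x\<bar> + m * A x) \<le> c * (pint p {0..1} (\<lambda>x. \<bar>e x\<bar>) + pint p {0..1} (\<lambda>x. m * A x))"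
      unfolding c_def using p0 by (intro pint_le_add) auto
    also have "pint p {0..1} (\<lambda>x. \<bar>e x\<bar>) \<le> ennreal (\<bar>g z\<bar> powr p) * pint p {0..1} (\<lambda>x. T (\<lambda>t. 1) x - 1)"
      by (intro pint_mult_le p0 AE_I2) (auto simp: e_def abs_mult intro!: mult_right_mono z)
    also have "\<dots> \<le> ennreal S * Y * Z"
      using sup[OF g z(1)] unfolding Y_def by (intro mult_mono Z) auto
    also have "pint p {0..1} (\<lambda>x. m * A x) = ennreal (m powr p) * pint p {0..1} A"
      using m p0 by (subst pint_cmult) auto
    also have "\<dots> \<le> Z * (M * Y)"
    proof (intro mult_mono Z order_trans[OF A(4)])
      show "pint p {0..1} g'' \<le> Y" by (simp add: Y_def)
    qed auto
    also have "ennreal (\<bar>g' z'\<bar> powr p) * pint p {0..1} (diag_eval T (\<lambda>x t. \<bar>t - x\<bar>)) \<le> ennreal S * Y * Z"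
      using sup[OF g z'(1)] unfolding Y_def by (intro mult_mono Z) auto
    finally have "pint p {0..1} (\<lambda>x. T g x - g x) \<le> c * (ennreal S * Y * Z + c * (ennreal S * Y * Z + Z * (M * Y)))"
      by (simp add: c_def mult_left_mono add_mono)
    also have "\<dots> = C * (Z * Y)" by (simp add: C_def algebra_simps)
    finally show ?thesis by (simp add: Y_def)
  qed
  with fin show ?thesis by blast
qed

section \<open>Density of polynomials\<close>

lemma lebesgue_shift_measurable: "(\<lambda>x::real. x + c) \<in> measurable lebesgue lebesgue"
  using lebesgue_affine_measurable[of "\<lambda>_. 1" c] by (simp add: add.commute)

text \<open>Here \<open>v\<close> is measurable on the unit interval only. It is extended by
  \<open>0\<close>, and the shift is carried out for Lebesgue measurable functions.\<close>

lemma pint_shift_le: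
  assumes v: "v \<in> borel_measurable unit_leb" and c: "a + c \<ge> 0" "b + c \<le> 1"
  shows "(\<lambda>x. v (x + c)) \<in> borel_measurable (lebesgue_on {a..b})"
    "pint p {a..b} (\<lambda>x. v (x + c)) \<le> pint p {0..1} v"
proof -
  define w where "w x = (if x \<in> {0..1} then v x else 0)" for x
  have w[measurable]: "w \<in> borel_measurable lebesgue"
    unfolding w_def using v by (intro borel_measurable_if_I) auto
  have [measurable]: "(indicator {0..1} :: real \<Rightarrow> ennreal) \<in> borel_measurable lebesgue"
    by (intro borel_measurable_indicator) auto
  have wm: "(\<lambda>x. ennreal (\<bar>w x\<bar> powr p) * indicator {0..1} x) \<in> borel_measurable lebesgue"
    by measurable
  have wc: "(\<lambda>x. w (x + c)) \<in> borel_measurable lebesgue"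
    by (rule measurable_compose[OF lebesgue_shift_measurable w])
  have eq: "v (x + c) = w (x + c)" if "x \<in> {a..b}" for x
    using that c by (simp add: w_def)
  show "(\<lambda>x. v (x + c)) \<in> borel_measurable (lebesgue_on {a..b})"
    using measurable_restrict_space1[OF wc, of "{a..b}"]
    by (subst measurable_lebesgue_cong[of _ _ "\<lambda>x. w (x + c)"]) (use eq in auto)
  have "pint p {a..b} (\<lambda>x. v (x + c)) \<le> (\<integral>\<^sup>+ x. ennreal (\<bar>w (x + c)\<bar> powr p) * indicator {0..1} (x + c) \<partial>lebesgue)"
    unfolding pint_eq[of "{a..b}", simplified] nn_integral_completion using c
    by (intro nn_integral_mono) (auto simp: w_def split: split_indicator)
  also have "\<dots> = (\<integral>\<^sup>+ x. ennreal (\<bar>w x\<bar> powr p) * indicator {0..1} x \<partial>lebesgue)"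
    using nn_integral_real_affine_lebesgue[OF wm, of 1 c] by (simp add: add.commute)
  also have "\<dots> = pint p {0..1} v"
    unfolding pint_eq[of "{0..1}", simplified] nn_integral_completion
    by (intro nn_integral_cong) (auto simp: w_def split: split_indicator)
  finally show "pint p {a..b} (\<lambda>x. v (x + c)) \<le> pint p {0..1} v" .
qed

text \<open>Makes second differences stable under small changes in \<open>L_p\<close>, uniformly in
  the step; this is how they pass from \<open>f\<close> to the polynomial.\<close>

lemma second_difference_bound:
  assumes p: "0 < p" and v: "v \<in> borel_measurable unit_leb" and s: "0 \<le> s"
  shows "second_difference s v \<in> borel_measurable (lebesgue_on {0..1 - 2 * s})"
    "pint p {0..1 - 2 * s} (second_difference s v) \<le>
      ennreal (2 powr p) * (ennreal (2 powr p) * (1 + ennreal (2 powr p)) + 1) * pint p {0..1} v"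
proof -
  define c where "c = ennreal (2 powr p)"
  let ?S = "{0..1 - 2 * s}"
  have m[measurable]: "(\<lambda>x. v (x + 2 * s)) \<in> borel_measurable (lebesgue_on ?S)"
    "(\<lambda>x. v (x + s)) \<in> borel_measurable (lebesgue_on ?S)" "(\<lambda>x. v (x + 0)) \<in> borel_measurable (lebesgue_on ?S)"
    using s by (intro pint_shift_le(1)[OF v]; simp)+
  note m0 [measurable] = m(3)[simplified]
  show "second_difference s v \<in> borel_measurable (lebesgue_on ?S)"
    unfolding second_difference_def by measurable
  have b: "pint p ?S (\<lambda>x. v (x + 2 * s)) \<le> pint p {0..1} v" "pint p ?S (\<lambda>x. v (x + s)) \<le> pint p {0..1} v"
     "pint p ?S (\<lambda>x. v (x + 0)) \<le> pint p {0..1} v"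
    using s by (intro pint_shift_le(2)[OF v]; simp)+
  have "pint p ?S (second_difference s v) \<le> c * (pint p ?S (\<lambda>x. v (x + 2 * s) - 2 * v (x + s)) + pint p ?S v)"
    unfolding c_def second_difference_def using p by (intro pint_le_add) auto
  also have "pint p ?S (\<lambda>x. v (x + 2 * s) - 2 * v (x + s)) \<le> c * (pint p ?S (\<lambda>x. v (x + 2 * s)) + pint p ?S (\<lambda>x. 2 * v (x + s)))"
    unfolding c_def using p by (intro pint_le_add) auto
  also have "pint p ?S (\<lambda>x. 2 * v (x + s)) = c * pint p ?S (\<lambda>x. v (x + s))"
    using p by (subst pint_cmult) (auto simp: c_def)
  finally have "pint p ?S (second_difference s v) \<le>
      c * (c * (pint p ?S (\<lambda>x. v (x + 2 * s)) + c * pint p ?S (\<lambda>x. v (x + s))) + pint p ?S v)"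
    by (simp add: mult_left_mono add_mono)
  also have "\<dots> \<le> c * (c * (pint p {0..1} v + c * pint p {0..1} v) + pint p {0..1} v)"
    using b by (intro mult_left_mono add_mono) auto
  also have "\<dots> = c * (c * (1 + c) + 1) * pint p {0..1} v"
    by (simp add: algebra_simps)
  finally show "pint p ?S (second_difference s v) \<le>
      ennreal (2 powr p) * (ennreal (2 powr p) * (1 + ennreal (2 powr p)) + 1) * pint p {0..1} v"
    by (simp add: c_def)
qed

lemma C2_fun_polynomial:
  assumes "real_polynomial_function g"
  shows "\<exists>g' g''. C2_fun g g' g''"
proof -
  obtain g' where g': "real_polynomial_function g'" "\<And>x. (g has_real_derivative g' x) (at x)"
    using has_real_derivative_polynomial_function[OF assms] by blast
  obtain g'' where g'': "real_polynomial_function g''" "\<And>x. (g' has_real_derivative g'' x) (at x)"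
    using has_real_derivative_polynomial_function[OF g'(1)] by blast
  have "continuous_on UNIV g''"
    using g''(1) by (simp add: continuous_on_polymonial_function real_polynomial_function_eq)
  then show ?thesis using g' g'' by (auto simp: C2_fun_def)
qed

text \<open>Three approximations: truncation at a height \<open>K\<close>, a truncated continuous
  function, a polynomial. The truncation supplies the dominating constant that carries pointwise
  convergence over to the integrals.\<close>

lemma polynomial_dense_Lp:
  assumes p: "0 < p" and f: "f \<in> Lp_space p" and e: "0 < e"
  shows "\<exists>g. real_polynomial_function g \<and> pint p {0..1} (\<lambda>x. f x - g x) \<le> ennreal e"
proof -
  have fm[measurable]: "f \<in> borel_measurable unit_leb" and ff: "pint p {0..1} f < top"
    using f by (auto simp: Lp_space_iff)
  define cut where "cut K y = max (- K) (min K y)" for K y :: real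
  have cutm[measurable]: "(\<lambda>x. cut K (u x)) \<in> borel_measurable M" if "u \<in> borel_measurable M" for K u and M :: "real measure"
    unfolding cut_def using that by measurable
  define c where "c = 2 powr p"
  have c: "0 < c" by (simp add: c_def)
  \<comment> \<open>The triangle inequality is used twice, nested: the total is
    \<open>c * (e1 + c * (e1 + e1)) = (c + 2 * c * c) * e1\<close>.\<close>
  define e1 where "e1 = e / (c + 2 * c * c)"
  have e1: "0 < e1" using e c by (simp add: e1_def add_pos_pos)
  have "(\<lambda>K. \<integral>\<^sup>+ x. ennreal (\<bar>f x - cut (real K) (f x)\<bar> powr p) \<partial>unit_leb) \<longlonglongrightarrow> (\<integral>\<^sup>+ x. 0 \<partial>unit_leb)"
  proof (rule nn_integral_dominated_convergence[where w = "\<lambda>x. ennreal (\<bar>f x\<bar> powr p)"])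
    show "AE x in unit_leb. ennreal (\<bar>f x - cut (real j) (f x)\<bar> powr p) \<le> ennreal (\<bar>f x\<bar> powr p)" for j
      using p by (intro AE_I2 ennreal_leI powr_mono2) (auto simp: cut_def)
    show "AE x in unit_leb. (\<lambda>K. ennreal (\<bar>f x - cut (real K) (f x)\<bar> powr p)) \<longlonglongrightarrow> 0"
    proof (intro AE_I2 tendsto_eventually)
      fix x
      obtain K0 :: nat where K0: "\<bar>f x\<bar> \<le> real K0" using real_arch_simple by blast
      show "\<forall>\<^sub>F K in sequentially. ennreal (\<bar>f x - cut (real K) (f x)\<bar> powr p) = 0"
        using eventually_ge_at_top[of K0]
      proof eventually_elim
        case (elim K)
        then have "\<bar>f x\<bar> \<le> real K" using K0 by linarith
        then have "cut (real K) (f x) = f x" by (auto simp: cut_def)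
        then show ?case using p by simp
      qed
    qed
  qed (use ff in \<open>auto simp: pint_def\<close>)
  then have "\<forall>\<^sub>F K in sequentially. (\<integral>\<^sup>+ x. ennreal (\<bar>f x - cut (real K) (f x)\<bar> powr p) \<partial>unit_leb) < ennreal e1"
    using e1 by (intro order_tendstoD(2)) auto
  then obtain K :: nat where K: "pint p {0..1} (\<lambda>x. f x - cut (real K) (f x)) < ennreal e1"
    unfolding pint_def by (auto simp: eventually_sequentially)
  have "(\<lambda>x. if x \<in> {0..1} then f x else 0) \<in> borel_measurable lebesgue"
    by (intro borel_measurable_if_I) auto
  \<comment> \<open>Measurability in the sense of \<open>measurable_on\<close> supplies continuous
    functions converging off a negligible set.\<close>
  then have "(\<lambda>x. if x \<in> {0..1} then f x else 0) measurable_on {0..1}"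
    by (rule lebesgue_measurable_imp_measurable_on) simp
  then obtain N g where N: "negligible N" and gc: "\<And>n::nat. continuous_on UNIV (g n)"
    and gl: "\<And>x. x \<notin> N \<Longrightarrow> (\<lambda>n. g n x) \<longlonglongrightarrow> (if x \<in> {0..1} then if x \<in> {0..1} then f x else 0 else 0)"
    unfolding measurable_on_def by blast
  have AEN: "AE x in unit_leb. x \<notin> N"
  proof -
    have "AE x in lebesgue. x \<notin> N"
      using N by (simp add: negligible_iff_null_sets AE_not_in)
    then show ?thesis by (auto simp: AE_restrict_space_iff elim!: eventually_mono)
  qed
  have gm[measurable]: "g n \<in> borel_measurable unit_leb" for n
    by (rule borel_measurable_lebesgue_on_continuous[OF gc])
  have "(\<lambda>n. \<integral>\<^sup>+ x. ennreal (\<bar>cut (real K) (f x) - cut (real K) (g n x)\<bar> powr p) \<partial>unit_leb) \<longlonglongrightarrow> (\<integral>\<^sup>+ x. 0 \<partial>unit_leb)"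
  proof (rule nn_integral_dominated_convergence[where w = "\<lambda>x. ennreal ((2 * real K) powr p)"])
    show "AE x in unit_leb. ennreal (\<bar>cut (real K) (f x) - cut (real K) (g n x)\<bar> powr p) \<le> ennreal ((2 * real K) powr p)" for n
      using p by (intro AE_I2 ennreal_leI powr_mono2) (auto simp: cut_def max_def min_def)
    show "(\<integral>\<^sup>+ x. ennreal ((2 * real K) powr p) \<partial>unit_leb) < \<infinity>"
      by (simp add: emeasure_restrict_space ennreal_mult_less_top)
    have "AE x in unit_leb. x \<in> {0..1}" by (rule AE_I2) simp
    with AEN show "AE x in unit_leb. (\<lambda>n. ennreal (\<bar>cut (real K) (f x) - cut (real K) (g n x)\<bar> powr p)) \<longlonglongrightarrow> 0"
    proof eventually_elim
      case (elim x)
      then have lim: "(\<lambda>n. g n x) \<longlonglongrightarrow> f x" using gl[of x] by simp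
      have "(\<lambda>n. \<bar>cut (real K) (f x) - cut (real K) (g n x)\<bar>) \<longlonglongrightarrow> \<bar>cut (real K) (f x) - cut (real K) (f x)\<bar>"
        unfolding cut_def by (intro tendsto_intros lim)
      then have "(\<lambda>n. \<bar>cut (real K) (f x) - cut (real K) (g n x)\<bar>) \<longlonglongrightarrow> 0" by simp
      then have "(\<lambda>n. \<bar>cut (real K) (f x) - cut (real K) (g n x)\<bar> powr p) \<longlonglongrightarrow> 0"
        by (rule tendsto_zero_powrI[OF _ tendsto_const]) (use p in auto)
      from tendsto_ennrealI[OF this] show ?case by simp
    qed
  qed auto
  then have "\<forall>\<^sub>F n in sequentially. (\<integral>\<^sup>+ x. ennreal (\<bar>cut (real K) (f x) - cut (real K) (g n x)\<bar> powr p) \<partial>unit_leb) < ennreal e1"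
    using e1 by (intro order_tendstoD(2)) auto
  then obtain n where n: "pint p {0..1} (\<lambda>x. cut (real K) (f x) - cut (real K) (g n x)) < ennreal e1"
    unfolding pint_def by (auto simp: eventually_sequentially)
  define u where "u x = cut (real K) (g n x)" for x
  have uc: "continuous_on S u" for S
    unfolding u_def cut_def by (intro continuous_intros continuous_on_subset[OF gc]) auto
  have um[measurable]: "u \<in> borel_measurable unit_leb"
    by (rule borel_measurable_lebesgue_on_continuous[OF uc])
  \<comment> \<open>A uniform distance of \<open>e1 powr (1 / p)\<close> on an interval of length
    \<open>1\<close> costs \<open>e1\<close> in \<open>p\<close>-th powers.\<close>
  have "0 < e1 powr (1 / p)" using e1 by simp
  then obtain q where q: "real_polynomial_function q" "\<And>x. x \<in> {0..1} \<Longrightarrow> \<bar>u x - q x\<bar> < e1 powr (1 / p)"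
    using Stone_Weierstrass_real_polynomial_function[of "{0..1::real}" u "e1 powr (1/p)"] uc by auto
  have qm[measurable]: "q \<in> borel_measurable unit_leb"
    using q(1) by (intro borel_measurable_lebesgue_on_continuous)
      (simp add: continuous_on_polymonial_function real_polynomial_function_eq)
  have uq: "pint p {0..1} (\<lambda>x. u x - q x) \<le> ennreal e1"
  proof (rule pint_le_const)
    fix x :: real assume "x \<in> {0..1}"
    then have "\<bar>u x - q x\<bar> powr p \<le> (e1 powr (1 / p)) powr p"
      using q(2)[of x] p by (intro powr_mono2) auto
    then show "ennreal (\<bar>u x - q x\<bar> powr p) \<le> ennreal e1"
      using p e1 by (intro ennreal_leI) (simp add: powr_powr)
  qed
  have "pint p {0..1} (\<lambda>x. f x - q x) \<le> ennreal c * (pint p {0..1} (\<lambda>x. f x - cut (real K) (f x)) + pint p {0..1} (\<lambda>x. cut (real K) (f x) - q x))"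
    unfolding c_def using p by (intro pint_le_add) auto
  also have "pint p {0..1} (\<lambda>x. cut (real K) (f x) - q x) \<le> ennreal c * (pint p {0..1} (\<lambda>x. cut (real K) (f x) - u x) + pint p {0..1} (\<lambda>x. u x - q x))"
    unfolding c_def using p by (intro pint_le_add) auto
  also have "\<dots> \<le> ennreal c * (ennreal e1 + ennreal e1)"
    using n uq unfolding u_def by (intro mult_left_mono add_mono) auto
  also have "pint p {0..1} (\<lambda>x. f x - cut (real K) (f x)) \<le> ennreal e1" using K by simp
  finally have "pint p {0..1} (\<lambda>x. f x - q x) \<le> ennreal c * (ennreal e1 + ennreal c * (ennreal e1 + ennreal e1))"
    by (simp add: mult_left_mono add_mono)
  also have "\<dots> = ennreal (c * (e1 + c * (e1 + e1)))"
  proof -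
    have "ennreal (c * (e1 + c * (e1 + e1))) = ennreal c * ennreal (e1 + c * (e1 + e1))"
      using c by (intro ennreal_mult') auto
    also have "ennreal (e1 + c * (e1 + e1)) = ennreal e1 + ennreal (c * (e1 + e1))"
      using c e1 by (intro ennreal_plus) auto
    also have "ennreal (c * (e1 + e1)) = ennreal c * ennreal (e1 + e1)"
      using c by (intro ennreal_mult') auto
    also have "ennreal (e1 + e1) = ennreal e1 + ennreal e1"
      using e1 by (intro ennreal_plus) auto
    finally show ?thesis by simp
  qed
  also have "c * (e1 + c * (e1 + e1)) = (c + 2 * c * c) * e1" by (simp add: algebra_simps)
  also have "\<dots> = e" using c by (simp add: e1_def add_pos_pos[THEN less_imp_neq, symmetric])
  finally show ?thesis using q(1) by blast
qed

section \<open>The estimate in terms of the modulus of smoothness\<close>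

text \<open>The factor \<open>\<tau>\<^sup>2 powr p\<close> stands outside the integral of
  \<open>g''\<close>: for \<open>\<tau> = 0\<close> it vanishes, since \<open>0 powr p = 0\<close>,
  whatever the size of \<open>q''\<close>.\<close>

lemma K_functional_bound_polynomial:
  assumes p: "1 \<le> p"
  shows "\<exists>C::ennreal. C \<noteq> top \<and> (\<forall>q \<tau> W. real_polynomial_function q \<longrightarrow> 0 \<le> \<tau> \<longrightarrow> \<tau> \<le> 1/16 \<longrightarrow>
     (\<forall>s\<in>{0..\<tau>}. pint p {0..1 - 2 * s} (second_difference s q) \<le> W) \<longrightarrow>
     (\<exists>g g' g''. C2_fun g g' g'' \<and> pint p {0..1} (\<lambda>x. g x - q x) \<le> C * W \<and>
        ennreal (\<tau>\<^sup>2 powr p) * pint p {0..1} g'' \<le> C * W))"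
proof -
  obtain C where C: "C \<noteq> top" and K: "\<And>f h W. \<lbrakk>continuous_on UNIV f; 0 < h; h \<le> 1/16;
     \<forall>s\<in>{0..h}. pint p {0..1 - 2 * s} (second_difference s f) \<le> W\<rbrakk> \<Longrightarrow>
     (\<exists>g g' g''. C2_fun g g' g'' \<and> pint p {0..1} (\<lambda>x. g x - f x) \<le> C * W \<and>
        pint p {0..1} (\<lambda>x. h\<^sup>2 * g'' x) \<le> C * W)"
    using K_functional_bound[OF p] by blast
  have "\<exists>g g' g''. C2_fun g g' g'' \<and> pint p {0..1} (\<lambda>x. g x - q x) \<le> C * W \<and>
        ennreal (\<tau>\<^sup>2 powr p) * pint p {0..1} g'' \<le> C * W"
    if q: "real_polynomial_function q" and \<tau>: "0 \<le> \<tau>" "\<tau> \<le> 1/16"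
      and W: "\<forall>s\<in>{0..\<tau>}. pint p {0..1 - 2 * s} (second_difference s q) \<le> W" for q \<tau> W
  proof -
    obtain q' q'' where q2: "C2_fun q q' q''" using C2_fun_polynomial[OF q] by blast
    show ?thesis
    proof (cases "\<tau> = 0")
      case True
      have "pint p {0..1} (\<lambda>x. q x - q x) = 0" using p by (simp add: pint_def)
      then show ?thesis using q2 True p by (intro exI[of _ q] exI[of _ q'] exI[of _ q'']) simp
    next
      case False
      then obtain g g' g'' where g: "C2_fun g g' g''" "pint p {0..1} (\<lambda>x. g x - q x) \<le> C * W"
        "pint p {0..1} (\<lambda>x. \<tau>\<^sup>2 * g'' x) \<le> C * W"
        using K[OF C2_funD(3)[OF q2] _ \<tau>(2) W] \<tau> by auto
      have "pint p {0..1} (\<lambda>x. \<tau>\<^sup>2 * g'' x) = ennreal (\<tau>\<^sup>2 powr p) * pint p {0..1} g''"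
        using p by (subst pint_cmult) (auto intro!: borel_measurable_lebesgue_on_continuous C2_funD(5)[OF g(1)])
      then show ?thesis using g by metis
    qed
  qed
  with C show ?thesis by blast
qed

lemma omega2_bound:
  assumes p: "0 < p" and s: "0 \<le> s" "s \<le> 1/2" "ennreal s \<le> \<delta>"
  shows "pint p {0..1 - 2 * s} (second_difference s f) \<le> ennreal_powr (omega2 p f \<delta>) p"
proof (rule pint_le_of_Lp_norm_le[OF p])
  have S: "{x \<in> {0..1}. x + 2 * s \<in> {0..1}} = {0..1 - 2 * s}" using s by auto
  show "Lp_norm p (lebesgue_on {0..1 - 2 * s}) (second_difference s f) \<le> omega2 p f \<delta>"
    unfolding omega2_def S[symmetric] by (rule SUP_upper) (use s in auto)
qed

text \<open>Squaring undoes the root in \<open>t_param\<close>; the two \<open>L_p\<close> norms are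
  then raised to the power \<open>p\<close>, which makes \<open>\<tau>\<^sup>2 powr p\<close> their
  common bound.\<close>

lemma t_param_bounds:
  assumes p: "0 < p" and t: "t_param p T = ennreal \<tau>" and \<tau>: "0 \<le> \<tau>"
  shows "pint p {0..1} (\<lambda>x. T (\<lambda>t. 1) x - 1) \<le> ennreal (\<tau>\<^sup>2 powr p)"
    "pint p {0..1} (diag_eval T (\<lambda>x t. \<bar>t - x\<bar>)) \<le> ennreal (\<tau>\<^sup>2 powr p)"
    "mu_param T \<le> ennreal (\<tau>\<^sup>2)"
proof -
  let ?S = "{Lp_norm p unit_leb (\<lambda>x. T (\<lambda>t. 1) x - 1), Lp_norm p unit_leb (diag_eval T (\<lambda>x t. \<bar>t - x\<bar>)), mu_param T}"
  have "Max ?S = ennreal_powr (ennreal_powr (Max ?S) (1 / 2)) 2" by (simp add: ennreal_powr_powr)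
  also have "ennreal_powr (Max ?S) (1 / 2) = ennreal \<tau>" using t by (simp add: t_param_def)
  also have "ennreal_powr (ennreal \<tau>) 2 = ennreal (\<tau>\<^sup>2)" using \<tau> by (simp add: ennreal_powr_ennreal)
  finally have max: "x \<le> ennreal (\<tau>\<^sup>2)" if "x \<in> ?S" for x
    using Max_ge[OF _ that] by simp
  show "mu_param T \<le> ennreal (\<tau>\<^sup>2)" by (rule max) simp
  have "pint p {0..1} v \<le> ennreal (\<tau>\<^sup>2 powr p)" if "Lp_norm p unit_leb v \<le> ennreal (\<tau>\<^sup>2)" for v
    using pint_le_of_Lp_norm_le[OF p that] by (simp add: ennreal_powr_ennreal)
  then show "pint p {0..1} (\<lambda>x. T (\<lambda>t. 1) x - 1) \<le> ennreal (\<tau>\<^sup>2 powr p)"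
    "pint p {0..1} (diag_eval T (\<lambda>x t. \<bar>t - x\<bar>)) \<le> ennreal (\<tau>\<^sup>2 powr p)"
    by (auto intro: max)
qed

text \<open>\<open>T f - f\<close> is split at \<open>g\<close>: boundedness of \<open>T\<close>
  handles \<open>T f - T g\<close>, the smooth estimate handles \<open>T g - g\<close>, and
  \<open>g - f\<close> is controlled through the polynomial.\<close>

lemma small_t_estimate:
  assumes p: "1 < p" and B: "B \<noteq> top"
  shows "\<exists>C::ennreal. C \<noteq> top \<and> (\<forall>T f \<tau>. sublinear_Lp_operator p T \<longrightarrow> op_norm p T \<le> B \<longrightarrow> f \<in> Lp_space p \<longrightarrow>
     0 \<le> \<tau> \<longrightarrow> \<tau> \<le> 1/16 \<longrightarrow> t_param p T = ennreal \<tau> \<longrightarrow>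
     pint p {0..1} (\<lambda>x. T f x - f x) \<le>
       C * (ennreal (\<tau>\<^sup>2 powr p) * pint p {0..1} f + ennreal_powr (omega2 p f (ennreal \<tau>)) p))"
proof -
  have p0: "0 < p" "0 \<le> p" "1 \<le> p" using p by auto
  obtain C1 where C1: "C1 \<noteq> top" and K: "\<And>q \<tau> W. \<lbrakk>real_polynomial_function q; 0 \<le> \<tau>; \<tau> \<le> 1/16;
     \<forall>s\<in>{0..\<tau>}. pint p {0..1 - 2 * s} (second_difference s q) \<le> W\<rbrakk> \<Longrightarrow>
     (\<exists>g g' g''. C2_fun g g' g'' \<and> pint p {0..1} (\<lambda>x. g x - q x) \<le> C1 * W \<and>
        ennreal (\<tau>\<^sup>2 powr p) * pint p {0..1} g'' \<le> C1 * W)"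
    using K_functional_bound_polynomial[OF p0(3)] by blast
  obtain C2 where C2: "C2 \<noteq> top" and smooth: "\<And>T g g' g'' Z m. \<lbrakk>sublinear_Lp_operator p T; C2_fun g g' g''; 0 \<le> m;
     pint p {0..1} (\<lambda>x. T (\<lambda>t. 1) x - 1) \<le> Z; pint p {0..1} (diag_eval T (\<lambda>x t. \<bar>t - x\<bar>)) \<le> Z;
     mu_param T \<le> ennreal m; ennreal (m powr p) \<le> Z\<rbrakk> \<Longrightarrow>
     pint p {0..1} (\<lambda>x. T g x - g x) \<le> C2 * (Z * (pint p {0..1} g + pint p {0..1} g''))"
    using smooth_estimate[OF p] by blast
  define c where "c = ennreal (2 powr p)"
  define K0 where "K0 = ennreal_powr B p"
  define D where "D = c * (c * (1 + c) + 1)"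
  define CE where "CE = c * (1 + C1 * (c * (1 + D)))"
  define C3 where "C3 = C1 * (c * (1 + D))"
  define C where "C = c * (K0 * CE + c * (C2 * (c * (1 + CE) + C3) + CE))"
  have fin: "c \<noteq> top" "K0 \<noteq> top" "D \<noteq> top" "CE \<noteq> top" "C3 \<noteq> top" "C \<noteq> top"
    using B C1 C2 by (auto simp: c_def K0_def D_def CE_def C3_def C_def ennreal_mult_eq_top_iff)
  have "pint p {0..1} (\<lambda>x. T f x - f x) \<le>
       C * (ennreal (\<tau>\<^sup>2 powr p) * pint p {0..1} f + ennreal_powr (omega2 p f (ennreal \<tau>)) p)"
    if T: "sublinear_Lp_operator p T" and TB: "op_norm p T \<le> B" and f: "f \<in> Lp_space p"
      and \<tau>: "0 \<le> \<tau>" "\<tau> \<le> 1/16" "t_param p T = ennreal \<tau>" for T f \<tau>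
  proof -
    interpret sublinear_Lp_operator p T by (rule T)
    define Z where "Z = ennreal (\<tau>\<^sup>2 powr p)"
    define W where "W = ennreal_powr (omega2 p f (ennreal \<tau>)) p"
    define P where "P = pint p {0..1} f"
    \<comment> \<open>\<open>Z\<close> may thus be dropped in front of \<open>f - g\<close>, while
      the product \<open>Z * P\<close> is kept: it becomes the term with the norm of
      \<open>f\<close>.\<close>
    have Z1: "Z \<le> 1"
    proof -
      have "\<tau>\<^sup>2 powr p \<le> 1" using \<tau> p0 by (intro powr_le1) (auto simp: abs_square_le_1)
      then show ?thesis by (simp add: Z_def)
    qed
    have fm[measurable]: "f \<in> borel_measurable unit_leb" using f by (simp add: Lp_space_iff)
    have approx: "pint p {0..1} (\<lambda>x. T f x - f x) \<le> C * (Z * P + W + ennreal e)" if e: "0 < e" for e :: real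
    proof -
      \<comment> \<open>One quantity dominating every small term, so that all bounds become
        multiples of \<open>Y\<close>; \<open>e\<close> is the distance to the polynomial.\<close>
      define Y where "Y = Z * P + W + ennreal e"
      have YW: "W + ennreal e \<le> Y" and YZ: "Z * P \<le> Y" and Ye: "ennreal e \<le> Y"
        by (auto simp: Y_def add_increasing add_increasing2 add.assoc)
      obtain q where q: "real_polynomial_function q" "pint p {0..1} (\<lambda>x. f x - q x) \<le> ennreal e"
        using polynomial_dense_Lp[OF p0(1) f e] by blast
      obtain q' q'' where q2: "C2_fun q q' q''" using C2_fun_polynomial[OF q(1)] by blast
      have qm[measurable]: "q \<in> borel_measurable unit_leb"
        by (rule borel_measurable_lebesgue_on_continuous[OF C2_funD(3)[OF q2]])
      \<comment> \<open>The modulus controls \<open>f\<close>, not \<open>q\<close>. Second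
        differences of the two differ by those of \<open>f - q\<close>, whose \<open>p\<close>-th
        powers integrate to at most \<open>D * e\<close> for every step.\<close>
      have "\<forall>s\<in>{0..\<tau>}. pint p {0..1 - 2 * s} (second_difference s q) \<le> c * (1 + D) * Y"
      proof
        fix s assume s: "s \<in> {0..\<tau>}"
        let ?S = "{0..1 - 2 * s}"
        have fqm: "(\<lambda>x. f x - q x) \<in> borel_measurable unit_leb" by measurable
        have "pint p ?S (second_difference s q) \<le> c * (pint p ?S (second_difference s f) + pint p ?S (second_difference s (\<lambda>x. f x - q x)))"
          unfolding c_def
        proof (rule pint_le_add)
          show "\<bar>second_difference s q x\<bar> \<le> \<bar>second_difference s f x\<bar> + \<bar>second_difference s (\<lambda>x. f x - q x) x\<bar>" for x
          proof -
            have "second_difference s q x = second_difference s f x - second_difference s (\<lambda>x. f x - q x) x"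
              by (simp add: second_difference_def)
            then show ?thesis by linarith
          qed
        qed (use p0 s second_difference_bound(1)[OF p0(1) fm] second_difference_bound(1)[OF p0(1) fqm] in auto)
        also have "\<dots> \<le> c * (W + D * ennreal e)"
        proof (intro mult_left_mono add_mono)
          show "pint p ?S (second_difference s f) \<le> W"
            unfolding W_def using s \<tau> by (intro omega2_bound p0 ennreal_leI) auto
          have "pint p ?S (second_difference s (\<lambda>x. f x - q x)) \<le> D * pint p {0..1} (\<lambda>x. f x - q x)"
            unfolding D_def c_def using s by (intro second_difference_bound(2) p0 fqm) auto
          also have "\<dots> \<le> D * ennreal e" by (intro mult_left_mono q) auto
          finally show "pint p ?S (second_difference s (\<lambda>x. f x - q x)) \<le> D * ennreal e" .
        qed auto
        also have "\<dots> \<le> c * (Y + D * Y)"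
          using YW Ye by (intro mult_left_mono add_mono) (auto intro: order_trans[rotated])
        also have "\<dots> = c * (1 + D) * Y" by (simp add: algebra_simps)
        finally show "pint p ?S (second_difference s q) \<le> c * (1 + D) * Y" .
      qed
      from K[OF q(1) \<tau>(1,2) this] obtain g g' g'' where g: "C2_fun g g' g''"
        "pint p {0..1} (\<lambda>x. g x - q x) \<le> C3 * Y" "Z * pint p {0..1} g'' \<le> C3 * Y"
        by (auto simp: Z_def C3_def mult.assoc)
      have gL: "g \<in> Lp_space p" by (intro continuous_imp_Lp_space C2_funD(3)[OF g(1)] p0)
      have gm[measurable]: "g \<in> borel_measurable unit_leb" using gL by (simp add: Lp_space_iff)
      have [measurable]: "T f \<in> borel_measurable unit_leb" "T g \<in> borel_measurable unit_leb"
        using T_Lp[OF f] T_Lp[OF gL] by (auto simp: Lp_space_iff)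
      have E: "pint p {0..1} (\<lambda>x. f x - g x) \<le> CE * Y"
      proof -
        have "pint p {0..1} (\<lambda>x. f x - g x) \<le> c * (pint p {0..1} (\<lambda>x. f x - q x) + pint p {0..1} (\<lambda>x. g x - q x))"
          unfolding c_def using p0 by (intro pint_le_add) auto
        also have "\<dots> \<le> c * (Y + C3 * Y)"
          using q(2) Ye g(2) by (intro mult_left_mono add_mono) auto
        finally show ?thesis by (simp add: CE_def C3_def algebra_simps)
      qed
      have 1: "pint p {0..1} (\<lambda>x. T f x - T g x) \<le> K0 * (CE * Y)"
      proof -
        have k: "(\<lambda>t. \<bar>f t - g t\<bar>) \<in> Lp_space p" by (intro Lp_space_abs Lp_space_diff p0 f gL)
        have "pint p {0..1} (\<lambda>x. T f x - T g x) \<le> pint p {0..1} (T (\<lambda>t. \<bar>f t - g t\<bar>))"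
          using T_abs_diff_le[OF f gL] p0 by (intro pint_mono_AE) (auto elim!: eventually_mono)
        also have "\<dots> \<le> K0 * pint p {0..1} (\<lambda>t. \<bar>f t - g t\<bar>)"
          unfolding K0_def by (rule T_bound[OF TB k])
        also have "pint p {0..1} (\<lambda>t. \<bar>f t - g t\<bar>) = pint p {0..1} (\<lambda>t. f t - g t)" by (simp add: pint_def)
        also have "K0 * \<dots> \<le> K0 * (CE * Y)" by (intro mult_left_mono E) auto
        finally show ?thesis .
      qed
      have 2: "pint p {0..1} (\<lambda>x. T g x - g x) \<le> C2 * (c * (Y + CE * Y) + C3 * Y)"
      proof -
        have "pint p {0..1} (\<lambda>x. T g x - g x) \<le> C2 * (Z * (pint p {0..1} g + pint p {0..1} g''))"
          by (rule smooth[OF T g(1), of "\<tau>\<^sup>2"]) (use t_param_bounds[OF p0(1) \<tau>(3,1)] in \<open>auto simp: Z_def\<close>)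
        also have "\<dots> = C2 * (Z * pint p {0..1} g + Z * pint p {0..1} g'')" by (simp add: algebra_simps)
        also have "\<dots> \<le> C2 * (Z * (c * (P + CE * Y)) + C3 * Y)"
        proof (intro mult_left_mono add_mono g)
          have "pint p {0..1} g \<le> c * (pint p {0..1} f + pint p {0..1} (\<lambda>x. f x - g x))"
            unfolding c_def using p0 by (intro pint_le_add) auto
          also have "\<dots> \<le> c * (P + CE * Y)" unfolding P_def by (intro mult_left_mono add_mono E) auto
          finally show "pint p {0..1} g \<le> c * (P + CE * Y)" .
        qed auto
        also have "\<dots> = C2 * (c * (Z * P + Z * (CE * Y)) + C3 * Y)" by (simp add: algebra_simps)
        also have "\<dots> \<le> C2 * (c * (Y + 1 * (CE * Y)) + C3 * Y)"
          by (intro mult_left_mono add_mono mult_right_mono Z1 YZ) auto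
        finally show ?thesis by simp
      qed
      have "pint p {0..1} (\<lambda>x. T f x - f x) \<le> c * (pint p {0..1} (\<lambda>x. T f x - T g x) + pint p {0..1} (\<lambda>x. T g x - f x))"
        unfolding c_def using p0 by (intro pint_le_add) auto
      also have "pint p {0..1} (\<lambda>x. T g x - f x) \<le> c * (pint p {0..1} (\<lambda>x. T g x - g x) + pint p {0..1} (\<lambda>x. f x - g x))"
        unfolding c_def using p0 by (intro pint_le_add) auto
      also have "\<dots> \<le> c * (C2 * (c * (Y + CE * Y) + C3 * Y) + CE * Y)"
        by (intro mult_left_mono add_mono 2 E) auto
      also note 1
      finally have "pint p {0..1} (\<lambda>x. T f x - f x) \<le> c * (K0 * (CE * Y) + c * (C2 * (c * (Y + CE * Y) + C3 * Y) + CE * Y))"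
        by (simp add: mult_left_mono add_mono)
      also have "\<dots> = C * Y" by (simp add: C_def algebra_simps)
      finally show ?thesis by (simp add: Y_def)
    qed
    have "pint p {0..1} (\<lambda>x. T f x - f x) \<le> C * (Z * P + W)"
    proof (rule ennreal_le_epsilon)
      fix e :: real assume e: "0 < e"
      obtain r where r: "0 \<le> r" "C = ennreal r" using fin(6) by (cases C) auto
      \<comment> \<open>The divisor \<open>r + 1\<close> is positive without an argument that
        \<open>C\<close> is nonzero, and \<open>r * e' \<le> e\<close> is enough.\<close>
      define e' where "e' = e / (r + 1)"
      have e': "0 < e'" using e r by (simp add: e'_def)
      have "C * ennreal e' = ennreal (r * e')" using r e' by (simp add: ennreal_mult)
      also have "\<dots> \<le> ennreal e"
        using r e by (intro ennreal_leI) (simp add: e'_def field_simps)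
      finally have "C * (Z * P + W + ennreal e') \<le> C * (Z * P + W) + ennreal e"
        by (simp add: distrib_left add_left_mono)
      then show "pint p {0..1} (\<lambda>x. T f x - f x) \<le> C * (Z * P + W) + ennreal e"
        using approx[OF e'] by (rule order_trans[rotated])
    qed
    then show ?thesis by (simp add: Z_def P_def W_def)
  qed
  with fin(6) show ?thesis by blast
qed

theorem theorem4:
  fixes p :: real and T :: "nat \<Rightarrow> (real \<Rightarrow> real) \<Rightarrow> real \<Rightarrow> real"
  assumes "1 < p"
    and "\<And>n. Lp_operator p (T n)"
    and "uniformly_bounded_ops p T"
    and "\<And>n. strongly_translatable_op p (T n)"
    and "\<And>n. sublinear_op p (T n)"
    and "\<And>n. monotone_op p (T n)"
    and "(\<lambda>n. t_param p (T n)) \<longlonglongrightarrow> 0"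
  shows "\<exists>M::real. M > 0 \<and>
    (\<forall>f\<in>Lp_space p. \<forall>n.
      Lp_norm p unit_leb (\<lambda>x. T n f x - f x)
        \<le> ennreal M * ((t_param p (T n))\<^sup>2 * Lp_norm p unit_leb f + omega2 p f (t_param p (T n))))"
proof -
  have p0: "0 < p" "0 \<le> p" using assms(1) by auto
  define B where "B = (SUP n. op_norm p (T n))"
  have B: "B \<noteq> top" using assms(3) unfolding uniformly_bounded_ops_def B_def less_top infinity_ennreal_def .
  have TB: "op_norm p (T n) \<le> B" for n unfolding B_def by (rule SUP_upper) simp
  have op: "sublinear_Lp_operator p (T n)" for n using assms by unfold_locales
  obtain C where C: "C \<noteq> top" and small: "\<And>T f \<tau>. \<lbrakk>sublinear_Lp_operator p T; op_norm p T \<le> B; f \<in> Lp_space p;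
     0 \<le> \<tau>; \<tau> \<le> 1/16; t_param p T = ennreal \<tau>\<rbrakk> \<Longrightarrow> pint p {0..1} (\<lambda>x. T f x - f x) \<le>
       C * (ennreal (\<tau>\<^sup>2 powr p) * pint p {0..1} f + ennreal_powr (omega2 p f (ennreal \<tau>)) p)"
    using small_t_estimate[OF assms(1) B] by blast
  \<comment> \<open>\<open>c\<close> belongs to the bound of \<open>T f - f\<close> by boundedness
    alone. In \<open>C'\<close>, \<open>256 = 16^2\<close> compensates for the square of a
    \<open>t\<close> above \<open>1/16\<close>, and \<open>2 * C\<close> arises because each of two
    \<open>p\<close>-th powers is bounded by that of the sum.\<close>
  define c where "c = ennreal (2 powr p) * (ennreal_powr B p + 1)"
  define C' where "C' = 2 * C + c * ennreal (256 powr p)"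
  have fin: "C' \<noteq> top" using B C by (simp add: C'_def c_def ennreal_mult_eq_top_iff)
  have main: "pint p {0..1} (\<lambda>x. T n f x - f x) \<le>
      C' * ennreal_powr ((t_param p (T n))\<^sup>2 * Lp_norm p unit_leb f + omega2 p f (t_param p (T n))) p"
    (is "_ \<le> C' * ennreal_powr (?X + ?\<omega>) p")
    if f: "f \<in> Lp_space p" for f n
  proof -
    interpret sublinear_Lp_operator p "T n" by (rule op)
    have Xp: "ennreal_powr ?X p = ennreal_powr ((t_param p (T n))\<^sup>2) p * pint p {0..1} f"
      using p0 by (simp add: ennreal_powr_mult Lp_norm_eq ennreal_powr_powr)
    have le: "ennreal_powr ?X p \<le> ennreal_powr (?X + ?\<omega>) p" "ennreal_powr ?\<omega> p \<le> ennreal_powr (?X + ?\<omega>) p"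
      using p0 by (auto intro!: ennreal_powr_mono)
    show ?thesis
    proof (cases "t_param p (T n) \<le> ennreal (1/16)")
      case True
      then obtain \<tau> where \<tau>: "0 \<le> \<tau>" "t_param p (T n) = ennreal \<tau>"
        by (cases "t_param p (T n)") (auto simp: top_unique)
      then have \<tau>16: "\<tau> \<le> 1/16" using True by simp
      have "pint p {0..1} (\<lambda>x. T n f x - f x) \<le> C * (ennreal_powr ?X p + ennreal_powr ?\<omega> p)"
        using small[OF op TB f \<tau>(1) \<tau>16 \<tau>(2)] \<tau> unfolding Xp
        by (simp add: ennreal_power ennreal_powr_ennreal)
      also have "\<dots> \<le> C * (ennreal_powr (?X + ?\<omega>) p + ennreal_powr (?X + ?\<omega>) p)"
        by (intro mult_left_mono add_mono le) auto
      also have "\<dots> = 2 * C * ennreal_powr (?X + ?\<omega>) p" by (simp add: mult_2[symmetric] mult_ac)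
      also have "\<dots> \<le> C' * ennreal_powr (?X + ?\<omega>) p" unfolding C'_def by (intro mult_right_mono) auto
      finally show ?thesis .
    next
      \<comment> \<open>This case includes \<open>t_param p (T n) = \<infinity>\<close>.\<close>
      case False
      have [measurable]: "f \<in> borel_measurable unit_leb" "T n f \<in> borel_measurable unit_leb"
        using f T_Lp[OF f] by (auto simp: Lp_space_iff)
      have "pint p {0..1} (\<lambda>x. T n f x - f x) \<le> ennreal (2 powr p) * (pint p {0..1} (T n f) + pint p {0..1} f)"
        using p0 by (intro pint_le_add) auto
      also have "\<dots> \<le> ennreal (2 powr p) * (ennreal_powr B p * pint p {0..1} f + pint p {0..1} f)"
        by (intro mult_left_mono add_mono T_bound TB f) auto
      also have "\<dots> = c * (1 * pint p {0..1} f)" by (simp add: c_def algebra_simps)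
      also have "\<dots> \<le> c * (ennreal (256 powr p) * ennreal_powr ((t_param p (T n))\<^sup>2) p * pint p {0..1} f)"
      proof (intro mult_left_mono mult_right_mono)
        have "ennreal ((1/16)\<^sup>2) = ennreal (1/16) ^ 2" by (subst ennreal_power) auto
        also have "\<dots> \<le> (t_param p (T n))\<^sup>2" using False by (intro power_mono) auto
        finally have "ennreal_powr (ennreal ((1/16)\<^sup>2)) p \<le> ennreal_powr ((t_param p (T n))\<^sup>2) p"
          using p0 by (intro ennreal_powr_mono) auto
        then have "ennreal (256 powr p) * ennreal (((1/16)\<^sup>2) powr p) \<le> ennreal (256 powr p) * ennreal_powr ((t_param p (T n))\<^sup>2) p"
          by (intro mult_left_mono) (auto simp: ennreal_powr_ennreal)
        moreover have "ennreal (256 powr p) * ennreal (((1/16)\<^sup>2) powr p) = 1"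
          by (subst ennreal_mult[symmetric]) (auto simp: powr_mult[symmetric] power2_eq_square)
        ultimately show "1 \<le> ennreal (256 powr p) * ennreal_powr ((t_param p (T n))\<^sup>2) p" by simp
      qed auto
      also have "\<dots> = c * ennreal (256 powr p) * ennreal_powr ?X p" unfolding Xp by (simp add: mult_ac)
      also have "\<dots> \<le> C' * ennreal_powr (?X + ?\<omega>) p"
        unfolding C'_def by (intro mult_mono le) auto
      finally show ?thesis .
    qed
  qed
  obtain r where r: "0 \<le> r" "C' = ennreal r" using fin by (cases C') auto
  show ?thesis
  \<comment> \<open>Taking the \<open>p\<close>-th root turns the constant \<open>r\<close> into
    \<open>r powr (1 / p)\<close>; the added \<open>1\<close> makes positivity immediate.\<close>
  proof (intro exI[of _ "r powr (1 / p) + 1"] conjI ballI allI)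
    show "0 < r powr (1 / p) + 1" by (simp add: add_nonneg_pos)
    fix f n assume f: "f \<in> Lp_space p"
    let ?Y = "(t_param p (T n))\<^sup>2 * Lp_norm p unit_leb f + omega2 p f (t_param p (T n))"
    have "Lp_norm p unit_leb (\<lambda>x. T n f x - f x) \<le> ennreal_powr (C' * ennreal_powr ?Y p) (1 / p)"
      unfolding Lp_norm_eq[of p "{0..1}" "\<lambda>x. T n f x - f x"] using p0 by (intro ennreal_powr_mono main f) auto
    also have "\<dots> = ennreal (r powr (1 / p)) * ?Y"
      using p0 r by (simp add: ennreal_powr_mult ennreal_powr_powr ennreal_powr_ennreal)
    also have "\<dots> \<le> ennreal (r powr (1 / p) + 1) * ?Y"
      by (intro mult_right_mono ennreal_leI) auto
    finally show "Lp_norm p unit_leb (\<lambda>x. T n f x - f x) \<le> ennreal (r powr (1 / p) + 1) * ?Y" .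
  qed
qed

end
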